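(* Let $\mathcal{S}_1\xrightarrow{\phi_1}\mathcal{S}_2\xrightarrow{\phi_2}\mathcal{S}_3\xrightarrow{\phi_3}\cdots$ be an inductive system in the category $\mathbf{OS}$ of operator systems and unital completely positive maps, and let $\mathcal{T}$ be an operator system. Then $\varinjlim_{\mathbf{OS}}(\mathcal{S}_k\otimes_{\max}\mathcal{T})$ (with connecting maps $\phi_k\otimes\mathrm{id}_{\mathcal{T}}$) is unitally completely order isomorphic to $(\varinjlim_{\mathbf{OS}}\mathcal{S}_k)\otimes_{\max}\mathcal{T}$.
   Context: An operator system (not assumed complete) is a matrix ordered $*$-vector space with an Archimedean matrix order unit. Inductive limits in $\mathbf{OS}$ (objects with compatible unital completely positive maps, universal with this property) exist and are unique up to unital complete order isomorphism (a unital linear bijection, completely positive with completely positive inverse). For operator systems $\mathcal{S},\mathcal{T}$ let $P_n^{\max}(\mathcal{S},\mathcal{T})=\{\alpha(C\otimes D)\alpha^*:C\in M_k(\mathcal{S})^+,\ D\in M_m(\mathcal{T})^+,\ \alpha\in M_{n,km}(\mathbb{C}),\ k,m\in\mathbb{N}\}\subseteq M_n(\mathcal{S}\odot\mathcal{T})$, where $\odot$ is the algebraic tensor product. The maximal tensor product $\mathcal{S}\otimes_{\max}\mathcal{T}$ is the Archimedeanisation of $(\mathcal{S}\odot\mathcal{T},\{P_n^{\max}(\mathcal{S},\mathcal{T})\}_n,e_{\mathcal{S}}\otimes e_{\mathcal{T}})$; its underlying space is $\mathcal{S}\odot\mathcal{T}$ and $X\in M_n(\mathcal{S}\otimes_{\max}\mathcal{T})^+$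 if and only if $r(e_{\mathcal{S}}\otimes e_{\mathcal{T}})^{(n)}+X\in P_n^{\max}(\mathcal{S},\mathcal{T})$ for every $r>0$. It is functorial: tensor products of unital completely positive maps are unital completely positive. *)

theory Defs
  imports
    "HOL-Algebra.Module"
    "HOL-Library.Poly_Mapping"
    "Jordan_Normal_Form.Matrix"
begin

section \<open>Complex \<open>*\<close>-vector spaces\<close>

text \<open>
  Vector spaces are modules, in the sense of \<open>HOL-Algebra\<close>, over the field of complex numbers.
  The ring record underlying a module also has fields \<open>mult\<close> and \<open>one\<close>; nothing depends on them.
\<close>

definition complex_field :: "complex ring" where
  "complex_field = \<lparr>carrier = UNIV, mult = (*), one = 1, zero = 0, add = (+)\<rparr>"

record 'a star_space = "(complex, 'a) module" +
  invol :: "'a \<Rightarrow> 'a"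

locale star_vector_space =
  fixes V :: "('a, 'z) star_space_scheme"
  assumes module: "Module.module complex_field V"
    and invol_closed: "x \<in> carrier V \<Longrightarrow> invol V x \<in> carrier V"
    and invol_invol: "x \<in> carrier V \<Longrightarrow> invol V (invol V x) = x"
    and invol_add: "x \<in> carrier V \<Longrightarrow> y \<in> carrier V \<Longrightarrow>
      invol V (x \<oplus>\<^bsub>V\<^esub> y) = invol V x \<oplus>\<^bsub>V\<^esub> invol V y"
    and invol_smult: "x \<in> carrier V \<Longrightarrow> invol V (c \<odot>\<^bsub>V\<^esub> x) = cnj c \<odot>\<^bsub>V\<^esub> invol V x"

section \<open>Square matrices over a \<open>*\<close>-vector space\<close>

definition mats :: "('a, 'z) star_space_scheme \<Rightarrow> nat \<Rightarrow> 'a mat set" where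
  "mats V n = {A \<in> carrier_mat n n. \<forall>i<n. \<forall>j<n. A $$ (i, j) \<in> carrier V}"

definition mat_zero :: "('a, 'z) star_space_scheme \<Rightarrow> nat \<Rightarrow> 'a mat" where
  "mat_zero V n = mat n n (\<lambda>_. \<zero>\<^bsub>V\<^esub>)"

definition mat_add :: "('a, 'z) star_space_scheme \<Rightarrow> 'a mat \<Rightarrow> 'a mat \<Rightarrow> 'a mat" where
  "mat_add V A B = mat (dim_row A) (dim_col A) (\<lambda>ij. A $$ ij \<oplus>\<^bsub>V\<^esub> B $$ ij)"

definition mat_neg :: "('a, 'z) star_space_scheme \<Rightarrow> 'a mat \<Rightarrow> 'a mat" where
  "mat_neg V A = map_mat (\<lambda>x. \<ominus>\<^bsub>V\<^esub> x) A"

definition mat_scale :: "('a, 'z) star_space_scheme \<Rightarrow> complex \<Rightarrow> 'a mat \<Rightarrow> 'a mat" where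
  "mat_scale V c A = map_mat (\<lambda>x. c \<odot>\<^bsub>V\<^esub> x) A"

definition mat_star :: "('a, 'z) star_space_scheme \<Rightarrow> 'a mat \<Rightarrow> 'a mat" where
  "mat_star V A = mat (dim_col A) (dim_row A) (\<lambda>(i, j). invol V (A $$ (j, i)))"

definition herm_mats :: "('a, 'z) star_space_scheme \<Rightarrow> nat \<Rightarrow> 'a mat set" where
  "herm_mats V n = {A \<in> mats V n. mat_star V A = A}"

definition mat_diag_const :: "('a, 'z) star_space_scheme \<Rightarrow> nat \<Rightarrow> 'a \<Rightarrow> 'a mat" where
  "mat_diag_const V n x = mat n n (\<lambda>(i, j). if i = j then x else \<zero>\<^bsub>V\<^esub>)"

text \<open>\<open>\<alpha> A \<alpha>\<^sup>*\<close> for a scalar \<open>n \<times> m\<close> matrix \<open>\<alpha>\<close> and an \<open>m \<times> m\<close> matrix \<open>A\<close> over \<open>V\<close>.\<close>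

definition mat_conj :: "('a, 'z) star_space_scheme \<Rightarrow> complex mat \<Rightarrow> 'a mat \<Rightarrow> 'a mat" where
  "mat_conj V \<alpha> A = mat (dim_row \<alpha>) (dim_row \<alpha>) (\<lambda>(i, j).
     \<Oplus>\<^bsub>V\<^esub>k\<in>{..<dim_col \<alpha>}. \<Oplus>\<^bsub>V\<^esub>l\<in>{..<dim_col \<alpha>}.
       (\<alpha> $$ (i, k) * cnj (\<alpha> $$ (j, l))) \<odot>\<^bsub>V\<^esub> (A $$ (k, l)))"

section \<open>Operator systems\<close>

text \<open>
  \<open>mpos V n\<close> is the cone \<open>M\<^sub>n(V)\<^sup>+\<close>. Only the values at \<open>n \<ge> 1\<close> are constrained or used.
\<close>

record 'a op_sys = "'a star_space" +
  ounit :: 'a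
  mpos :: "nat \<Rightarrow> 'a mat set"

locale matrix_ordered_space = star_vector_space V for V :: "('a, 'z) op_sys_scheme" +
  assumes mpos_herm: "n > 0 \<Longrightarrow> mpos V n \<subseteq> herm_mats V n"
    and mpos_nonempty: "n > 0 \<Longrightarrow> mpos V n \<noteq> {}"
    and mpos_add: "n > 0 \<Longrightarrow> A \<in> mpos V n \<Longrightarrow> B \<in> mpos V n \<Longrightarrow> mat_add V A B \<in> mpos V n"
    and mpos_scale: "n > 0 \<Longrightarrow> A \<in> mpos V n \<Longrightarrow> (r::real) \<ge> 0 \<Longrightarrow>
      mat_scale V (complex_of_real r) A \<in> mpos V n"
    and mpos_proper: "n > 0 \<Longrightarrow> A \<in> mpos V n \<Longrightarrow> mat_neg V A \<in> mpos V n \<Longrightarrow> A = mat_zero V n"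
    and mpos_conj: "n > 0 \<Longrightarrow> m > 0 \<Longrightarrow> \<alpha> \<in> carrier_mat n m \<Longrightarrow> A \<in> mpos V m \<Longrightarrow>
      mat_conj V \<alpha> A \<in> mpos V n"

locale operator_system = matrix_ordered_space V for V :: "('a, 'z) op_sys_scheme" +
  assumes ounit_closed: "ounit V \<in> carrier V"
    and ounit_herm: "invol V (ounit V) = ounit V"
    and matrix_order_unit: "n > 0 \<Longrightarrow> A \<in> herm_mats V n \<Longrightarrow>
      \<exists>r::real. r > 0 \<and>
        mat_add V (mat_scale V (complex_of_real r) (mat_diag_const V n (ounit V))) (mat_neg V A)
          \<in> mpos V n"
    and archimedean: "n > 0 \<Longrightarrow> A \<in> mats V n \<Longrightarrow>
      (\<And>r::real. r > 0 \<Longrightarrow>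
        mat_add V (mat_scale V (complex_of_real r) (mat_diag_const V n (ounit V))) A \<in> mpos V n)
      \<Longrightarrow> A \<in> mpos V n"

definition linear_map ::
  "('a, 'y) star_space_scheme \<Rightarrow> ('b, 'z) star_space_scheme \<Rightarrow> ('a \<Rightarrow> 'b) \<Rightarrow> bool" where
  "linear_map V W f \<longleftrightarrow> f \<in> carrier V \<rightarrow> carrier W \<and>
     (\<forall>x\<in>carrier V. \<forall>y\<in>carrier V. f (x \<oplus>\<^bsub>V\<^esub> y) = f x \<oplus>\<^bsub>W\<^esub> f y) \<and>
     (\<forall>c. \<forall>x\<in>carrier V. f (c \<odot>\<^bsub>V\<^esub> x) = c \<odot>\<^bsub>W\<^esub> f x)"

definition completely_positive :: "'a op_sys \<Rightarrow> 'b op_sys \<Rightarrow> ('a \<Rightarrow> 'b) \<Rightarrow> bool" where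
  "completely_positive V W f \<longleftrightarrow> linear_map V W f \<and>
     (\<forall>n>0. \<forall>A\<in>mpos V n. map_mat f A \<in> mpos W n)"

definition ucp :: "'a op_sys \<Rightarrow> 'b op_sys \<Rightarrow> ('a \<Rightarrow> 'b) \<Rightarrow> bool" where
  "ucp V W f \<longleftrightarrow> completely_positive V W f \<and> f (ounit V) = ounit W"

definition unital_complete_order_iso :: "'a op_sys \<Rightarrow> 'b op_sys \<Rightarrow> ('a \<Rightarrow> 'b) \<Rightarrow> bool" where
  "unital_complete_order_iso V W f \<longleftrightarrow> bij_betw f (carrier V) (carrier W) \<and> ucp V W f \<and>
     completely_positive W V (inv_into (carrier V) f)"

definition uco_isomorphic :: "'a op_sys \<Rightarrow> 'b op_sys \<Rightarrow> bool" where
  "uco_isomorphic V W \<longleftrightarrow> (\<exists>f. unital_complete_order_iso V W f)"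

section \<open>Inductive limits\<close>

definition inductive_system :: "(nat \<Rightarrow> 'a op_sys) \<Rightarrow> (nat \<Rightarrow> 'a \<Rightarrow> 'a) \<Rightarrow> bool" where
  "inductive_system S \<phi> \<longleftrightarrow>
     (\<forall>k. operator_system (S k)) \<and> (\<forall>k. ucp (S k) (S (Suc k)) (\<phi> k))"

definition compatible_maps ::
  "(nat \<Rightarrow> 'a op_sys) \<Rightarrow> (nat \<Rightarrow> 'a \<Rightarrow> 'a) \<Rightarrow> 'r op_sys \<Rightarrow> (nat \<Rightarrow> 'a \<Rightarrow> 'r) \<Rightarrow> bool" where
  "compatible_maps S \<phi> R \<rho> \<longleftrightarrow>
     (\<forall>k. ucp (S k) R (\<rho> k)) \<and> (\<forall>k. \<forall>x\<in>carrier (S k). \<rho> (Suc k) (\<phi> k x) = \<rho> k x)"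

text \<open>
  \<open>(L, \<psi>)\<close> is an inductive limit of \<open>(S, \<phi>)\<close>: the universal object with compatible unital
  completely positive maps. A quantifier in HOL cannot range over operator systems of all types,
  so the universal property is tested against those whose elements have type \<open>nat \<times> 'a\<close>.
  This universe is large enough to determine the limit: the limit is a quotient of the disjoint
  union of the \<open>S k\<close>, and choosing representatives \<open>(k, x)\<close> gives a copy of it
  with carrier in \<open>nat \<times> 'a\<close>. The object \<open>L\<close> itself may be of any type; two maps
  into \<open>L\<close> that agree after composition with all states are equal, and the complex numbers have a
  copy in the universe as soon as some \<open>S k\<close> is nonzero, so \<open>L\<close> is determined up to
  unital complete order isomorphism. An object that is universal among operator systems of every
  type satisfies this condition in particular.
\<close>

definition inductive_limit ::
  "(nat \<Rightarrow> 'a op_sys) \<Rightarrow> (nat \<Rightarrow> 'a \<Rightarrow> 'a) \<Rightarrow> 'l op_sys \<Rightarrow> (nat \<Rightarrow> 'a \<Rightarrow> 'l) \<Rightarrow> bool" where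
  "inductive_limit S \<phi> L \<psi> \<longleftrightarrow>
     operator_system L \<and> compatible_maps S \<phi> L \<psi> \<and>
     (\<forall>(R :: (nat \<times> 'a) op_sys) \<rho>. operator_system R \<and> compatible_maps S \<phi> R \<rho> \<longrightarrow>
        (\<exists>h. ucp L R h \<and> (\<forall>k. \<forall>x\<in>carrier (S k). h (\<psi> k x) = \<rho> k x)) \<and>
        (\<forall>h h'. ucp L R h \<and> (\<forall>k. \<forall>x\<in>carrier (S k). h (\<psi> k x) = \<rho> k x) \<and>
                ucp L R h' \<and> (\<forall>k. \<forall>x\<in>carrier (S k). h' (\<psi> k x) = \<rho> k x) \<longrightarrow>
                (\<forall>z\<in>carrier L. h z = h' z)))"

section \<open>The algebraic tensor product\<close>

text \<open>
  The free vector space on \<open>carrier S \<times> carrier T\<close>, its subspace generated by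
  the bilinearity relations, and the quotient, whose elements are cosets.
\<close>

definition tensor_free ::
  "('a, 'y) star_space_scheme \<Rightarrow> ('b, 'z) star_space_scheme \<Rightarrow> ('a \<times> 'b \<Rightarrow>\<^sub>0 complex) set" where
  "tensor_free S T = {f. Poly_Mapping.keys f \<subseteq> carrier S \<times> carrier T}"

inductive_set tensor_null ::
  "('a, 'y) star_space_scheme \<Rightarrow> ('b, 'z) star_space_scheme \<Rightarrow> ('a \<times> 'b \<Rightarrow>\<^sub>0 complex) set"
  for S :: "('a, 'y) star_space_scheme" and T :: "('b, 'z) star_space_scheme" where
  null_zero: "0 \<in> tensor_null S T"
| null_add: "f \<in> tensor_null S T \<Longrightarrow> g \<in> tensor_null S T \<Longrightarrow> f + g \<in> tensor_null S T"
| null_scale: "f \<in> tensor_null S T \<Longrightarrow> Poly_Mapping.map ((*) c) f \<in> tensor_null S T"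
| add_left: "x \<in> carrier S \<Longrightarrow> x' \<in> carrier S \<Longrightarrow> y \<in> carrier T \<Longrightarrow>
    Poly_Mapping.single (x \<oplus>\<^bsub>S\<^esub> x', y) 1 - Poly_Mapping.single (x, y) 1
      - Poly_Mapping.single (x', y) 1 \<in> tensor_null S T"
| add_right: "x \<in> carrier S \<Longrightarrow> y \<in> carrier T \<Longrightarrow> y' \<in> carrier T \<Longrightarrow>
    Poly_Mapping.single (x, y \<oplus>\<^bsub>T\<^esub> y') 1 - Poly_Mapping.single (x, y) 1
      - Poly_Mapping.single (x, y') 1 \<in> tensor_null S T"
| smult_left: "x \<in> carrier S \<Longrightarrow> y \<in> carrier T \<Longrightarrow>
    Poly_Mapping.single (c \<odot>\<^bsub>S\<^esub> x, y) 1 - Poly_Mapping.single (x, y) c \<in> tensor_null S T"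
| smult_right: "x \<in> carrier S \<Longrightarrow> y \<in> carrier T \<Longrightarrow>
    Poly_Mapping.single (x, c \<odot>\<^bsub>T\<^esub> y) 1 - Poly_Mapping.single (x, y) c \<in> tensor_null S T"

type_synonym ('a, 'b) tensor = "('a \<times> 'b \<Rightarrow>\<^sub>0 complex) set"

definition tensor_class ::
  "('a, 'y) star_space_scheme \<Rightarrow> ('b, 'z) star_space_scheme \<Rightarrow>
   ('a \<times> 'b \<Rightarrow>\<^sub>0 complex) \<Rightarrow> ('a, 'b) tensor" where
  "tensor_class S T f = {g. g - f \<in> tensor_null S T}"

definition tensor_rep :: "('a, 'b) tensor \<Rightarrow> ('a \<times> 'b \<Rightarrow>\<^sub>0 complex)" where
  "tensor_rep X = (SOME f. f \<in> X)"

definition pure_tensor ::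
  "('a, 'y) star_space_scheme \<Rightarrow> ('b, 'z) star_space_scheme \<Rightarrow> 'a \<Rightarrow> 'b \<Rightarrow> ('a, 'b) tensor" where
  "pure_tensor S T x y = tensor_class S T (Poly_Mapping.single (x, y) 1)"

text \<open>The involution is determined by \<open>(x \<otimes> y)\<^sup>* = x\<^sup>* \<otimes> y\<^sup>*\<close> and conjugate linearity.\<close>

definition alg_tensor ::
  "('a, 'y) star_space_scheme \<Rightarrow> ('b, 'z) star_space_scheme \<Rightarrow> ('a, 'b) tensor star_space" where
  "alg_tensor S T = \<lparr>
     carrier = tensor_class S T ` tensor_free S T,
     mult = undefined,
     one = undefined,
     zero = tensor_class S T 0,
     add = (\<lambda>X Y. tensor_class S T (tensor_rep X + tensor_rep Y)),
     smult = (\<lambda>c X. tensor_class S T (Poly_Mapping.map ((*) c) (tensor_rep X))),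
     invol = (\<lambda>X. tensor_class S T
       (\<Sum>p\<in>Poly_Mapping.keys (tensor_rep X).
          Poly_Mapping.single (invol S (fst p), invol T (snd p))
            (cnj (Poly_Mapping.lookup (tensor_rep X) p))))\<rparr>"

text \<open>\<open>f \<otimes> g\<close> as a map from the tensor product of two spaces to that of \<open>S'\<close> and \<open>T'\<close>.\<close>

definition tensor_map ::
  "('c, 'y) star_space_scheme \<Rightarrow> ('d, 'z) star_space_scheme \<Rightarrow>
   ('a \<Rightarrow> 'c) \<Rightarrow> ('b \<Rightarrow> 'd) \<Rightarrow> ('a, 'b) tensor \<Rightarrow> ('c, 'd) tensor" where
  "tensor_map S' T' f g X = tensor_class S' T'
     (\<Sum>p\<in>Poly_Mapping.keys (tensor_rep X).
        Poly_Mapping.single (f (fst p), g (snd p)) (Poly_Mapping.lookup (tensor_rep X) p))"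

section \<open>The maximal tensor product\<close>

text \<open>
  \<open>C \<otimes> D \<in> M\<^sub>k\<^sub>m(S \<odot> T)\<close> for \<open>C \<in> M\<^sub>k(S)\<close> and \<open>D \<in> M\<^sub>m(T)\<close>, with the index
  pair \<open>(i, i')\<close>, \<open>i < k\<close>, \<open>i' < m\<close>, encoded as \<open>i * m + i'\<close>.
\<close>

definition mat_tensor ::
  "('a, 'y) star_space_scheme \<Rightarrow> ('b, 'z) star_space_scheme \<Rightarrow>
   'a mat \<Rightarrow> 'b mat \<Rightarrow> ('a, 'b) tensor mat" where
  "mat_tensor S T C D = (let m = dim_row D in
     mat (dim_row C * m) (dim_row C * m) (\<lambda>(i, j).
       pure_tensor S T (C $$ (i div m, j div m)) (D $$ (i mod m, j mod m))))"

definition P_max :: "'a op_sys \<Rightarrow> 'b op_sys \<Rightarrow> nat \<Rightarrow> ('a, 'b) tensor mat set" where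
  "P_max S T n = {mat_conj (alg_tensor S T) \<alpha> (mat_tensor S T C D) | \<alpha> C D k m.
     k > 0 \<and> m > 0 \<and> C \<in> mpos S k \<and> D \<in> mpos T m \<and> \<alpha> \<in> carrier_mat n (k * m)}"

definition max_tensor :: "'a op_sys \<Rightarrow> 'b op_sys \<Rightarrow> ('a, 'b) tensor op_sys" where
  "max_tensor S T = star_space.extend (alg_tensor S T)
     (op_sys.fields
       (pure_tensor S T (ounit S) (ounit T))
       (\<lambda>n. {X \<in> mats (alg_tensor S T) n. \<forall>r::real. r > 0 \<longrightarrow>
          mat_add (alg_tensor S T)
            (mat_scale (alg_tensor S T) (complex_of_real r)
              (mat_diag_const (alg_tensor S T) n (pure_tensor S T (ounit S) (ounit T)))) X
            \<in> P_max S T n}))"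

end

theory Submission
  imports Defs
begin

text \<open>
  Write \<open>e\<close> for order units and \<open>\<otimes>\<close> for the algebraic tensor product.
  Two properties of the limit \<open>L\<close> are needed: it is the union of the images of the \<open>S k\<close>, and for a
  positive matrix \<open>C\<close> over \<open>L\<close> and \<open>r > 0\<close> the matrix \<open>r e + C\<close> is the image of a positive matrix
  over some \<open>S k\<close>. Both follow by applying the universal property to the union of the images,
  with the cones generated by the images of the cones of the \<open>S k\<close>. Functoriality of the maximal tensor
  product and the universal property of \<open>M\<close> then give a unital completely positive map \<open>h\<close> from \<open>M\<close> to the
  maximal tensor product of \<open>L\<close> and \<open>T\<close>. In the other direction, \<open>\<psi>\<^sub>k a \<otimes> y \<mapsto> \<chi>\<^sub>k (a \<otimes> y)\<close> is a
  well defined linear map \<open>g\<close>, because states of \<open>M\<close> induce compatible families of states of the \<open>S k\<close>,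
  and \<open>g\<close> is completely positive by the second property of \<open>L\<close>. Finally \<open>h \<circ> g\<close> is the identity on pure
  tensors, and \<open>g \<circ> h\<close> is the identity since states separate points (Hahn-Banach) and states of \<open>M\<close> are
  determined by their restrictions to the images of the \<open>\<chi>\<^sub>k\<close>.

  Before this can start, the maximal tensor product must be shown to be an operator system. Its cones
  are proper because products of states separate the points of the algebraic tensor product and are
  positive on the cones; the latter uses that the entrywise product of two positive semidefinite matrices
  has nonnegative sum of entries.
\<close>

section \<open>Matrices over a star vector space\<close>

text \<open>The main obstacle is that \<open>\<psi> k a = 0\<close> can hold although no connecting
  map sends \<open>a\<close> to 0: it is enough that the order norms of the images of
  \<open>a\<close> tend to 0. Whether \<open>\<chi> k\<close> respects such collapses is an order
  question, not an algebraic one, and it is settled through states, whose compatible families factor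
  through \<open>L\<close> by universality. A functional
  \<open>a \<mapsto> f (a \<otimes> y)\<close> can be rescaled to a state if \<open>y\<close> is
  positive and the value at the unit is nonzero; \<open>y = e + p\<close> guarantees this, and such
  \<open>y\<close> span \<open>T\<close>. The second obstacle is the universe: universality is
  tested only on systems with elements in \<open>nat \<times> 'a\<close>. A target is moved there
  along an injection of its carrier. For a union of images a chosen representative provides one; for
  the complex numbers the multiples of a nonzero unit do, and the arguments are arranged so that
  this injection is asked for only once a state is known to exist. Order unit properties are reduced
  to \<open>2 \<times> 2\<close> blocks of single elements, which can be checked on pure
  tensors.\<close>

abbreviation scalar_mat :: "('a, 'z) star_space_scheme \<Rightarrow> nat \<Rightarrow> real \<Rightarrow> 'a \<Rightarrow> 'a mat" where
  "scalar_mat V n r x \<equiv> mat_scale V (complex_of_real r) (mat_diag_const V n x)"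

lemma complex_field_simps [simp]:
  "carrier complex_field = UNIV" "add complex_field = (+)" "monoid.mult complex_field = (*)"
  "one complex_field = 1" "zero complex_field = 0"
  by (simp_all add: complex_field_def)

lemma cring_complex_field: "cring complex_field"
proof (rule cringI)
  show "abelian_group complex_field"
  proof (rule abelian_groupI)
    show "\<exists>y\<in>carrier complex_field. y \<oplus>\<^bsub>complex_field\<^esub> x = \<zero>\<^bsub>complex_field\<^esub>" for x
      by (auto intro!: exI[of _ "- x"])
  qed auto
  show "comm_monoid complex_field"
    by unfold_locales (auto simp: algebra_simps)
qed (auto simp: algebra_simps)

context star_vector_space
begin

sublocale abelian_group V
  using module by (rule module.axioms)

lemma smult_closed [simp, intro]: "x \<in> carrier V \<Longrightarrow> c \<odot>\<^bsub>V\<^esub> x \<in> carrier V"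
  using module.smult_closed[OF module] by simp

lemma smult_add_right:
  "x \<in> carrier V \<Longrightarrow> y \<in> carrier V \<Longrightarrow> c \<odot>\<^bsub>V\<^esub> (x \<oplus>\<^bsub>V\<^esub> y) = c \<odot>\<^bsub>V\<^esub> x \<oplus>\<^bsub>V\<^esub> c \<odot>\<^bsub>V\<^esub> y"
  using module.smult_r_distr[OF module] by simp

lemma smult_add_left:
  "x \<in> carrier V \<Longrightarrow> (c + d) \<odot>\<^bsub>V\<^esub> x = c \<odot>\<^bsub>V\<^esub> x \<oplus>\<^bsub>V\<^esub> d \<odot>\<^bsub>V\<^esub> x"
  using module.smult_l_distr[OF module, of c d] by simp

lemma smult_smult [simp]: "x \<in> carrier V \<Longrightarrow> c \<odot>\<^bsub>V\<^esub> (d \<odot>\<^bsub>V\<^esub> x) = (c * d) \<odot>\<^bsub>V\<^esub> x"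
  using module.smult_assoc1[OF module, of c d] by simp

lemma smult_one [simp]: "x \<in> carrier V \<Longrightarrow> 1 \<odot>\<^bsub>V\<^esub> x = x"
  using module.smult_one[OF module] by simp

lemma smult_null [simp]: "x \<in> carrier V \<Longrightarrow> 0 \<odot>\<^bsub>V\<^esub> x = \<zero>\<^bsub>V\<^esub>"
  using module.smult_l_null[OF module] by simp

lemma smult_zero [simp]: "c \<odot>\<^bsub>V\<^esub> \<zero>\<^bsub>V\<^esub> = \<zero>\<^bsub>V\<^esub>"
  using module.smult_r_null[OF module, of c] by simp

lemma neg_eq_smult: "x \<in> carrier V \<Longrightarrow> \<ominus>\<^bsub>V\<^esub> x = (-1) \<odot>\<^bsub>V\<^esub> x"
proof -
  assume x: "x \<in> carrier V"
  have "(-1) \<odot>\<^bsub>V\<^esub> x \<oplus>\<^bsub>V\<^esub> x = (-1 + 1) \<odot>\<^bsub>V\<^esub> x"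
    using x by (simp only: smult_add_left smult_one)
  then show ?thesis
    using x by (intro minus_equality) auto
qed

lemma smult_finsum:
  "finite I \<Longrightarrow> f \<in> I \<rightarrow> carrier V \<Longrightarrow>
    c \<odot>\<^bsub>V\<^esub> (\<Oplus>\<^bsub>V\<^esub>i\<in>I. f i) = (\<Oplus>\<^bsub>V\<^esub>i\<in>I. c \<odot>\<^bsub>V\<^esub> f i)"
  using module.finsum_smult_ldistr[OF module] by simp

lemma finsum_smult_left:
  "finite I \<Longrightarrow> x \<in> carrier V \<Longrightarrow> (\<Sum>i\<in>I. c i) \<odot>\<^bsub>V\<^esub> x = (\<Oplus>\<^bsub>V\<^esub>i\<in>I. c i \<odot>\<^bsub>V\<^esub> x)"
  by (induction I rule: finite_induct) (auto simp: smult_add_left)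

lemma invol_zero [simp]: "invol V \<zero>\<^bsub>V\<^esub> = \<zero>\<^bsub>V\<^esub>"
  using invol_smult[of "\<zero>\<^bsub>V\<^esub>" 0] invol_closed[of "\<zero>\<^bsub>V\<^esub>"] by simp

lemma invol_finsum:
  "finite I \<Longrightarrow> f \<in> I \<rightarrow> carrier V \<Longrightarrow> invol V (\<Oplus>\<^bsub>V\<^esub>i\<in>I. f i) = (\<Oplus>\<^bsub>V\<^esub>i\<in>I. invol V (f i))"
proof (induction I rule: finite_induct)
  case (insert i I)
  then have "f i \<in> carrier V" "f \<in> I \<rightarrow> carrier V" by auto
  with insert show ?case
    by (simp add: invol_add invol_closed Pi_iff)
qed simp

lemma mats_dim [simp]: "A \<in> mats V n \<Longrightarrow> dim_row A = n" "A \<in> mats V n \<Longrightarrow> dim_col A = n"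
  by (auto simp: mats_def)

lemma mat_mem_mats: "(\<And>i j. i < n \<Longrightarrow> j < n \<Longrightarrow> f (i, j) \<in> carrier V) \<Longrightarrow> mat n n f \<in> mats V n"
  by (simp add: mats_def)

lemma mats_memI:
  "dim_row A = n \<Longrightarrow> dim_col A = n \<Longrightarrow> (\<And>i j. i < n \<Longrightarrow> j < n \<Longrightarrow> A $$ (i, j) \<in> carrier V)
    \<Longrightarrow> A \<in> mats V n"
  by (auto simp: mats_def)

lemma mat_zero_mats [simp, intro]: "mat_zero V n \<in> mats V n"
  by (simp add: mats_def mat_zero_def)

lemma mat_add_mats [simp, intro]:
  "A \<in> mats V n \<Longrightarrow> B \<in> mats V n \<Longrightarrow> mat_add V A B \<in> mats V n"
  by (auto simp: mats_def mat_add_def)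

lemma mat_neg_mats [simp, intro]: "A \<in> mats V n \<Longrightarrow> mat_neg V A \<in> mats V n"
  by (auto simp: mats_def mat_neg_def)

lemma mat_scale_mats [simp, intro]: "A \<in> mats V n \<Longrightarrow> mat_scale V c A \<in> mats V n"
  by (auto simp: mats_def mat_scale_def)

lemma mat_star_mats [simp, intro]: "A \<in> mats V n \<Longrightarrow> mat_star V A \<in> mats V n"
  by (auto simp: mats_def mat_star_def invol_closed)

lemma mat_diag_const_mats [simp, intro]: "x \<in> carrier V \<Longrightarrow> mat_diag_const V n x \<in> mats V n"
  by (auto simp: mats_def mat_diag_const_def)

lemma mats_closed [simp, intro]:
  "i < n \<Longrightarrow> j < n \<Longrightarrow> A \<in> mats V n \<Longrightarrow> A $$ (i, j) \<in> carrier V"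
  by (simp add: mats_def)

lemma mats_closed' [simp, intro]: "p \<in> {..<n} \<times> {..<n} \<Longrightarrow> A \<in> mats V n \<Longrightarrow> A $$ p \<in> carrier V"
  by (cases p) auto

lemma mats_eqI:
  assumes "A \<in> mats V n" "B \<in> mats V n" "\<And>i j. i < n \<Longrightarrow> j < n \<Longrightarrow> A $$ (i, j) = B $$ (i, j)"
  shows "A = B"
  using assms by (intro eq_matI) auto

lemma mat_index [simp]:
  assumes "i < n" "j < n"
  shows "mat_zero V n $$ (i, j) = \<zero>\<^bsub>V\<^esub>"
    and "A \<in> mats V n \<Longrightarrow> mat_add V A B $$ (i, j) = A $$ (i, j) \<oplus>\<^bsub>V\<^esub> B $$ (i, j)"
    and "A \<in> mats V n \<Longrightarrow> mat_neg V A $$ (i, j) = \<ominus>\<^bsub>V\<^esub> (A $$ (i, j))"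
    and "A \<in> mats V n \<Longrightarrow> mat_scale V c A $$ (i, j) = c \<odot>\<^bsub>V\<^esub> A $$ (i, j)"
    and "A \<in> mats V n \<Longrightarrow> mat_star V A $$ (i, j) = invol V (A $$ (j, i))"
    and "mat_diag_const V n x $$ (i, j) = (if i = j then x else \<zero>\<^bsub>V\<^esub>)"
  using assms
  by (simp_all add: mat_zero_def mat_add_def mat_neg_def mat_scale_def mat_star_def mat_diag_const_def)

lemma herm_matsD: "A \<in> herm_mats V n \<Longrightarrow> A \<in> mats V n" "A \<in> herm_mats V n \<Longrightarrow> mat_star V A = A"
  by (simp_all add: herm_mats_def)

lemma herm_matsI:
  "A \<in> mats V n \<Longrightarrow> (\<And>i j. i < n \<Longrightarrow> j < n \<Longrightarrow> invol V (A $$ (j, i)) = A $$ (i, j)) \<Longrightarrow> A \<in> herm_mats V n"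
  unfolding herm_mats_def by (auto intro!: mats_eqI)

lemma herm_mats_index:
  assumes "A \<in> herm_mats V n" "i < n" "j < n"
  shows "invol V (A $$ (j, i)) = A $$ (i, j)"
  using mat_index(5)[OF assms(2,3), of A] herm_matsD[OF assms(1)] by simp

lemma mat_neg_eq_scale: "A \<in> mats V n \<Longrightarrow> mat_neg V A = mat_scale V (-1) A"
  by (rule mats_eqI) (auto simp: neg_eq_smult)

section \<open>Compressions by scalar matrices\<close>

lemma mat_conj_mats [simp, intro]:
  "\<alpha> \<in> carrier_mat n m \<Longrightarrow> A \<in> mats V m \<Longrightarrow> mat_conj V \<alpha> A \<in> mats V n"
  unfolding mat_conj_def by (auto intro!: mat_mem_mats finsum_closed)

text \<open>A single sum over index pairs is easier to swap, split and reindex than the nested sums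
  of the definition; most computations with \<open>mat_conj\<close> start from this form.\<close>

lemma mat_conj_index:
  assumes "\<alpha> \<in> carrier_mat n m" "A \<in> mats V m" "i < n" "j < n"
  shows "mat_conj V \<alpha> A $$ (i, j) =
    (\<Oplus>\<^bsub>V\<^esub>p\<in>{..<m} \<times> {..<m}. (\<alpha> $$ (i, fst p) * cnj (\<alpha> $$ (j, snd p))) \<odot>\<^bsub>V\<^esub> A $$ p)"
  using assms unfolding mat_conj_def by (simp, subst add.finprod_finprod) (auto simp: case_prod_unfold)

lemma mat_conj_index':
  assumes "\<alpha> \<in> carrier_mat n m" "i < n" "j < n"
  shows "mat_conj V \<alpha> A $$ (i, j) = (\<Oplus>\<^bsub>V\<^esub>k\<in>{..<m}. \<Oplus>\<^bsub>V\<^esub>l\<in>{..<m}.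
    (\<alpha> $$ (i, k) * cnj (\<alpha> $$ (j, l))) \<odot>\<^bsub>V\<^esub> A $$ (k, l))"
  using assms unfolding mat_conj_def by auto

lemma mat_conj_add:
  assumes "\<alpha> \<in> carrier_mat n m" "A \<in> mats V m" "B \<in> mats V m"
  shows "mat_conj V \<alpha> (mat_add V A B) = mat_add V (mat_conj V \<alpha> A) (mat_conj V \<alpha> B)"
proof (rule mats_eqI)
  fix i j assume "i < n" "j < n"
  have "(\<Oplus>\<^bsub>V\<^esub>p\<in>{..<m} \<times> {..<m}. (\<alpha> $$ (i, fst p) * cnj (\<alpha> $$ (j, snd p))) \<odot>\<^bsub>V\<^esub> mat_add V A B $$ p)
     = (\<Oplus>\<^bsub>V\<^esub>p\<in>{..<m} \<times> {..<m}. (\<alpha> $$ (i, fst p) * cnj (\<alpha> $$ (j, snd p))) \<odot>\<^bsub>V\<^esub> A $$ p \<oplus>\<^bsub>V\<^esub>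
      (\<alpha> $$ (i, fst p) * cnj (\<alpha> $$ (j, snd p))) \<odot>\<^bsub>V\<^esub> B $$ p)"
    using assms by (intro finsum_cong') (auto simp: smult_add_right)
  then show "mat_conj V \<alpha> (mat_add V A B) $$ (i, j) = mat_add V (mat_conj V \<alpha> A) (mat_conj V \<alpha> B) $$ (i, j)"
    using assms \<open>i < n\<close> \<open>j < n\<close>
    by (simp add: mat_conj_index[OF assms(1)] mat_index(2)[OF _ _ mat_conj_mats[OF assms(1,2)]] case_prod_unfold)
qed (use assms in auto)

lemma mat_conj_scale:
  assumes "\<alpha> \<in> carrier_mat n m" "A \<in> mats V m"
  shows "mat_conj V \<alpha> (mat_scale V c A) = mat_scale V c (mat_conj V \<alpha> A)"
proof (rule mats_eqI)
  fix i j assume "i < n" "j < n"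
  then show "mat_conj V \<alpha> (mat_scale V c A) $$ (i, j) = mat_scale V c (mat_conj V \<alpha> A) $$ (i, j)"
    using assms
    by (simp add: mat_conj_index[OF assms(1)] mat_index(4)[OF _ _ mat_conj_mats[OF assms(1,2)]] case_prod_unfold)
       (subst smult_finsum, auto intro!: finsum_cong' simp: mult_ac simp del: smult_smult,
        auto simp: mult_ac)
qed (use assms in auto)

lemma mat_conj_star:
  assumes "\<alpha> \<in> carrier_mat n m" "A \<in> mats V m"
  shows "mat_star V (mat_conj V \<alpha> A) = mat_conj V \<alpha> (mat_star V A)"
proof (rule mats_eqI)
  fix i j assume ij: "i < n" "j < n"
  have "mat_star V (mat_conj V \<alpha> A) $$ (i, j) =
     (finsum V (\<lambda>(k, l). invol V ((\<alpha> $$ (j, k) * cnj (\<alpha> $$ (i, l))) \<odot>\<^bsub>V\<^esub> A $$ (k, l))) ({..<m} \<times> {..<m}))"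
    using ij assms
    by (simp add: mat_conj_index[OF assms(1)] mat_index(5)[OF _ _ mat_conj_mats[OF assms(1,2)]] case_prod_unfold)
       (subst invol_finsum, auto)
  also have "\<dots> = (\<Oplus>\<^bsub>V\<^esub>p\<in>{..<m} \<times> {..<m}. (\<alpha> $$ (i, fst p) * cnj (\<alpha> $$ (j, snd p))) \<odot>\<^bsub>V\<^esub> mat_star V A $$ p)"
    using assms by (subst add.finprod_swap) (auto intro!: finsum_cong' simp: invol_smult invol_closed mult_ac)
  finally show "mat_star V (mat_conj V \<alpha> A) $$ (i, j) = mat_conj V \<alpha> (mat_star V A) $$ (i, j)"
    using ij assms by (simp add: mat_conj_index[OF assms(1)])
qed (use assms in auto)

lemma mat_conj_herm:
  assumes "\<alpha> \<in> carrier_mat n m" "A \<in> herm_mats V m"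
  shows "mat_conj V \<alpha> A \<in> herm_mats V n"
  using assms mat_conj_star[OF assms(1), of A] by (auto simp: herm_mats_def)

text \<open>This makes \<open>P_max\<close> stable under compressions: the outer scalar matrix is
  absorbed by the inner one.\<close>

lemma mat_conj_conj:
  assumes \<beta>: "\<beta> \<in> carrier_mat n m" and \<alpha>: "\<alpha> \<in> carrier_mat m q" and A: "A \<in> mats V q"
  shows "mat_conj V \<beta> (mat_conj V \<alpha> A) = mat_conj V (\<beta> * \<alpha>) A"
proof (rule mats_eqI)
  fix i j assume ij: "i < n" "j < n"
  let ?M = "{..<m} \<times> {..<m}" and ?Q = "{..<q} \<times> {..<q}"
  have "mat_conj V \<beta> (mat_conj V \<alpha> A) $$ (i, j) =
     (\<Oplus>\<^bsub>V\<^esub>u\<in>?M. (\<beta> $$ (i, fst u) * cnj (\<beta> $$ (j, snd u))) \<odot>\<^bsub>V\<^esub>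
        (\<Oplus>\<^bsub>V\<^esub>v\<in>?Q. (\<alpha> $$ (fst u, fst v) * cnj (\<alpha> $$ (snd u, snd v))) \<odot>\<^bsub>V\<^esub> A $$ v))"
    unfolding mat_conj_index[OF \<beta> mat_conj_mats[OF \<alpha> A] ij]
    using A by (intro finsum_cong') (auto simp: mat_conj_index[OF \<alpha> A] intro!: finsum_closed)
  also have "\<dots> = (\<Oplus>\<^bsub>V\<^esub>u\<in>?M. \<Oplus>\<^bsub>V\<^esub>v\<in>?Q. (\<beta> $$ (i, fst u) * \<alpha> $$ (fst u, fst v) *
        cnj (\<beta> $$ (j, snd u) * \<alpha> $$ (snd u, snd v))) \<odot>\<^bsub>V\<^esub> A $$ v)"
    using A by (intro finsum_cong') (auto simp: smult_finsum Pi_iff mult_ac intro!: finsum_cong' finsum_closed)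
  also have "\<dots> = (\<Oplus>\<^bsub>V\<^esub>v\<in>?Q. \<Oplus>\<^bsub>V\<^esub>u\<in>?M. (\<beta> $$ (i, fst u) * \<alpha> $$ (fst u, fst v) *
        cnj (\<beta> $$ (j, snd u) * \<alpha> $$ (snd u, snd v))) \<odot>\<^bsub>V\<^esub> A $$ v)"
    using A by (intro add.finprod_finprod_swap) auto
  also have "\<dots> = (\<Oplus>\<^bsub>V\<^esub>v\<in>?Q. (\<Sum>u\<in>?M. \<beta> $$ (i, fst u) * \<alpha> $$ (fst u, fst v) *
        cnj (\<beta> $$ (j, snd u) * \<alpha> $$ (snd u, snd v))) \<odot>\<^bsub>V\<^esub> A $$ v)"
    using A by (intro finsum_cong') (auto simp: finsum_smult_left)
  also have "\<dots> = mat_conj V (\<beta> * \<alpha>) A $$ (i, j)"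
    unfolding mat_conj_index[OF mult_carrier_mat[OF \<beta> \<alpha>] A ij]
  proof (rule finsum_cong')
    fix v assume "v \<in> ?Q"
    then show "(\<Sum>u\<in>?M. \<beta> $$ (i, fst u) * \<alpha> $$ (fst u, fst v) *
        cnj (\<beta> $$ (j, snd u) * \<alpha> $$ (snd u, snd v))) \<odot>\<^bsub>V\<^esub> A $$ v =
      ((\<beta> * \<alpha>) $$ (i, fst v) * cnj ((\<beta> * \<alpha>) $$ (j, snd v))) \<odot>\<^bsub>V\<^esub> A $$ v"
      using ij \<alpha> \<beta>
      by (auto simp: scalar_prod_def sum_product sum.cartesian_product case_prod_unfold atLeast0LessThan
          cnj_sum)
  qed (use A in auto)
  finally show "mat_conj V \<beta> (mat_conj V \<alpha> A) $$ (i, j) = mat_conj V (\<beta> * \<alpha>) A $$ (i, j)" .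
qed (use assms mat_conj_mats[OF mult_carrier_mat[OF \<beta> \<alpha>] A] in auto)

lemma mat_conj_one:
  assumes A: "A \<in> mats V n"
  shows "mat_conj V (1\<^sub>m n) A = A"
proof (rule mats_eqI)
  fix i j assume ij: "i < n" "j < n"
  have "mat_conj V (1\<^sub>m n) A $$ (i, j) = (\<Oplus>\<^bsub>V\<^esub>p\<in>{..<n} \<times> {..<n}. if (i, j) = p then A $$ p else \<zero>\<^bsub>V\<^esub>)"
    unfolding mat_conj_index[OF one_carrier_mat A ij]
    using ij A by (intro finsum_cong') (auto split: if_splits)
  also have "\<dots> = A $$ (i, j)"
    using ij A by (intro add.finprod_singleton) auto
  finally show "mat_conj V (1\<^sub>m n) A $$ (i, j) = A $$ (i, j)" .
qed (use A mat_conj_mats[OF one_carrier_mat A] in auto)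

end

section \<open>Linear maps\<close>

lemma linear_mapD:
  assumes "linear_map V W f"
  shows "x \<in> carrier V \<Longrightarrow> f x \<in> carrier W"
    and "x \<in> carrier V \<Longrightarrow> y \<in> carrier V \<Longrightarrow> f (x \<oplus>\<^bsub>V\<^esub> y) = f x \<oplus>\<^bsub>W\<^esub> f y"
    and "x \<in> carrier V \<Longrightarrow> f (c \<odot>\<^bsub>V\<^esub> x) = c \<odot>\<^bsub>W\<^esub> f x"
  using assms by (auto simp: linear_map_def)

lemma linear_mapI:
  assumes "\<And>x. x \<in> carrier V \<Longrightarrow> f x \<in> carrier W"
    and "\<And>x y. x \<in> carrier V \<Longrightarrow> y \<in> carrier V \<Longrightarrow> f (x \<oplus>\<^bsub>V\<^esub> y) = f x \<oplus>\<^bsub>W\<^esub> f y"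
    and "\<And>c x. x \<in> carrier V \<Longrightarrow> f (c \<odot>\<^bsub>V\<^esub> x) = c \<odot>\<^bsub>W\<^esub> f x"
  shows "linear_map V W f"
  using assms by (auto simp: linear_map_def)

lemma linear_map_comp: "linear_map V W f \<Longrightarrow> linear_map W X g \<Longrightarrow> linear_map V X (g \<circ> f)"
  by (auto intro!: linear_mapI simp: linear_mapD)

locale star_linear_map = V: star_vector_space V + W: star_vector_space W
  for V :: "('a, 'y) star_space_scheme" and W :: "('b, 'z) star_space_scheme" +
  fixes f :: "'a \<Rightarrow> 'b"
  assumes linear: "linear_map V W f"
begin

lemmas map_closed [simp, intro] = linear_mapD(1)[OF linear]
lemmas map_add = linear_mapD(2)[OF linear]
lemmas map_smult = linear_mapD(3)[OF linear]

lemma map_zero [simp]: "f \<zero>\<^bsub>V\<^esub> = \<zero>\<^bsub>W\<^esub>"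
  using map_smult[of "\<zero>\<^bsub>V\<^esub>" 0] by simp

lemma map_neg: "x \<in> carrier V \<Longrightarrow> f (\<ominus>\<^bsub>V\<^esub> x) = \<ominus>\<^bsub>W\<^esub> f x"
  by (simp add: V.neg_eq_smult W.neg_eq_smult map_smult)

lemma map_finsum:
  "finite I \<Longrightarrow> g \<in> I \<rightarrow> carrier V \<Longrightarrow> f (\<Oplus>\<^bsub>V\<^esub>i\<in>I. g i) = (\<Oplus>\<^bsub>W\<^esub>i\<in>I. f (g i))"
  by (induction I rule: finite_induct) (auto simp: map_add Pi_iff)

lemma map_mat_mats [simp, intro]: "A \<in> mats V n \<Longrightarrow> map_mat f A \<in> mats W n"
  by (rule W.mats_memI) auto

lemma map_mat_index [simp]: "i < n \<Longrightarrow> j < n \<Longrightarrow> A \<in> mats V n \<Longrightarrow> map_mat f A $$ (i, j) = f (A $$ (i, j))"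
  by simp

lemma map_mat_add:
  "A \<in> mats V n \<Longrightarrow> B \<in> mats V n \<Longrightarrow> map_mat f (mat_add V A B) = mat_add W (map_mat f A) (map_mat f B)"
  by (rule W.mats_eqI) (auto simp: map_add W.mat_index(2)[OF _ _ map_mat_mats])

lemma map_mat_scale:
  "A \<in> mats V n \<Longrightarrow> map_mat f (mat_scale V c A) = mat_scale W c (map_mat f A)"
  by (rule W.mats_eqI) (auto simp: map_smult W.mat_index(4)[OF _ _ map_mat_mats])

lemma map_mat_neg:
  "A \<in> mats V n \<Longrightarrow> map_mat f (mat_neg V A) = mat_neg W (map_mat f A)"
  by (rule W.mats_eqI) (auto simp: map_neg W.mat_index(3)[OF _ _ map_mat_mats])

lemma map_mat_zero: "map_mat f (mat_zero V n) = mat_zero W n"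
  by (rule W.mats_eqI) (auto simp: V.mat_zero_mats)

lemma map_mat_diag_const:
  "x \<in> carrier V \<Longrightarrow> map_mat f (mat_diag_const V n x) = mat_diag_const W n (f x)"
  by (rule W.mats_eqI) (auto simp: map_mat_index[OF _ _ V.mat_diag_const_mats])

lemma map_mat_conj:
  assumes "\<alpha> \<in> carrier_mat n m" "A \<in> mats V m"
  shows "map_mat f (mat_conj V \<alpha> A) = mat_conj W \<alpha> (map_mat f A)"
proof (rule W.mats_eqI)
  fix i j assume "i < n" "j < n"
  then show "map_mat f (mat_conj V \<alpha> A) $$ (i, j) = mat_conj W \<alpha> (map_mat f A) $$ (i, j)"
    using assms
    by (simp add: map_mat_index[OF _ _ V.mat_conj_mats[OF assms]] V.mat_conj_index W.mat_conj_index[OF assms(1) map_mat_mats])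
      (subst map_finsum, auto simp: map_smult intro!: W.finsum_cong')
qed (use assms in auto)

end

text \<open>Additive inverses come for free: \<open>(-1)\<close> times \<open>x\<close> is one, by
  distributivity and the law for the scalar 0.\<close>

lemma star_vector_spaceI:
  fixes V :: "('a, 'z) star_space_scheme"
  assumes add_closed: "\<And>x y. x \<in> carrier V \<Longrightarrow> y \<in> carrier V \<Longrightarrow> x \<oplus>\<^bsub>V\<^esub> y \<in> carrier V"
    and assoc: "\<And>x y z. x \<in> carrier V \<Longrightarrow> y \<in> carrier V \<Longrightarrow> z \<in> carrier V \<Longrightarrow>
      (x \<oplus>\<^bsub>V\<^esub> y) \<oplus>\<^bsub>V\<^esub> z = x \<oplus>\<^bsub>V\<^esub> (y \<oplus>\<^bsub>V\<^esub> z)"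
    and comm: "\<And>x y. x \<in> carrier V \<Longrightarrow> y \<in> carrier V \<Longrightarrow> x \<oplus>\<^bsub>V\<^esub> y = y \<oplus>\<^bsub>V\<^esub> x"
    and zero: "\<zero>\<^bsub>V\<^esub> \<in> carrier V" "\<And>x. x \<in> carrier V \<Longrightarrow> \<zero>\<^bsub>V\<^esub> \<oplus>\<^bsub>V\<^esub> x = x"
    and smult_closed: "\<And>c x. x \<in> carrier V \<Longrightarrow> c \<odot>\<^bsub>V\<^esub> x \<in> carrier V"
    and smult_add_left: "\<And>c d x. x \<in> carrier V \<Longrightarrow> (c + d) \<odot>\<^bsub>V\<^esub> x = c \<odot>\<^bsub>V\<^esub> x \<oplus>\<^bsub>V\<^esub> d \<odot>\<^bsub>V\<^esub> x"
    and smult_add_right: "\<And>c x y. x \<in> carrier V \<Longrightarrow> y \<in> carrier V \<Longrightarrow>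
      c \<odot>\<^bsub>V\<^esub> (x \<oplus>\<^bsub>V\<^esub> y) = c \<odot>\<^bsub>V\<^esub> x \<oplus>\<^bsub>V\<^esub> c \<odot>\<^bsub>V\<^esub> y"
    and smult_smult: "\<And>c d x. x \<in> carrier V \<Longrightarrow> (c * d) \<odot>\<^bsub>V\<^esub> x = c \<odot>\<^bsub>V\<^esub> (d \<odot>\<^bsub>V\<^esub> x)"
    and smult_one: "\<And>x. x \<in> carrier V \<Longrightarrow> 1 \<odot>\<^bsub>V\<^esub> x = x"
    and smult_null: "\<And>x. x \<in> carrier V \<Longrightarrow> 0 \<odot>\<^bsub>V\<^esub> x = \<zero>\<^bsub>V\<^esub>"
    and invol: "\<And>x. x \<in> carrier V \<Longrightarrow> invol V x \<in> carrier V"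
      "\<And>x. x \<in> carrier V \<Longrightarrow> invol V (invol V x) = x"
      "\<And>x y. x \<in> carrier V \<Longrightarrow> y \<in> carrier V \<Longrightarrow>
        invol V (x \<oplus>\<^bsub>V\<^esub> y) = invol V x \<oplus>\<^bsub>V\<^esub> invol V y"
      "\<And>c x. x \<in> carrier V \<Longrightarrow> invol V (c \<odot>\<^bsub>V\<^esub> x) = cnj c \<odot>\<^bsub>V\<^esub> invol V x"
  shows "star_vector_space V"
proof (rule star_vector_space.intro)
  show "Module.module complex_field V"
  proof (rule moduleI[OF cring_complex_field])
    show "abelian_group V"
    proof (rule abelian_groupI)
      fix x assume x: "x \<in> carrier V"
      have "(-1) \<odot>\<^bsub>V\<^esub> x \<oplus>\<^bsub>V\<^esub> x = (-1 + 1) \<odot>\<^bsub>V\<^esub> x"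
        using x by (simp only: smult_add_left smult_one)
      also have "\<dots> = \<zero>\<^bsub>V\<^esub>"
        using smult_null[OF x] by simp
      finally show "\<exists>y\<in>carrier V. y \<oplus>\<^bsub>V\<^esub> x = \<zero>\<^bsub>V\<^esub>"
        using smult_closed[OF x] by blast
    qed (fact add_closed zero comm assoc)+
  qed (simp_all add: smult_closed smult_add_left smult_add_right smult_smult smult_one)
qed (fact invol)+

section \<open>Archimedeanization\<close>

text \<open>The construction in \<open>max_tensor\<close> for arbitrary cones. It is used three
  times: for the complex numbers, for the union of the images in a cocone and for the maximal tensor
  product.\<close>

definition archimedeanization :: "'a star_space \<Rightarrow> 'a \<Rightarrow> (nat \<Rightarrow> 'a mat set) \<Rightarrow> 'a op_sys" where
  "archimedeanization V e P = star_space.extend V (op_sys.fields e (\<lambda>n. {X \<in> mats V n. \<forall>r::real. r > 0 \<longrightarrow>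
     mat_add V (scalar_mat V n r e) X \<in> P n}))"

lemma archimedeanization_simps [simp]:
  "carrier (archimedeanization V e P) = carrier V"
  "add (archimedeanization V e P) = add V"
  "zero (archimedeanization V e P) = zero V"
  "smult (archimedeanization V e P) = smult V"
  "invol (archimedeanization V e P) = invol V"
  "ounit (archimedeanization V e P) = e"
  "mpos (archimedeanization V e P) n = {X \<in> mats V n. \<forall>r::real. r > 0 \<longrightarrow>
     mat_add V (scalar_mat V n r e) X \<in> P n}"
  by (simp_all add: archimedeanization_def star_space.defs op_sys.defs)

text \<open>Inverses and finite sums are determined by carrier, addition and zero, so adding cones
  and a unit to the record does not change them.\<close>

lemma a_inv_eq_if_same_ops:
  assumes "carrier V = carrier W" "add V = add W" "zero V = zero W"
  shows "a_inv V = a_inv W" "finsum V = finsum W"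
  unfolding a_inv_def[abs_def] m_inv_def[abs_def] finsum_def[abs_def] finprod_def[abs_def]
    partial_object.simps monoid.simps assms by (rule refl)+

lemma archimedeanization_ops [simp]:
  "a_inv (archimedeanization V e P) = a_inv V"
  "finsum (archimedeanization V e P) = finsum V"
  by (rule a_inv_eq_if_same_ops; simp)+

lemma archimedeanization_mats [simp]:
  "mats (archimedeanization V e P) = mats V"
  "mat_zero (archimedeanization V e P) = mat_zero V"
  "mat_add (archimedeanization V e P) = mat_add V"
  "mat_neg (archimedeanization V e P) = mat_neg V"
  "mat_scale (archimedeanization V e P) = mat_scale V"
  "mat_star (archimedeanization V e P) = mat_star V"
  "herm_mats (archimedeanization V e P) = herm_mats V"
  "mat_diag_const (archimedeanization V e P) = mat_diag_const V"
  "mat_conj (archimedeanization V e P) = mat_conj V"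
  by (simp_all add: fun_eq_iff mats_def mat_zero_def mat_add_def mat_neg_def mat_scale_def
      mat_star_def herm_mats_def mat_diag_const_def mat_conj_def cong: if_cong)

lemma star_vector_space_archimedeanization:
  assumes "star_vector_space V"
  shows "star_vector_space (archimedeanization V e P)"
proof -
  interpret star_vector_space V by fact
  show ?thesis
    by (rule star_vector_spaceI)
      (simp_all add: a_ac smult_add_left smult_add_right invol_closed invol_invol invol_add invol_smult)
qed

text \<open>This matrix is positive iff the order norm of \<open>x\<close> is at most \<open>r\<close>.\<close>

definition norm_block :: "('a, 'z) star_space_scheme \<Rightarrow> 'a \<Rightarrow> real \<Rightarrow> 'a \<Rightarrow> 'a mat" where
  "norm_block V e r x = mat 2 2 (\<lambda>(i, j). if i = j then complex_of_real r \<odot>\<^bsub>V\<^esub> e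
     else if i = 0 then x else invol V x)"

context star_vector_space
begin

text \<open>Coordinates with respect to \<open>e\<close>, \<open>x\<close> and the adjoint of
  \<open>x\<close>: equations between matrix entries become equations between complex
  coefficients.\<close>

definition lincomb3 :: "'a \<Rightarrow> 'a \<Rightarrow> 'a \<Rightarrow> complex \<Rightarrow> complex \<Rightarrow> complex \<Rightarrow> 'a" where
  "lincomb3 x y z a b c = a \<odot>\<^bsub>V\<^esub> x \<oplus>\<^bsub>V\<^esub> (b \<odot>\<^bsub>V\<^esub> y \<oplus>\<^bsub>V\<^esub> c \<odot>\<^bsub>V\<^esub> z)"

context
  fixes x y z
  assumes xyz [simp]: "x \<in> carrier V" "y \<in> carrier V" "z \<in> carrier V"
begin

lemma lincomb3_closed: "lincomb3 x y z a b c \<in> carrier V"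
  by (simp add: lincomb3_def)

lemma lincomb3_add:
  "lincomb3 x y z a b c \<oplus>\<^bsub>V\<^esub> lincomb3 x y z a' b' c' = lincomb3 x y z (a + a') (b + b') (c + c')"
  by (simp add: lincomb3_def smult_add_left a_ac)

lemma lincomb3_smult: "d \<odot>\<^bsub>V\<^esub> lincomb3 x y z a b c = lincomb3 x y z (d * a) (d * b) (d * c)"
  by (simp add: lincomb3_def smult_add_right)

lemma lincomb3_neg: "\<ominus>\<^bsub>V\<^esub> lincomb3 x y z a b c = lincomb3 x y z (- a) (- b) (- c)"
  by (simp add: neg_eq_smult lincomb3_closed lincomb3_smult)

end

lemma mat_conj_norm_block:
  assumes "\<alpha> \<in> carrier_mat n 2" "x \<in> carrier V" "e \<in> carrier V" "i < n" "j < n"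
  shows "mat_conj V \<alpha> (norm_block V e r x) $$ (i, j) = lincomb3 e x (invol V x)
    (complex_of_real r * (\<alpha> $$ (i, 0) * cnj (\<alpha> $$ (j, 0)) + \<alpha> $$ (i, 1) * cnj (\<alpha> $$ (j, 1))))
    (\<alpha> $$ (i, 0) * cnj (\<alpha> $$ (j, 1))) (\<alpha> $$ (i, 1) * cnj (\<alpha> $$ (j, 0)))"
proof -
  have "invol V x \<in> carrier V" using assms invol_closed by auto
  then show ?thesis
    using assms unfolding mat_conj_index'[OF assms(1,4,5)]
    by (simp add: numeral_2_eq_2 lessThan_Suc norm_block_def lincomb3_def smult_add_left algebra_simps a_ac)
qed

text \<open>Splits \<open>r E + X\<close> as \<open>t (R E - B) + (t B + X)\<close>. If
  \<open>B\<close> is bounded by \<open>R E\<close>, positivity of the perturbation of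
  \<open>X\<close> by \<open>t B\<close> thus passes to the perturbation by \<open>r E\<close>; this
  allows any bounded \<open>B\<close> in Archimedean arguments.\<close>

lemma mat_dominated:
  assumes E: "E \<in> mats V n" and B: "B \<in> mats V n" and X: "X \<in> mats V n" and r: "(t::real) * R = r"
  shows "mat_add V (mat_scale V (complex_of_real r) E) X =
    mat_add V (mat_scale V (complex_of_real t) (mat_add V (mat_scale V (complex_of_real R) E) (mat_neg V B)))
      (mat_add V (mat_scale V (complex_of_real t) B) X)"
proof (rule mats_eqI)
  fix i j assume ij: "i < n" "j < n"
  have N: "mat_neg V B \<in> mats V n" using B by auto
  have eq: "complex_of_real r \<odot>\<^bsub>V\<^esub> u \<oplus>\<^bsub>V\<^esub> d =
    complex_of_real t \<odot>\<^bsub>V\<^esub> (complex_of_real R \<odot>\<^bsub>V\<^esub> u \<oplus>\<^bsub>V\<^esub> (\<ominus>\<^bsub>V\<^esub> c)) \<oplus>\<^bsub>V\<^esub> (complex_of_real t \<odot>\<^bsub>V\<^esub> c \<oplus>\<^bsub>V\<^esub> d)"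
    if cd: "u \<in> carrier V" "c \<in> carrier V" "d \<in> carrier V" for u c d
  proof -
    have "(- complex_of_real t) \<odot>\<^bsub>V\<^esub> c \<oplus>\<^bsub>V\<^esub> (complex_of_real t \<odot>\<^bsub>V\<^esub> c \<oplus>\<^bsub>V\<^esub> d) = d"
      using cd by (simp add: a_assoc[symmetric] smult_add_left[symmetric])
    then show ?thesis
      using cd r by (simp add: neg_eq_smult smult_add_right a_assoc flip: of_real_mult)
  qed
  show "mat_add V (mat_scale V (complex_of_real r) E) X $$ (i, j) =
    mat_add V (mat_scale V (complex_of_real t) (mat_add V (mat_scale V (complex_of_real R) E) (mat_neg V B)))
      (mat_add V (mat_scale V (complex_of_real t) B) X) $$ (i, j)"
    unfolding mat_index(2)[OF ij mat_scale_mats[OF E]] mat_index(4)[OF ij E]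
      mat_index(2)[OF ij mat_scale_mats[OF mat_add_mats[OF mat_scale_mats[OF E] N]]]
      mat_index(4)[OF ij mat_add_mats[OF mat_scale_mats[OF E] N]]
      mat_index(2)[OF ij mat_scale_mats[OF B]] mat_index(4)[OF ij B] mat_index(3)[OF ij B]
    by (rule eq) (use ij E B X in auto)
qed (use E B X in auto)

end

text \<open>The order unit property is asked for only through \<open>P_norm_block\<close>: it
  concerns single elements and is additive in them, hence can be checked on pure tensors, and it
  implies the property at all matrix levels. \<open>P_proper\<close> speaks about the closures
  because properness of \<open>P n\<close> alone would not pass to them.\<close>

locale archimedeanizable = star_vector_space V for V :: "'a star_space" +
  fixes e :: 'a and P :: "nat \<Rightarrow> 'a mat set"
  assumes e_closed [simp]: "e \<in> carrier V" and e_herm [simp]: "invol V e = e"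
    and P_herm: "n > 0 \<Longrightarrow> P n \<subseteq> herm_mats V n"
    and P_add: "n > 0 \<Longrightarrow> A \<in> P n \<Longrightarrow> B \<in> P n \<Longrightarrow> mat_add V A B \<in> P n"
    and P_scale: "n > 0 \<Longrightarrow> A \<in> P n \<Longrightarrow> (r::real) \<ge> 0 \<Longrightarrow> mat_scale V (complex_of_real r) A \<in> P n"
    and P_conj: "n > 0 \<Longrightarrow> m > 0 \<Longrightarrow> \<alpha> \<in> carrier_mat n m \<Longrightarrow> A \<in> P m \<Longrightarrow> mat_conj V \<alpha> A \<in> P n"
    and P_norm_block: "x \<in> carrier V \<Longrightarrow> \<exists>r::real. r > 0 \<and> norm_block V e r x \<in> P 2"
    and P_proper: "n > 0 \<Longrightarrow> A \<in> mats V n \<Longrightarrow>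
      (\<And>r::real. r > 0 \<Longrightarrow> mat_add V (scalar_mat V n r e) A \<in> P n) \<Longrightarrow>
      (\<And>r::real. r > 0 \<Longrightarrow> mat_add V (scalar_mat V n r e) (mat_neg V A) \<in> P n) \<Longrightarrow>
      A = mat_zero V n"
begin

section \<open>Order unit estimates at every matrix level\<close>

abbreviation E :: "real \<Rightarrow> nat \<Rightarrow> 'a mat" where
  "E r n \<equiv> scalar_mat V n r e"

lemma P_mats: "n > 0 \<Longrightarrow> A \<in> P n \<Longrightarrow> A \<in> mats V n"
  using P_herm herm_matsD by blast

lemma E_mats [simp, intro]: "E r n \<in> mats V n"
  by auto

lemma E_index: "i < n \<Longrightarrow> j < n \<Longrightarrow> E r n $$ (i, j) = complex_of_real r \<odot>\<^bsub>V\<^esub> (if i = j then e else \<zero>\<^bsub>V\<^esub>)"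
  by (simp add: mat_index(4)[OF _ _ mat_diag_const_mats])

text \<open>The norm block of zero is diagonal with entries \<open>r e\<close>. Compressing it to
  one coordinate and dividing by \<open>r\<close> leaves \<open>e\<close> at a single diagonal
  position, and sums of these give the rest.\<close>

lemma diag_indicator_P:
  assumes n: "n > 0" and "F \<subseteq> {..<n}"
  shows "mat n n (\<lambda>(i, j). if i = j \<and> i \<in> F then e else \<zero>\<^bsub>V\<^esub>) \<in> P n"
proof -
  obtain r where r: "r > 0" "norm_block V e r \<zero>\<^bsub>V\<^esub> \<in> P 2"
    using P_norm_block[of "\<zero>\<^bsub>V\<^esub>"] by auto
  define D where "D F = mat n n (\<lambda>(i, j). if i = j \<and> i \<in> F then e else \<zero>\<^bsub>V\<^esub>)" for F
  have D: "D F \<in> mats V n" for F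
    unfolding D_def by (rule mat_mem_mats) auto
  define \<alpha> :: "nat \<Rightarrow> complex mat" where "\<alpha> i = mat n 2 (\<lambda>(p, q). if p = i \<and> q = 0 then 1 else 0)" for i
  have \<alpha>: "\<alpha> i \<in> carrier_mat n 2" for i by (simp add: \<alpha>_def)
  have single: "D {i} \<in> P n" if "i < n" for i
  proof -
    have "D {i} = mat_scale V (complex_of_real (1 / r)) (mat_conj V (\<alpha> i) (norm_block V e r \<zero>\<^bsub>V\<^esub>))"
    proof (rule mats_eqI)
      have "norm_block V e r \<zero>\<^bsub>V\<^esub> \<in> mats V 2" by (rule P_mats) (use r in auto)
      note M = mat_conj_mats[OF \<alpha> this]
      show "mat_scale V (complex_of_real (1 / r)) (mat_conj V (\<alpha> i) (norm_block V e r \<zero>\<^bsub>V\<^esub>)) \<in> mats V n"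
        using M by auto
      fix p q assume pq: "p < n" "q < n"
      show "D {i} $$ (p, q) = mat_scale V (complex_of_real (1 / r)) (mat_conj V (\<alpha> i) (norm_block V e r \<zero>\<^bsub>V\<^esub>)) $$ (p, q)"
        unfolding mat_index(4)[OF pq M] mat_conj_norm_block[OF \<alpha> zero_closed e_closed pq]
        using pq r(1) by (simp add: lincomb3_smult D_def \<alpha>_def lincomb3_def)
    qed (rule D)
    then show ?thesis
      using P_scale[OF n P_conj[OF n _ \<alpha> r(2)], of "1 / r"] r(1) by simp
  qed
  have "finite F" using assms(2) finite_subset by blast
  then have "D F \<in> P n" using assms(2)
  proof (induction F rule: finite_induct)
    case empty
    have "D {} = mat_scale V (complex_of_real 0) (D {0})"
      by (rule mats_eqI[OF D mat_scale_mats[OF D]]) (simp add: mat_index(4)[OF _ _ D], simp add: D_def)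
    then show ?case
      using P_scale[OF n single[OF n], of 0] by simp
  next
    case (insert i F)
    have "D (insert i F) = mat_add V (D {i}) (D F)"
      by (rule mats_eqI[OF D mat_add_mats[OF D D]])
        (use insert(2) in \<open>simp add: mat_index(2)[OF _ _ D]; auto simp: D_def\<close>)
    then show ?case
      using insert single n by (auto intro!: P_add)
  qed
  then show ?thesis by (simp add: D_def)
qed

lemma E_P: "n > 0 \<Longrightarrow> r \<ge> 0 \<Longrightarrow> E r n \<in> P n"
proof -
  assume *: "n > 0" "r \<ge> 0"
  have "mat_diag_const V n e = mat n n (\<lambda>(i, j). if i = j \<and> i \<in> {..<n} then e else \<zero>\<^bsub>V\<^esub>)"
    by (rule eq_matI) (auto simp: mat_diag_const_def)
  then show ?thesis
    using diag_indicator_P[OF *(1), of "{..<n}"] P_scale[OF *(1) _ *(2)] by auto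
qed

lemma mat_neg_add_assoc:
  assumes "A \<in> mats V n" "B \<in> mats V n" "A' \<in> mats V n" "B' \<in> mats V n"
  shows "mat_add V (mat_add V (E r n) (mat_neg V (mat_add V A A'))) (mat_add V (E s n) (mat_neg V (mat_add V B B'))) =
    mat_add V (E (r + s) n) (mat_neg V (mat_add V (mat_add V A B) (mat_add V A' B')))"
proof -
  have m: "mat_add V A A' \<in> mats V n" "mat_add V B B' \<in> mats V n" "mat_add V A B \<in> mats V n" "mat_add V A' B' \<in> mats V n"
    using assms by auto
  note m' = mat_add_mats[OF m(3,4)]
  have "mat_neg V (mat_add V A A') \<in> mats V n" "mat_neg V (mat_add V B B') \<in> mats V n"
    using m by auto
  note m'' = mat_add_mats[OF E_mats this(1)] mat_add_mats[OF E_mats this(2)]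
  show ?thesis
    by (rule mats_eqI)
      (use assms in \<open>auto simp: mat_index(2)[OF _ _ m''(1)] mat_index(2)[OF _ _ m(3)] mat_index(2)[OF _ _ E_mats] mat_index(3)[OF _ _ m(1)] mat_index(3)[OF _ _ m(2)] mat_index(3)[OF _ _ m']
       E_index neg_eq_smult smult_add_right smult_add_left a_ac\<close>)
qed

lemma mat_unit_elementary:
  assumes n: "n > 0" and ij: "i < n" "j < n" and x: "x \<in> carrier V"
    and Z: "Z = mat n n (\<lambda>p. if p = (i, j) then x else \<zero>\<^bsub>V\<^esub>)"
  shows "\<exists>r>0. mat_add V (E r n) (mat_neg V (mat_add V Z (mat_star V Z))) \<in> P n"
proof -
  obtain r where r: "r > 0" "norm_block V e r x \<in> P 2"
    using P_norm_block[OF x] by auto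
  \<comment> \<open>The columns are the unit vectors \<open>e_i\<close> and \<open>- e_j\<close>.
    The compression of the norm block puts \<open>r e\<close> at the diagonal positions
    \<open>i\<close> and \<open>j\<close> and subtracts \<open>Z\<close> and its adjoint.\<close>
  define \<alpha> :: "complex mat" where
    "\<alpha> = mat n 2 (\<lambda>(p, q). if q = 0 then (if p = i then 1 else 0) else (if p = j then -1 else 0))"
  have \<alpha>: "\<alpha> \<in> carrier_mat n 2" by (simp add: \<alpha>_def)
  \<comment> \<open>The identity without its \<open>i\<close>-th diagonal entry:
    \<open>r (D i) + r (D j)\<close> fills the diagonal of the compression up to
    \<open>2 r e\<close>.\<close>
  define D where "D i = mat n n (\<lambda>(p, q). if p = q \<and> p \<in> {..<n} - {i} then e else \<zero>\<^bsub>V\<^esub>)" for i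
  have "D i \<in> P n" for i
    unfolding D_def by (rule diag_indicator_P[OF n]) auto
  then have DP: "mat_scale V (complex_of_real r) (D i) \<in> P n" for i
    using n r(1) by (auto intro!: P_scale)
  have D: "D i \<in> mats V n" for i
    unfolding D_def by (rule mat_mem_mats) auto
  have Zm: "Z \<in> mats V n" unfolding Z by (rule mat_mem_mats) (use x in auto)
  have x': "invol V x \<in> carrier V" using x by (rule invol_closed)
  let ?C = "mat_conj V \<alpha> (norm_block V e r x)"
  have C: "?C \<in> mats V n" using r by (auto intro!: mat_conj_mats[OF \<alpha>] P_mats)
  have ZZ: "mat_add V Z (mat_star V Z) \<in> mats V n" using Zm by auto
  let ?DD = "mat_add V (mat_scale V (complex_of_real r) (D i)) (mat_scale V (complex_of_real r) (D j))"
  have "mat_add V (E (2 * r) n) (mat_neg V (mat_add V Z (mat_star V Z))) =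
    mat_add V ?C ?DD"
  proof (rule mats_eqI)
    fix p q assume pq: "p < n" "q < n"
    \<comment> \<open>With all conditional entries in coordinates, the case distinction at the end
      only compares scalars.\<close>
    have if1: "(if b then e else \<zero>\<^bsub>V\<^esub>) = lincomb3 e x (invol V x) (if b then 1 else 0) 0 0"
      "(if b then x else \<zero>\<^bsub>V\<^esub>) = lincomb3 e x (invol V x) 0 (if b then 1 else 0) 0"
      "(if b then invol V x else \<zero>\<^bsub>V\<^esub>) = lincomb3 e x (invol V x) 0 0 (if b then 1 else 0)" for b
      using x x' by (auto simp: lincomb3_def)
    have Z1: "Z $$ (p, q) = (if p = i \<and> q = j then x else \<zero>\<^bsub>V\<^esub>)"
      unfolding Z using pq by simp
    have Z2: "invol V (Z $$ (q, p)) = (if q = i \<and> p = j then invol V x else \<zero>\<^bsub>V\<^esub>)"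
      unfolding Z using pq by simp
    have l: "mat_add V (E (2 * r) n) (mat_neg V (mat_add V Z (mat_star V Z))) $$ (p, q) =
      complex_of_real (2 * r) \<odot>\<^bsub>V\<^esub> (if p = q then e else \<zero>\<^bsub>V\<^esub>) \<oplus>\<^bsub>V\<^esub>
      (\<ominus>\<^bsub>V\<^esub> ((if p = i \<and> q = j then x else \<zero>\<^bsub>V\<^esub>) \<oplus>\<^bsub>V\<^esub> (if q = i \<and> p = j then invol V x else \<zero>\<^bsub>V\<^esub>)))"
      unfolding mat_index(2)[OF pq E_mats] mat_index(3)[OF pq ZZ] mat_index(2)[OF pq Zm]
        mat_index(5)[OF pq Zm] E_index[OF pq] Z1 Z2 by (rule refl)
    have D1: "D k $$ (p, q) = (if p = q \<and> p \<noteq> k then e else \<zero>\<^bsub>V\<^esub>)" for k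
      unfolding D_def using pq by simp
    have rr: "mat_add V ?C ?DD $$ (p, q) =
       ?C $$ (p, q) \<oplus>\<^bsub>V\<^esub> (complex_of_real r \<odot>\<^bsub>V\<^esub> (if p = q \<and> p \<noteq> i then e else \<zero>\<^bsub>V\<^esub>)
       \<oplus>\<^bsub>V\<^esub> complex_of_real r \<odot>\<^bsub>V\<^esub> (if p = q \<and> p \<noteq> j then e else \<zero>\<^bsub>V\<^esub>))"
      unfolding mat_index(2)[OF pq C] mat_index(2)[OF pq mat_scale_mats[OF D]] mat_index(4)[OF pq D] D1
      by (rule refl)
    have \<alpha>1: "\<alpha> $$ (p, 0) = (if p = i then 1 else 0)" "\<alpha> $$ (q, 0) = (if q = i then 1 else 0)"
      "\<alpha> $$ (p, 1) = (if p = j then -1 else 0)" "\<alpha> $$ (q, 1) = (if q = j then -1 else 0)"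
      unfolding \<alpha>_def using pq by simp_all
    have ee: "e \<in> carrier V" by simp
    note lc = lincomb3_add[OF ee x x'] lincomb3_smult[OF ee x x'] lincomb3_neg[OF ee x x']
    show "mat_add V (E (2 * r) n) (mat_neg V (mat_add V Z (mat_star V Z))) $$ (p, q) = mat_add V ?C ?DD $$ (p, q)"
      unfolding l rr mat_conj_norm_block[OF \<alpha> x ee pq] if1 lc \<alpha>1
      by (cases "p = q"; cases "p = i"; cases "p = j"; cases "q = i"; cases "q = j"; simp add: mult.commute)
  qed (use C D ZZ in auto)
  moreover have "mat_add V ?C ?DD \<in> P n"
    using n r DP by (intro P_add P_conj[OF _ _ \<alpha>]) auto
  ultimately show ?thesis
    using r(1) by (intro exI[of _ "2 * r"]) auto
qed

text \<open>A single off-diagonal entry is not a hermitian matrix. Bounding \<open>Z\<close> plus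
  its adjoint for arbitrary \<open>Z\<close> makes it possible to add one entry at a time; a
  hermitian \<open>A\<close> is then treated with \<open>Z = A / 2\<close>.\<close>

lemma order_unit_add_star:
  assumes n: "n > 0" and Z: "Z \<in> mats V n"
  shows "\<exists>r>0. mat_add V (E r n) (mat_neg V (mat_add V Z (mat_star V Z))) \<in> P n"
proof -
  define ZF where "ZF F = mat n n (\<lambda>p. if p \<in> F then Z $$ p else \<zero>\<^bsub>V\<^esub>)" for F
  have ZF: "ZF F \<in> mats V n" for F
    unfolding ZF_def by (rule mat_mem_mats) (use Z in auto)
  have "\<exists>r>0. mat_add V (E r n) (mat_neg V (mat_add V (ZF F) (mat_star V (ZF F)))) \<in> P n"
    if "finite F" "F \<subseteq> {..<n} \<times> {..<n}" for F
    using that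
  proof (induction F rule: finite_induct)
    case empty
    have "ZF {} = mat n n (\<lambda>p. if p = (0, 0) then \<zero>\<^bsub>V\<^esub> else \<zero>\<^bsub>V\<^esub>)" by (rule eq_matI) (auto simp: ZF_def)
    then show ?case using mat_unit_elementary[OF n n n, of "\<zero>\<^bsub>V\<^esub>" "ZF {}"] by auto
  next
    case (insert p F)
    obtain i j where p: "p = (i, j)" "i < n" "j < n" using insert.prems by auto
    obtain r where r: "r > 0" "mat_add V (E r n) (mat_neg V (mat_add V (ZF F) (mat_star V (ZF F)))) \<in> P n"
      using insert by auto
    have "ZF {p} = mat n n (\<lambda>q. if q = (i, j) then Z $$ (i, j) else \<zero>\<^bsub>V\<^esub>)"
      by (rule eq_matI) (auto simp: ZF_def p)
    then obtain s where s: "s > 0" "mat_add V (E s n) (mat_neg V (mat_add V (ZF {p}) (mat_star V (ZF {p})))) \<in> P n"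
      using mat_unit_elementary[OF n p(2,3), of "Z $$ (i, j)" "ZF {p}"] Z p(2,3) by auto
    have eq: "mat_add V (ZF F) (ZF {p}) = ZF (insert p F)"
      by (rule mats_eqI[OF _ ZF]) (use ZF Z insert(2) in \<open>auto simp: mat_index(2)[OF _ _ ZF], auto simp: ZF_def\<close>)
    have eq': "mat_add V (mat_star V (ZF F)) (mat_star V (ZF {p})) = mat_star V (ZF (insert p F))"
      unfolding eq[symmetric]
      by (rule mats_eqI[of _ n]) (auto simp: ZF mat_index(2)[OF _ _ mat_star_mats[OF ZF]] mat_index(2)[OF _ _ ZF]
        mat_index(5)[OF _ _ mat_add_mats[OF ZF ZF]] mat_index(5)[OF _ _ ZF] invol_add mats_closed[OF _ _ ZF])
    have "mat_add V (E (r + s) n) (mat_neg V (mat_add V (ZF (insert p F)) (mat_star V (ZF (insert p F))))) \<in> P n"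
      using P_add[OF n r(2) s(2)]
      unfolding mat_neg_add_assoc[OF ZF ZF mat_star_mats[OF ZF] mat_star_mats[OF ZF]] eq eq' .
    then show ?case using r(1) s(1) by (intro exI[of _ "r + s"]) auto
  qed
  from this[of "{..<n} \<times> {..<n}"]
  have "\<exists>r>0. mat_add V (E r n) (mat_neg V (mat_add V (ZF ({..<n} \<times> {..<n})) (mat_star V (ZF ({..<n} \<times> {..<n}))))) \<in> P n"
    by simp
  moreover have "ZF ({..<n} \<times> {..<n}) = Z"
    by (rule mats_eqI[OF ZF Z]) (auto simp: ZF_def)
  ultimately show ?thesis by auto
qed

lemma order_unit:
  assumes n: "n > 0" and A: "A \<in> herm_mats V n"
  shows "\<exists>r>0. mat_add V (E r n) (mat_neg V A) \<in> P n"
proof -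
  let ?Z = "mat_scale V (1/2) A"
  have Am: "A \<in> mats V n" using A by (rule herm_matsD)
  have "mat_add V ?Z (mat_star V ?Z) = A"
  proof (rule mats_eqI)
    fix i j assume ij: "i < n" "j < n"
    have "mat_add V ?Z (mat_star V ?Z) $$ (i, j) = (1/2) \<odot>\<^bsub>V\<^esub> A $$ (i, j) \<oplus>\<^bsub>V\<^esub> (1/2) \<odot>\<^bsub>V\<^esub> A $$ (i, j)"
      using ij Am by (simp add: mat_index(2)[OF _ _ mat_scale_mats[OF Am]] mat_index(5)[OF _ _ mat_scale_mats[OF Am]]
        invol_smult herm_mats_index[OF A] mats_closed[OF _ _ Am])
    also have "\<dots> = A $$ (i, j)"
      using ij Am by (simp add: smult_add_left[symmetric])
    finally show "mat_add V ?Z (mat_star V ?Z) $$ (i, j) = A $$ (i, j)" .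
  qed (use Am in auto)
  then show ?thesis using order_unit_add_star[OF n, of ?Z] Am by auto
qed

section \<open>The closed cones form an operator system\<close>

lemma P_subset_closure:
  assumes "n > 0" "A \<in> P n"
  shows "A \<in> mpos (archimedeanization V e P) n"
  using assms P_mats E_P P_add by simp

lemma E_add: "A \<in> mats V n \<Longrightarrow> B \<in> mats V n \<Longrightarrow>
   mat_add V (E (r + s) n) (mat_add V A B) = mat_add V (mat_add V (E r n) A) (mat_add V (E s n) B)"
  by (rule mats_eqI) (auto simp: mat_index(2)[OF _ _ E_mats] mat_index(2)[OF _ _ mat_add_mats[OF E_mats]]
    E_index smult_add_left a_ac)

lemma E_scale: "A \<in> mats V n \<Longrightarrow>
   mat_scale V (complex_of_real s) (mat_add V (E r n) A) = mat_add V (E (s * r) n) (mat_scale V (complex_of_real s) A)"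
  by (rule mats_eqI) (auto simp: mat_index(2)[OF _ _ E_mats] mat_index(4)[OF _ _ mat_add_mats[OF E_mats]]
    E_index smult_add_right)

lemma E_assoc: "A \<in> mats V n \<Longrightarrow>
   mat_add V (E (r + s) n) A = mat_add V (E r n) (mat_add V (E s n) A)"
  by (rule mats_eqI) (auto simp: mat_index(2)[OF _ _ E_mats] E_index smult_add_left a_ac)

lemma E_1: "E 1 n = mat_diag_const V n e"
  by (rule mats_eqI[OF E_mats]) (auto simp: E_index)

theorem operator_system_archimedeanization: "operator_system (archimedeanization V e P)"
proof -
  interpret A: star_vector_space "archimedeanization V e P"
    by (rule star_vector_space_archimedeanization) unfold_locales
  let ?A = "archimedeanization V e P"
  show ?thesis
  proof
    fix n :: nat assume n: "n > 0"
    show "mpos ?A n \<subseteq> herm_mats ?A n"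
    proof
      fix X assume "X \<in> mpos ?A n"
      then have X: "X \<in> mats V n" "\<forall>r>0. mat_add V (E r n) X \<in> P n"
        by auto
      \<comment> \<open>The perturbed matrix is hermitian, and the unit that was added is hermitian
        as well, so it can be cancelled on the diagonal.\<close>
      have X': "mat_add V (E 1 n) X \<in> herm_mats V n"
        by (rule subsetD[OF P_herm[OF n]], rule X(2)[rule_format]) simp
      show "X \<in> herm_mats ?A n"
        unfolding archimedeanization_mats
      proof (rule herm_matsI[OF X(1)])
        fix i j assume ij: "i < n" "j < n"
        show "invol V (X $$ (j, i)) = X $$ (i, j)"
          using herm_mats_index[OF X' ij] ij X(1)
          by (cases "i = j") (auto simp: mat_index(2)[OF _ _ E_mats] E_index invol_add invol_smult invol_closed)
      qed
    qed
    show "mpos ?A n \<noteq> {}"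
    proof -
      have "E 1 n \<in> mpos ?A n"
        by (rule P_subset_closure[OF n E_P[OF n]]) simp
      then show ?thesis by blast
    qed
    show "mat_add ?A X Y \<in> mpos ?A n" if "X \<in> mpos ?A n" "Y \<in> mpos ?A n" for X Y
    proof -
      have "mat_add V (E r n) (mat_add V X Y) \<in> P n" if "r > 0" for r
        using E_add[of X n Y "r/2" "r/2"] P_add[OF n, of "mat_add V (E (r/2) n) X" "mat_add V (E (r/2) n) Y"]
          \<open>X \<in> mpos ?A n\<close> \<open>Y \<in> mpos ?A n\<close> that by (simp del: of_real_divide)
      then show ?thesis using that by auto
    qed
    show "mat_scale ?A (complex_of_real r) X \<in> mpos ?A n" if "X \<in> mpos ?A n" "r \<ge> 0" for X and r :: real
    proof -
      have X: "X \<in> mats V n" using that by auto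
      \<comment> \<open>For \<open>r > 0\<close> the perturbation is pulled back to
        \<open>s / r\<close>; for \<open>r = 0\<close> the matrix is just
        \<open>s e\<close>.\<close>
      have "mat_add V (E s n) (mat_scale V (complex_of_real r) X) \<in> P n" if s: "s > 0" for s
      proof (cases "r = 0")
        case True
        have "mat_add V (E s n) (mat_scale V (complex_of_real r) X) = E s n"
          using X True by (intro mats_eqI[of _ n]) (auto simp: mat_index(2)[OF _ _ E_mats] E_index)
        then show ?thesis using E_P[OF n] s by auto
      next
        case False
        then have "mat_add V (E (s/r) n) X \<in> P n" using \<open>r \<ge> 0\<close> s \<open>X \<in> mpos ?A n\<close> by (simp del: of_real_divide)
        then show ?thesis
          using P_scale[OF n _ \<open>r \<ge> 0\<close>, of "mat_add V (E (s/r) n) X"] E_scale[OF X, of r "s/r"] False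
          by (simp del: of_real_divide)
      qed
      then show ?thesis using X by auto
    qed
    show "X = mat_zero ?A n" if "X \<in> mpos ?A n" "mat_neg ?A X \<in> mpos ?A n" for X
      using that P_proper[OF n, of X] by simp
    show "mat_conj ?A \<alpha> X \<in> mpos ?A n"
      if m: "m > 0" and \<alpha>: "\<alpha> \<in> carrier_mat n m" and X: "X \<in> mpos ?A m" for \<alpha> m X
    proof -
      have Xm: "X \<in> mats V m" using X by simp
      have "E 1 m \<in> herm_mats V m"
        by (rule subsetD[OF P_herm[OF m] E_P[OF m]]) simp
      then have "mat_diag_const V m e \<in> herm_mats V m" unfolding E_1 .
      \<comment> \<open>The compression of the unit by \<open>\<alpha>\<close> is in general no
        multiple of the unit. It is bounded by \<open>R e\<close>, so the perturbation
        \<open>s e\<close> dominates \<open>t = s / R\<close> times it, and the latter comes from a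
        perturbation before compression.\<close>
      from mat_conj_herm[OF \<alpha> this]
      obtain R where R: "R > 0" "mat_add V (E R n) (mat_neg V (mat_conj V \<alpha> (mat_diag_const V m e))) \<in> P n"
        using order_unit[OF n] by auto
      have C: "mat_conj V \<alpha> (mat_diag_const V m e) \<in> mats V n" "mat_conj V \<alpha> X \<in> mats V n"
        using mat_conj_mats[OF \<alpha>] Xm by auto
      have "mat_add V (E s n) (mat_conj V \<alpha> X) \<in> P n" if s: "s > 0" for s
      proof -
        define t where "t = s / R"
        have t: "t > 0" "t * R = s" using s R(1) by (auto simp: t_def)
        have 1: "mat_add V (mat_scale V (complex_of_real t) (mat_conj V \<alpha> (mat_diag_const V m e))) (mat_conj V \<alpha> X) \<in> P n"
          using P_conj[OF n m \<alpha>, of "mat_add V (E t m) X"] X t(1)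
          by (simp add: mat_conj_add[OF \<alpha>] mat_conj_scale[OF \<alpha>])
        have 2: "mat_scale V (complex_of_real t) (mat_add V (E R n) (mat_neg V (mat_conj V \<alpha> (mat_diag_const V m e)))) \<in> P n"
          using R t by (intro P_scale[OF n]) auto
        have "mat_add V (E s n) (mat_conj V \<alpha> X) =
          mat_add V (mat_scale V (complex_of_real t) (mat_add V (E R n) (mat_neg V (mat_conj V \<alpha> (mat_diag_const V m e)))))
           (mat_add V (mat_scale V (complex_of_real t) (mat_conj V \<alpha> (mat_diag_const V m e))) (mat_conj V \<alpha> X))"
          by (rule mat_dominated[OF mat_diag_const_mats[OF e_closed] C t(2)])
        then show ?thesis using P_add[OF n 2 1] by simp
      qed
      then show ?thesis using C by auto
    qed
    show "\<exists>r>0. mat_add ?A (scalar_mat ?A n r (ounit ?A)) (mat_neg ?A X) \<in> mpos ?A n"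
      if "X \<in> herm_mats ?A n" for X
      using order_unit[OF n, of X] that P_subset_closure[OF n] by fastforce
    show "X \<in> mpos ?A n" if X: "X \<in> mats ?A n"
      and "\<And>r::real. r > 0 \<Longrightarrow> mat_add ?A (scalar_mat ?A n r (ounit ?A)) X \<in> mpos ?A n" for X
    proof -
      have "mat_add V (E r n) X \<in> P n" if "r > 0" for r
        using E_assoc[of X n "r/2" "r/2"] X \<open>\<And>r::real. r > 0 \<Longrightarrow> mat_add ?A _ X \<in> mpos ?A n\<close>[of "r/2"] \<open>r > 0\<close>
        by (simp del: of_real_divide)
      then show ?thesis using X by simp
    qed
  qed auto
qed

end

section \<open>Transport of structure\<close>

text \<open>Serves to bring an operator system into the type over which universality is tested; all
  operations are computed in \<open>V\<close> via the inverse of \<open>j\<close>.\<close>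

definition transport :: "('a \<Rightarrow> 'b) \<Rightarrow> 'a op_sys \<Rightarrow> 'b op_sys" where
  "transport j V = (let k = inv_into (carrier V) j in \<lparr>
     carrier = j ` carrier V, monoid.mult = undefined, one = undefined, zero = j \<zero>\<^bsub>V\<^esub>,
     add = (\<lambda>x y. j (k x \<oplus>\<^bsub>V\<^esub> k y)), smult = (\<lambda>c x. j (c \<odot>\<^bsub>V\<^esub> k x)),
     invol = (\<lambda>x. j (invol V (k x))), ounit = j (ounit V), mpos = (\<lambda>n. map_mat j ` mpos V n)\<rparr>)"

lemma ucpI:
  assumes "linear_map V W f" "\<And>n A. n > 0 \<Longrightarrow> A \<in> mpos V n \<Longrightarrow> map_mat f A \<in> mpos W n" "f (ounit V) = ounit W"
  shows "ucp V W f"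
  using assms by (auto simp: ucp_def completely_positive_def)

lemma ucpD:
  assumes "ucp V W f"
  shows "linear_map V W f" "\<And>n A. n > 0 \<Longrightarrow> A \<in> mpos V n \<Longrightarrow> map_mat f A \<in> mpos W n" "f (ounit V) = ounit W"
  using assms by (auto simp: ucp_def completely_positive_def)

lemma ucp_comp:
  assumes "ucp V W f" "ucp W X g"
  shows "ucp V X (g \<circ> f)"
proof (rule ucpI)
  show "linear_map V X (g \<circ> f)"
    using ucpD(1)[OF assms(1)] ucpD(1)[OF assms(2)] by (auto intro!: linear_mapI simp: linear_mapD)
  show "map_mat (g \<circ> f) A \<in> mpos X n" if "n > 0" "A \<in> mpos V n" for n A
  proof -
    have "map_mat (g \<circ> f) A = map_mat g (map_mat f A)" by (rule eq_matI) auto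
    then show ?thesis using that ucpD(2)[OF assms(1)] ucpD(2)[OF assms(2)] by simp
  qed
qed (use ucpD(3)[OF assms(1)] ucpD(3)[OF assms(2)] in simp)

context matrix_ordered_space
begin

lemma mpos_mats: "n > 0 \<Longrightarrow> A \<in> mpos V n \<Longrightarrow> A \<in> mats V n"
  using mpos_herm herm_matsD by blast

end

lemma
  fixes V :: "'a op_sys" and j :: "'a \<Rightarrow> 'b"
  assumes "operator_system V" and inj: "inj_on j (carrier V)"
  shows operator_system_transport: "operator_system (transport j V)"
    and ucp_transport: "ucp V (transport j V) j"
    and ucp_transport_inv: "ucp (transport j V) V (inv_into (carrier V) j)"
proof -
  interpret V: operator_system V by fact
  let ?k = "inv_into (carrier V) j"
  define W where "W = transport j V"
  have k [simp]: "?k (j x) = x" if "x \<in> carrier V" for x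
    using inv_into_f_f[OF inj that] .
  have W: "carrier W = j ` carrier V" "\<zero>\<^bsub>W\<^esub> = j \<zero>\<^bsub>V\<^esub>"
    "\<And>x y. x \<oplus>\<^bsub>W\<^esub> y = j (?k x \<oplus>\<^bsub>V\<^esub> ?k y)" "\<And>c x. c \<odot>\<^bsub>W\<^esub> x = j (c \<odot>\<^bsub>V\<^esub> ?k x)"
    "\<And>x. invol W x = j (invol V (?k x))" "ounit W = j (ounit V)" "\<And>n. mpos W n = map_mat j ` mpos V n"
    by (auto simp: W_def transport_def Let_def)
  interpret W: star_vector_space W
    by (rule star_vector_spaceI)
      (auto simp: W V.invol_closed V.invol_invol V.invol_add V.invol_smult V.a_ac V.smult_add_left V.smult_add_right)
  have linj: "linear_map V W j"
    by (rule linear_mapI) (auto simp: W)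
  have link: "linear_map W V ?k"
    by (rule linear_mapI) (auto simp: W)
  interpret J: star_linear_map V W j by unfold_locales (fact linj)
  interpret K: star_linear_map W V ?k by unfold_locales (fact link)
  have jk: "map_mat j (map_mat ?k A) = A" if "A \<in> mats W n" for A n
  proof (rule W.mats_eqI)
    fix i l assume "i < n" "l < n"
    moreover from this have "A $$ (i, l) \<in> carrier W" using that by auto
    ultimately show "map_mat j (map_mat ?k A) $$ (i, l) = A $$ (i, l)"
      using that by (auto simp: W(1) W.mats_dim[OF that])
  qed (use that in auto)
  have kj: "map_mat ?k (map_mat j A) = A" if "A \<in> mats V n" for A n
    by (rule V.mats_eqI[of _ n]) (use that in \<open>auto simp: K.map_mat_index[OF _ _ J.map_mat_mats[OF that]]\<close>)
  \<comment> \<open>Through this equivalence each axiom for \<open>W\<close> is pulled back to the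
    one for \<open>V\<close>.\<close>
  have pos_iff: "A \<in> mpos W n \<longleftrightarrow> map_mat ?k A \<in> mpos V n" if "A \<in> mats W n" "n > 0" for A n
  proof
    assume "A \<in> mpos W n"
    then obtain B where "B \<in> mpos V n" "A = map_mat j B" unfolding W(7) by blast
    then show "map_mat ?k A \<in> mpos V n" using kj[OF V.mpos_mats[OF that(2)]] by simp
  next
    assume "map_mat ?k A \<in> mpos V n"
    then have "map_mat j (map_mat ?k A) \<in> mpos W n" unfolding W(7) by (rule imageI)
    then show "A \<in> mpos W n" using jk[OF that(1)] by simp
  qed
  have invk: "?k (invol W x) = invol V (?k x)" if "x \<in> carrier W" for x
    using that by (auto simp: W V.invol_closed)
  have mat_star: "map_mat ?k (mat_star W A) = mat_star V (map_mat ?k A)" if "A \<in> mats W n" for A n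
    by (rule V.mats_eqI[of _ n])
      (use that in \<open>auto simp: K.map_mat_index[OF _ _ W.mat_star_mats] V.mat_index(5)[OF _ _ K.map_mat_mats] invk\<close>)
  have herm_iff: "A \<in> herm_mats W n \<longleftrightarrow> map_mat ?k A \<in> herm_mats V n" if "A \<in> mats W n" for A n
  proof -
    have "mat_star W A = A \<longleftrightarrow> map_mat ?k (mat_star W A) = map_mat ?k A"
      using jk[OF that] jk[OF W.mat_star_mats[OF that]] by metis
    then show ?thesis using that by (auto simp: herm_mats_def mat_star)
  qed
  have mposW: "A \<in> mats W n" if "A \<in> mpos W n" "n > 0" for A n
    using that V.mpos_mats[OF that(2)] by (auto simp: W(7))
  have e: "ounit W \<in> carrier W" "?k (ounit W) = ounit V"
    using V.ounit_closed by (auto simp: W)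
  show "operator_system W"
  proof
    fix n :: nat assume n: "n > 0"
    show "mpos W n \<subseteq> herm_mats W n"
    proof
      fix A assume A: "A \<in> mpos W n"
      then show "A \<in> herm_mats W n"
        using pos_iff[OF mposW[OF A n] n] V.mpos_herm[OF n] herm_iff[OF mposW[OF A n]] by auto
    qed
    show "mpos W n \<noteq> {}" using V.mpos_nonempty[OF n] by (simp add: W)
    show "mat_add W A B \<in> mpos W n" if "A \<in> mpos W n" "B \<in> mpos W n" for A B
      using that mposW[OF that(1) n] mposW[OF that(2) n] V.mpos_add[OF n]
      by (simp add: pos_iff[OF _ n] K.map_mat_add)
    show "mat_scale W (complex_of_real r) A \<in> mpos W n" if "A \<in> mpos W n" "0 \<le> r" for A r
      using that mposW[OF that(1) n] V.mpos_scale[OF n]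
      by (simp add: pos_iff[OF _ n] K.map_mat_scale)
    show "A = mat_zero W n" if "A \<in> mpos W n" "mat_neg W A \<in> mpos W n" for A
    proof -
      note A = mposW[OF that(1) n]
      have "map_mat ?k A = mat_zero V n"
        using that A by (intro V.mpos_proper[OF n]) (simp_all add: pos_iff[OF _ n] K.map_mat_neg)
      then show ?thesis using jk[OF A] J.map_mat_zero by metis
    qed
    show "mat_conj W \<alpha> A \<in> mpos W n" if "m > 0" "\<alpha> \<in> carrier_mat n m" "A \<in> mpos W m" for m \<alpha> A
      using that mposW[OF that(3,1)] V.mpos_conj[OF n that(1,2)] W.mat_conj_mats[OF that(2)]
      by (simp add: pos_iff[OF _ n] pos_iff[OF _ that(1)] K.map_mat_conj)
    show "\<exists>r>0. mat_add W (scalar_mat W n r (ounit W)) (mat_neg W A) \<in> mpos W n"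
      if A: "A \<in> herm_mats W n" for A
    proof -
      have "A \<in> mats W n" using A by (rule W.herm_matsD)
      then show ?thesis
        using V.matrix_order_unit[OF n, of "map_mat ?k A"] A e herm_iff[of A n]
        by (simp add: pos_iff[OF _ n] K.map_mat_add[of _ n] K.map_mat_neg[of _ n] K.map_mat_scale[of _ n] K.map_mat_diag_const)
    qed
    show "A \<in> mpos W n" if "A \<in> mats W n" and
      *: "\<And>r::real. r > 0 \<Longrightarrow> mat_add W (scalar_mat W n r (ounit W)) A \<in> mpos W n" for A
      unfolding pos_iff[OF that(1) n]
    proof (rule V.archimedean[OF n])
      show "mat_add V (scalar_mat V n r (ounit V)) (map_mat ?k A) \<in> mpos V n" if "r > 0" for r :: real
        using *[OF that] \<open>A \<in> mats W n\<close> e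
        by (simp add: pos_iff[OF _ n] K.map_mat_add[of _ n] K.map_mat_scale[of _ n] K.map_mat_diag_const)
    qed (use that in auto)
  qed (use V.ounit_closed V.ounit_herm in \<open>auto simp: W\<close>)
  show "ucp V W j"
    by (rule ucpI[OF linj]) (simp_all add: W)
  show "ucp W V ?k"
    by (rule ucpI[OF link]) (simp_all add: e pos_iff[symmetric] mposW)
qed

section \<open>The complex numbers as an operator system\<close>

definition complex_star :: "complex star_space" where
  "complex_star = \<lparr>carrier = UNIV, monoid.mult = undefined, one = undefined, zero = 0, add = (+),
     smult = (*), invol = cnj\<rparr>"

text \<open>The compression of \<open>A\<close> by the row vector \<open>v\<close>, that is, the
  \<open>1 \<times> 1\<close> case of \<open>mat_conj\<close>; hence the conjugate on the second
  index.\<close>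

definition qform :: "nat \<Rightarrow> (nat \<Rightarrow> complex) \<Rightarrow> complex mat \<Rightarrow> complex" where
  "qform n v A = (\<Sum>k<n. \<Sum>l<n. v k * cnj (v l) * A $$ (k, l))"

text \<open>The order on the complex numbers compares only numbers with equal imaginary parts, so
  the condition says that all values of the form are real and nonnegative. Being hermitian follows
  by polarization.\<close>

definition psd :: "nat \<Rightarrow> complex mat set" where
  "psd n = {A \<in> carrier_mat n n. \<forall>v. 0 \<le> qform n v A}"

text \<open>The cones are closed already, see \<open>mpos_complex_sys\<close>. Passing through the
  closure yields the operator system axioms from the general theorem.\<close>

definition complex_sys :: "complex op_sys" where
  "complex_sys = archimedeanization complex_star 1 psd"

lemma complex_star_simps [simp]:
  "carrier complex_star = UNIV" "zero complex_star = 0" "add complex_star = (+)"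
  "smult complex_star = (*)" "invol complex_star = cnj"
  by (simp_all add: complex_star_def)

interpretation complex_star: star_vector_space complex_star
  by (rule star_vector_spaceI) (auto simp: algebra_simps)

lemma finsum_complex_star [simp]: "finsum complex_star f I = sum f I"
  by (induction I rule: infinite_finite_induct) auto

lemma a_inv_complex_star [simp]: "a_inv complex_star x = - x"
  by (simp add: complex_star.neg_eq_smult)

lemma mats_complex_star [simp]: "mats complex_star n = carrier_mat n n"
  by (auto simp: mats_def)

section \<open>Quadratic forms and positive semidefinite matrices\<close>

lemma qform_add:
  "A \<in> carrier_mat n n \<Longrightarrow> B \<in> carrier_mat n n \<Longrightarrow>
    qform n v (mat_add complex_star A B) = qform n v A + qform n v B"
  by (simp add: qform_def algebra_simps sum.distrib)

lemma qform_scale: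
  "A \<in> carrier_mat n n \<Longrightarrow> qform n v (mat_scale complex_star c A) = c * qform n v A"
  by (simp add: qform_def algebra_simps sum_distrib_left)

lemma qform_neg:
  "A \<in> carrier_mat n n \<Longrightarrow> qform n v (mat_neg complex_star A) = - qform n v A"
  by (simp add: qform_def algebra_simps sum_negf)

lemma qform_conj:
  assumes "\<alpha> \<in> carrier_mat n m"
  shows "qform n v (mat_conj complex_star \<alpha> A) = qform m (\<lambda>k. \<Sum>i<n. v i * \<alpha> $$ (i, k)) A"
proof -
  have "qform n v (mat_conj complex_star \<alpha> A) =
    (\<Sum>i<n. \<Sum>j<n. \<Sum>k<m. \<Sum>l<m. v i * \<alpha> $$ (i, k) * cnj (v j * \<alpha> $$ (j, l)) * A $$ (k, l))"
    using assms by (simp add: qform_def complex_star.mat_conj_index' sum_distrib_left sum_distrib_right mult_ac)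
  also have "\<dots> = (\<Sum>i<n. \<Sum>k<m. \<Sum>j<n. \<Sum>l<m. v i * \<alpha> $$ (i, k) * cnj (v j * \<alpha> $$ (j, l)) * A $$ (k, l))"
    by (intro sum.cong refl sum.swap)
  also have "\<dots> = (\<Sum>k<m. \<Sum>i<n. \<Sum>j<n. \<Sum>l<m. v i * \<alpha> $$ (i, k) * cnj (v j * \<alpha> $$ (j, l)) * A $$ (k, l))"
    by (rule sum.swap)
  also have "\<dots> = (\<Sum>k<m. \<Sum>i<n. \<Sum>l<m. \<Sum>j<n. v i * \<alpha> $$ (i, k) * cnj (v j * \<alpha> $$ (j, l)) * A $$ (k, l))"
    by (intro sum.cong refl sum.swap)
  also have "\<dots> = (\<Sum>k<m. \<Sum>l<m. \<Sum>i<n. \<Sum>j<n. v i * \<alpha> $$ (i, k) * cnj (v j * \<alpha> $$ (j, l)) * A $$ (k, l))"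
    by (intro sum.cong refl sum.swap)
  also have "\<dots> = qform m (\<lambda>k. \<Sum>i<n. v i * \<alpha> $$ (i, k)) A"
    by (simp add: qform_def cnj_sum sum_distrib_left sum_distrib_right mult_ac) (intro sum.cong refl sum.swap)
  finally show ?thesis .
qed

lemma qform_diag: "qform n v (mat_diag_const complex_star n c) = c * (\<Sum>k<n. v k * cnj (v k))"
proof -
  have "(\<Sum>l<n. v k * cnj (v l) * (if k = l then c else 0)) = v k * cnj (v k) * c" if "k < n" for k
    using that by (simp add: if_distrib[of "(*) _"] cong: if_cong)
  then show ?thesis
    by (simp add: qform_def sum_distrib_left mult_ac cong: if_cong)
qed

text \<open>The test vector \<open>e_i + c e_j\<close> is a sum of two indicator functions, so that
  \<open>i = j\<close> is allowed. With \<open>c\<close> equal to 0, 1 and \<i> it recovers the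
  entries by polarization.\<close>

lemma qform_two:
  assumes "i < n" "j < n"
  shows "qform n (\<lambda>k. (if k = i then 1 else 0) + (if k = j then c else 0)) A =
    A $$ (i, i) + cnj c * A $$ (i, j) + c * A $$ (j, i) + c * cnj c * A $$ (j, j)"
proof -
  have *: "(\<Sum>k<n. ((if k = i then 1 else 0) + (if k = j then c else 0)) * f k) = f i + c * f j" for c :: complex and f
  proof -
    have "(\<Sum>k<n. ((if k = i then 1 else 0) + (if k = j then c else 0)) * f k) =
      (\<Sum>k<n. (if k = i then f k else 0) + (if k = j then c * f k else 0))"
      by (intro sum.cong) (auto simp: algebra_simps)
    then show ?thesis using assms by (simp add: sum.distrib)
  qed
  have "qform n (\<lambda>k. (if k = i then 1 else 0) + (if k = j then c else 0)) A =
    (\<Sum>k<n. ((if k = i then 1 else 0) + (if k = j then c else 0)) *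
      (\<Sum>l<n. ((if l = i then 1 else 0) + (if l = j then cnj c else 0)) * A $$ (k, l)))"
    unfolding qform_def sum_distrib_left by (intro sum.cong) auto
  also have "\<dots> = A $$ (i, i) + cnj c * A $$ (i, j) + c * A $$ (j, i) + c * cnj c * A $$ (j, j)"
    unfolding * by (simp add: algebra_simps)
  finally show ?thesis .
qed

lemma qform_real_imp_herm:
  assumes "\<And>v. Im (qform n v A) = 0" "i < n" "j < n"
  shows "A $$ (j, i) = cnj (A $$ (i, j))"
proof -
  have d: "Im (A $$ (k, k)) = 0" if "k < n" for k
    using assms(1)[of "\<lambda>l. (if l = k then 1 else 0) + (if l = k then 0 else 0)"] qform_two[OF that that, of 0 A]
    by simp
  show ?thesis
    using assms(1)[of "\<lambda>l. (if l = i then 1 else 0) + (if l = j then 1 else 0)"] qform_two[OF assms(2,3), of 1 A]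
      assms(1)[of "\<lambda>l. (if l = i then 1 else 0) + (if l = j then \<i> else 0)"] qform_two[OF assms(2,3), of \<i> A]
      d[OF assms(2)] d[OF assms(3)]
    by (simp add: complex_eq_iff)
qed

lemma qform_zero_imp_zero:
  assumes "\<And>v. qform n v A = 0" "i < n" "j < n"
  shows "A $$ (i, j) = 0"
proof -
  have d: "A $$ (k, k) = 0" if "k < n" for k
    using assms(1)[of "\<lambda>l. (if l = k then 1 else 0) + (if l = k then 0 else 0)"] qform_two[OF that that, of 0 A]
    by simp
  have "A $$ (i, j) + A $$ (j, i) = 0" "- \<i> * A $$ (i, j) + \<i> * A $$ (j, i) = 0"
    using assms(1)[of "\<lambda>l. (if l = i then 1 else 0) + (if l = j then 1 else 0)"] qform_two[OF assms(2,3), of 1 A]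
      assms(1)[of "\<lambda>l. (if l = i then 1 else 0) + (if l = j then \<i> else 0)"] qform_two[OF assms(2,3), of \<i> A]
      d[OF assms(2)] d[OF assms(3)]
    by simp_all
  then show ?thesis by (simp add: complex_eq_iff)
qed

lemma qform_nonneg_of_closure:
  assumes "A \<in> carrier_mat n n"
    "\<And>r::real. r > 0 \<Longrightarrow>
      mat_add complex_star (scalar_mat complex_star n r 1) A \<in> psd n"
  shows "0 \<le> qform n v A"
proof -
  define N where "N = (\<Sum>k<n. v k * cnj (v k))"
  have D: "mat_diag_const complex_star n 1 \<in> carrier_mat n n" by (simp add: mat_diag_const_def)
  have DS: "mat_scale complex_star c (mat_diag_const complex_star n 1) \<in> carrier_mat n n" for c
    by (simp add: mat_diag_const_def mat_scale_def)
  have N0: "0 \<le> N" unfolding N_def by (intro sum_nonneg) (simp add: less_eq_complex_def)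
  have *: "0 \<le> complex_of_real r * N + qform n v A" if "r > 0" for r
    using assms(2)[OF that] assms(1)
    by (simp add: psd_def qform_add[OF DS] qform_scale[OF D] qform_diag N_def)
  from *[of 1] N0 have im: "Im (qform n v A) = 0" by (simp add: less_eq_complex_def)
  have "0 \<le> Re (qform n v A) + e" if "e > 0" for e
  proof -
    \<comment> \<open>The perturbation is chosen so small that it contributes at most
      \<open>e\<close>; the \<open>+ 1\<close> covers \<open>N = 0\<close>.\<close>
    have "0 \<le> e / (Re N + 1) * Re N + Re (qform n v A)"
      using *[of "e / (Re N + 1)"] N0 that by (simp add: less_eq_complex_def)
    also have "e / (Re N + 1) * Re N \<le> e"
      using N0 that by (simp add: less_eq_complex_def field_simps)
    finally show ?thesis by simp
  qed
  then have "0 \<le> Re (qform n v A)" by (rule field_le_epsilon)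
  with im show ?thesis by (simp add: less_eq_complex_def)
qed

interpretation complex_arch: archimedeanizable complex_star 1 psd
proof
  fix n :: nat assume n: "n > 0"
  show "psd n \<subseteq> herm_mats complex_star n"
  proof
    fix A assume A: "A \<in> psd n"
    then have im: "Im (qform n v A) = 0" for v
      by (simp add: psd_def less_eq_complex_def)
    show "A \<in> herm_mats complex_star n"
    proof (rule complex_star.herm_matsI)
      show "A \<in> mats complex_star n" using A by (simp add: psd_def)
      show "invol complex_star (A $$ (j, i)) = A $$ (i, j)" if "i < n" "j < n" for i j
        using qform_real_imp_herm[OF im that] by simp
    qed
  qed
  show "mat_add complex_star A B \<in> psd n" if "A \<in> psd n" "B \<in> psd n" for A B
    using that complex_star.mat_add_mats[of A n B] by (auto simp: psd_def qform_add)
  show "mat_scale complex_star (complex_of_real r) A \<in> psd n" if "A \<in> psd n" "r \<ge> 0" for A r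
    using that complex_star.mat_scale_mats[of A n] by (auto simp: psd_def qform_scale less_eq_complex_def)
  show "mat_conj complex_star \<alpha> A \<in> psd n" if "\<alpha> \<in> carrier_mat n m" "A \<in> psd m" for \<alpha> m A
    using that complex_star.mat_conj_mats[OF that(1), of A] by (auto simp: psd_def qform_conj)
  show "A = mat_zero complex_star n" if A: "A \<in> mats complex_star n" and
     "\<And>r::real. r > 0 \<Longrightarrow> mat_add complex_star (scalar_mat complex_star n r 1) A \<in> psd n"
     "\<And>r::real. r > 0 \<Longrightarrow> mat_add complex_star (scalar_mat complex_star n r 1) (mat_neg complex_star A) \<in> psd n" for A
  proof (rule complex_star.mats_eqI[OF A])
    have "0 \<le> qform n v A" "0 \<le> qform n v (mat_neg complex_star A)" for v
      using that complex_star.mat_neg_mats[OF A] by (auto intro!: qform_nonneg_of_closure)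
    then have "qform n v A = 0" for v
      using A qform_neg[of A n v] by (metis antisym mats_complex_star neg_0_le_iff_le)
    then show "A $$ (i, j) = mat_zero complex_star n $$ (i, j)" if "i < n" "j < n" for i j
      using that qform_zero_imp_zero[of n A i j] \<open>\<And>v. qform n v A = 0\<close> by simp
  qed (rule complex_star.mat_zero_mats)
next
  fix x :: complex
  \<comment> \<open>Already \<open>cmod x\<close> makes the block positive semidefinite, by the
    inequality between geometric and arithmetic mean; the \<open>+ 1\<close> makes the constant
    positive.\<close>
  let ?r = "cmod x + 1"
  have "0 \<le> qform 2 v (norm_block complex_star 1 ?r x)" for v
  proof -
    have "qform 2 v (norm_block complex_star 1 ?r x) =
      complex_of_real ?r * (v 0 * cnj (v 0)) + complex_of_real ?r * (v 1 * cnj (v 1)) +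
        (v 0 * cnj (v 1) * x + cnj (v 0 * cnj (v 1) * x))"
      by (simp add: qform_def norm_block_def numeral_2_eq_2 lessThan_Suc)
    then have q: "qform 2 v (norm_block complex_star 1 ?r x) =
      complex_of_real (?r * ((cmod (v 0))\<^sup>2 + (cmod (v 1))\<^sup>2)) + (v 0 * cnj (v 1) * x + cnj (v 0 * cnj (v 1) * x))"
      unfolding complex_norm_square[symmetric] by (simp add: distrib_left)
    have "\<bar>2 * Re (v 0 * cnj (v 1) * x)\<bar> \<le> 2 * cmod (v 0 * cnj (v 1) * x)"
      using abs_Re_le_cmod[of "v 0 * cnj (v 1) * x"] by simp
    also have "\<dots> = cmod x * (2 * cmod (v 0) * cmod (v 1))" by (simp add: norm_mult)
    also have "\<dots> \<le> cmod x * ((cmod (v 0))\<^sup>2 + (cmod (v 1))\<^sup>2)"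
      by (intro mult_left_mono sum_squares_bound) auto
    also have "\<dots> \<le> ?r * ((cmod (v 0))\<^sup>2 + (cmod (v 1))\<^sup>2)"
      by (intro mult_right_mono) auto
    finally show ?thesis
      unfolding q complex_add_cnj less_eq_complex_def by simp
  qed
  then show "\<exists>r>0. norm_block complex_star 1 r x \<in> psd 2"
    by (intro exI[of _ ?r]) (simp add: psd_def norm_block_def add_nonneg_pos)
qed simp_all

lemma operator_system_complex: "operator_system complex_sys"
  unfolding complex_sys_def by (rule complex_arch.operator_system_archimedeanization)

lemma complex_sys_simps [simp]:
  "carrier complex_sys = UNIV" "zero complex_sys = 0" "add complex_sys = (+)"
  "smult complex_sys = (*)" "invol complex_sys = cnj" "ounit complex_sys = 1"
  by (simp_all add: complex_sys_def)

lemma mpos_complex_sys: "n > 0 \<Longrightarrow> mpos complex_sys n = psd n"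
proof (intro equalityI subsetI)
  fix A assume "n > 0" "A \<in> mpos complex_sys n"
  then have "A \<in> carrier_mat n n" "\<And>r::real. r > 0 \<Longrightarrow>
      mat_add complex_star (scalar_mat complex_star n r 1) A \<in> psd n"
    by (simp_all add: complex_sys_def)
  then show "A \<in> psd n"
    using qform_nonneg_of_closure[of A n] by (simp add: psd_def)
qed (simp only: complex_sys_def complex_arch.P_subset_closure)

section \<open>States separate points\<close>

context star_vector_space
begin

definition hermitian :: "'a set" where
  "hermitian = {x \<in> carrier V. invol V x = x}"

lemma hermitian_closed [simp, intro]:
  "x \<in> hermitian \<Longrightarrow> y \<in> hermitian \<Longrightarrow> x \<oplus>\<^bsub>V\<^esub> y \<in> hermitian"
  "x \<in> hermitian \<Longrightarrow> complex_of_real t \<odot>\<^bsub>V\<^esub> x \<in> hermitian"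
  "\<zero>\<^bsub>V\<^esub> \<in> hermitian"
  by (auto simp: hermitian_def invol_add invol_smult)

lemma hermitianI: "x \<in> carrier V \<Longrightarrow> invol V x = x \<Longrightarrow> x \<in> hermitian"
  by (simp add: hermitian_def)

lemma hermitian_invol: "x \<in> hermitian \<Longrightarrow> invol V x = x"
  by (simp add: hermitian_def)

lemma hermitian_carrier [simp]: "x \<in> hermitian \<Longrightarrow> x \<in> carrier V"
  by (simp add: hermitian_def)

definition re_part :: "'a \<Rightarrow> 'a" where
  "re_part x = (1/2) \<odot>\<^bsub>V\<^esub> (x \<oplus>\<^bsub>V\<^esub> invol V x)"

definition im_part :: "'a \<Rightarrow> 'a" where
  "im_part x = (- \<i>/2) \<odot>\<^bsub>V\<^esub> (x \<oplus>\<^bsub>V\<^esub> (- 1) \<odot>\<^bsub>V\<^esub> invol V x)"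

lemma re_im_hermitian:
  assumes x: "x \<in> carrier V"
  shows "re_part x \<in> hermitian" "im_part x \<in> hermitian"
  using x invol_closed[OF x]
  by (auto intro!: hermitianI simp: re_part_def im_part_def invol_add invol_smult invol_invol
    smult_add_right a_comm)

lemma re_im_decomposition:
  assumes x: "x \<in> carrier V"
  shows "x = re_part x \<oplus>\<^bsub>V\<^esub> \<i> \<odot>\<^bsub>V\<^esub> im_part x"
proof -
  have ix: "invol V x \<in> carrier V" using x by (rule invol_closed)
  have "re_part x \<oplus>\<^bsub>V\<^esub> \<i> \<odot>\<^bsub>V\<^esub> im_part x = ((1/2) \<odot>\<^bsub>V\<^esub> x \<oplus>\<^bsub>V\<^esub> (1/2) \<odot>\<^bsub>V\<^esub> x) \<oplus>\<^bsub>V\<^esub>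
     ((1/2) \<odot>\<^bsub>V\<^esub> invol V x \<oplus>\<^bsub>V\<^esub> (-1/2) \<odot>\<^bsub>V\<^esub> invol V x)"
    using x ix by (simp add: re_part_def im_part_def smult_add_right a_ac)
  also have "\<dots> = x" using x ix by (simp add: smult_add_left[symmetric])
  finally show ?thesis by simp
qed

section \<open>Sublinear functionals and the Hahn-Banach theorem on the hermitian part\<close>

definition sublinear :: "('a \<Rightarrow> real) \<Rightarrow> bool" where
  "sublinear q \<longleftrightarrow> (\<forall>x\<in>hermitian. \<forall>y\<in>hermitian. q (x \<oplus>\<^bsub>V\<^esub> y) \<le> q x + q y) \<and>
     (\<forall>x\<in>hermitian. \<forall>t\<ge>0. q (complex_of_real t \<odot>\<^bsub>V\<^esub> x) = t * q x)"

lemma sublinearD: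
  assumes "sublinear q" "x \<in> hermitian"
  shows "y \<in> hermitian \<Longrightarrow> q (x \<oplus>\<^bsub>V\<^esub> y) \<le> q x + q y"
    and "t \<ge> 0 \<Longrightarrow> q (complex_of_real t \<odot>\<^bsub>V\<^esub> x) = t * q x"
    and "q \<zero>\<^bsub>V\<^esub> = 0"
    and "0 \<le> q x + q (complex_of_real (- 1) \<odot>\<^bsub>V\<^esub> x)"
proof -
  show 1: "q \<zero>\<^bsub>V\<^esub> = 0"
    using assms smult_null[of x] unfolding sublinear_def by (metis hermitian_carrier mult_zero_left of_real_0 order_refl)
  have "x \<oplus>\<^bsub>V\<^esub> complex_of_real (- 1) \<odot>\<^bsub>V\<^esub> x = \<zero>\<^bsub>V\<^esub>"
    using smult_add_left[of x 1 "-1"] assms(2) by simp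
  then show "0 \<le> q x + q (complex_of_real (- 1) \<odot>\<^bsub>V\<^esub> x)"
    using assms 1 hermitian_closed(2)[OF assms(2), of "-1"] unfolding sublinear_def by metis
qed (use assms in \<open>auto simp: sublinear_def\<close>)

text \<open>Common to three infima: the tilt, the infimum of a chain, and the gauge
  \<open>inf {t. x \<le> t e}\<close>. Homogeneity is asked for as an inequality with positive
  scalars only; equality follows by applying it to \<open>c\<close> and to
  \<open>1 / c\<close>.\<close>

lemma sublinear_Inf:
  assumes ne: "\<And>x. x \<in> hermitian \<Longrightarrow> T x \<noteq> {}"
    and bdd: "\<And>x. x \<in> hermitian \<Longrightarrow> bdd_below (T x)"
    and add: "\<And>x y s t. x \<in> hermitian \<Longrightarrow> y \<in> hermitian \<Longrightarrow> s \<in> T x \<Longrightarrow> t \<in> T y \<Longrightarrow>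
      \<exists>r\<in>T (x \<oplus>\<^bsub>V\<^esub> y). r \<le> s + t"
    and scale: "\<And>x c t. x \<in> hermitian \<Longrightarrow> (c::real) > 0 \<Longrightarrow> t \<in> T x \<Longrightarrow>
      \<exists>r\<in>T (complex_of_real c \<odot>\<^bsub>V\<^esub> x). r \<le> c * t"
    and zero: "Inf (T \<zero>\<^bsub>V\<^esub>) = (0::real)"
  shows "sublinear (\<lambda>x. Inf (T x))"
proof -
  have le: "Inf (T x) \<le> u" if "x \<in> hermitian" "r \<in> T x" "r \<le> u" for x r u
    using cInf_lower[OF that(2) bdd[OF that(1)]] that(3) by simp
  have *: "Inf (T (complex_of_real c \<odot>\<^bsub>V\<^esub> x)) \<le> c * Inf (T x)" if x: "x \<in> hermitian" and c: "c > 0" for x c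
  proof -
    have "Inf (T (complex_of_real c \<odot>\<^bsub>V\<^esub> x)) / c \<le> Inf (T x)"
    proof (rule cInf_greatest[OF ne[OF x]])
      fix t assume "t \<in> T x"
      then obtain r where r: "r \<in> T (complex_of_real c \<odot>\<^bsub>V\<^esub> x)" "r \<le> c * t"
        using scale[OF x c] by auto
      show "Inf (T (complex_of_real c \<odot>\<^bsub>V\<^esub> x)) / c \<le> t"
        using le[OF hermitian_closed(2)[OF x] r] c by (simp add: pos_divide_le_eq mult.commute)
    qed
    then show ?thesis using c by (simp add: field_simps)
  qed
  show ?thesis
    unfolding sublinear_def
  proof (intro conjI ballI allI impI)
    fix x y assume xy: "x \<in> hermitian" "y \<in> hermitian"
    have "Inf (T (x \<oplus>\<^bsub>V\<^esub> y)) - Inf (T y) \<le> Inf (T x)"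
    proof (rule cInf_greatest[OF ne[OF xy(1)]])
      fix s assume s: "s \<in> T x"
      have "Inf (T (x \<oplus>\<^bsub>V\<^esub> y)) - s \<le> Inf (T y)"
      proof (rule cInf_greatest[OF ne[OF xy(2)]])
        fix t assume "t \<in> T y"
        then show "Inf (T (x \<oplus>\<^bsub>V\<^esub> y)) - s \<le> t"
          using add[OF xy s] le[of "x \<oplus>\<^bsub>V\<^esub> y" _ "s + t"] xy by fastforce
      qed
      then show "Inf (T (x \<oplus>\<^bsub>V\<^esub> y)) - Inf (T y) \<le> s" by simp
    qed
    then show "Inf (T (x \<oplus>\<^bsub>V\<^esub> y)) \<le> Inf (T x) + Inf (T y)" by simp
  next
    fix x and c :: real assume x: "x \<in> hermitian" and c: "c \<ge> 0"
    show "Inf (T (complex_of_real c \<odot>\<^bsub>V\<^esub> x)) = c * Inf (T x)"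
    proof (cases "c = 0")
      case False
      then have c: "c > 0" using c by simp
      have "Inf (T (complex_of_real (1/c) \<odot>\<^bsub>V\<^esub> (complex_of_real c \<odot>\<^bsub>V\<^esub> x))) \<le> (1/c) * Inf (T (complex_of_real c \<odot>\<^bsub>V\<^esub> x))"
        using x c by (intro *) auto
      then have "c * Inf (T x) \<le> Inf (T (complex_of_real c \<odot>\<^bsub>V\<^esub> x))"
        using x c by (simp add: field_simps)
      then show ?thesis using *[OF x c] by simp
    qed (use x zero in simp)
  qed
qed

text \<open>The infimum of \<open>q (x + t y) - t q y\<close> over \<open>t \<ge> 0\<close>: the largest sublinear functional below
  \<open>q\<close> that is linear in the direction of \<open>y\<close>.\<close>

definition tilt :: "('a \<Rightarrow> real) \<Rightarrow> 'a \<Rightarrow> 'a \<Rightarrow> real" where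
  "tilt q y x = Inf ((\<lambda>t. q (x \<oplus>\<^bsub>V\<^esub> complex_of_real t \<odot>\<^bsub>V\<^esub> y) - t * q y) ` {0..})"

lemma tilt:
  assumes q: "sublinear q" and y: "y \<in> hermitian"
  shows sublinear_tilt: "sublinear (tilt q y)"
    and tilt_le: "x \<in> hermitian \<Longrightarrow> t \<ge> 0 \<Longrightarrow> tilt q y x \<le> q (x \<oplus>\<^bsub>V\<^esub> complex_of_real t \<odot>\<^bsub>V\<^esub> y) - t * q y"
proof -
  let ?T = "\<lambda>x. (\<lambda>t. q (x \<oplus>\<^bsub>V\<^esub> complex_of_real t \<odot>\<^bsub>V\<^esub> y) - t * q y) ` {0..}"
  \<comment> \<open>From \<open>t y = - x + (x + t y)\<close> and subadditivity.\<close>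
  have bdd: "- q (complex_of_real (- 1) \<odot>\<^bsub>V\<^esub> x) \<le> q (x \<oplus>\<^bsub>V\<^esub> complex_of_real t \<odot>\<^bsub>V\<^esub> y) - t * q y"
    if x: "x \<in> hermitian" and t: "t \<ge> 0" for x t
  proof -
    have "complex_of_real (- 1) \<odot>\<^bsub>V\<^esub> x \<oplus>\<^bsub>V\<^esub> x = \<zero>\<^bsub>V\<^esub>"
      using smult_add_left[of x "-1" 1] x by simp
    then have "(complex_of_real (- 1) \<odot>\<^bsub>V\<^esub> x) \<oplus>\<^bsub>V\<^esub> (x \<oplus>\<^bsub>V\<^esub> complex_of_real t \<odot>\<^bsub>V\<^esub> y) = complex_of_real t \<odot>\<^bsub>V\<^esub> y"
      using x y by (simp add: a_assoc[symmetric])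
    then have "t * q y \<le> q (complex_of_real (- 1) \<odot>\<^bsub>V\<^esub> x) + q (x \<oplus>\<^bsub>V\<^esub> complex_of_real t \<odot>\<^bsub>V\<^esub> y)"
      using sublinearD(1)[OF q hermitian_closed(2)[OF x, of "-1"], of "x \<oplus>\<^bsub>V\<^esub> complex_of_real t \<odot>\<^bsub>V\<^esub> y"]
        sublinearD(2)[OF q y t] x y by (simp del: of_real_minus)
    then show ?thesis by simp
  qed
  have bb: "bdd_below (?T x)" if "x \<in> hermitian" for x
    using bdd[OF that] by (intro bdd_belowI[of _ "- q (complex_of_real (- 1) \<odot>\<^bsub>V\<^esub> x)"]) auto
  show "tilt q y x \<le> q (x \<oplus>\<^bsub>V\<^esub> complex_of_real t \<odot>\<^bsub>V\<^esub> y) - t * q y" if "x \<in> hermitian" "t \<ge> 0" for x t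
    unfolding tilt_def using that by (intro cInf_lower bb) auto
  have "sublinear (\<lambda>x. Inf (?T x))"
  proof (rule sublinear_Inf)
    fix x x' s t assume x: "x \<in> hermitian" "x' \<in> hermitian" and "s \<in> ?T x" "t \<in> ?T x'"
    then obtain a b where ab: "a \<ge> 0" "b \<ge> 0" "s = q (x \<oplus>\<^bsub>V\<^esub> complex_of_real a \<odot>\<^bsub>V\<^esub> y) - a * q y"
      "t = q (x' \<oplus>\<^bsub>V\<^esub> complex_of_real b \<odot>\<^bsub>V\<^esub> y) - b * q y" by auto
    have eq: "(x \<oplus>\<^bsub>V\<^esub> complex_of_real a \<odot>\<^bsub>V\<^esub> y) \<oplus>\<^bsub>V\<^esub> (x' \<oplus>\<^bsub>V\<^esub> complex_of_real b \<odot>\<^bsub>V\<^esub> y) =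
      (x \<oplus>\<^bsub>V\<^esub> x') \<oplus>\<^bsub>V\<^esub> complex_of_real (a + b) \<odot>\<^bsub>V\<^esub> y"
      using x y by (simp add: smult_add_left a_ac)
    have "q ((x \<oplus>\<^bsub>V\<^esub> x') \<oplus>\<^bsub>V\<^esub> complex_of_real (a + b) \<odot>\<^bsub>V\<^esub> y) - (a + b) * q y \<le> s + t"
      using sublinearD(1)[OF q, of "x \<oplus>\<^bsub>V\<^esub> complex_of_real a \<odot>\<^bsub>V\<^esub> y" "x' \<oplus>\<^bsub>V\<^esub> complex_of_real b \<odot>\<^bsub>V\<^esub> y"] x y
      unfolding eq ab by (simp add: algebra_simps)
    then show "\<exists>r\<in>?T (x \<oplus>\<^bsub>V\<^esub> x'). r \<le> s + t" using ab(1,2) by (auto intro!: bexI[of _ "a + b"])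
  next
    fix x t and c :: real assume x: "x \<in> hermitian" and c: "c > 0" and "t \<in> ?T x"
    then obtain a where a: "a \<ge> 0" "t = q (x \<oplus>\<^bsub>V\<^esub> complex_of_real a \<odot>\<^bsub>V\<^esub> y) - a * q y" by auto
    have eq: "complex_of_real c \<odot>\<^bsub>V\<^esub> (x \<oplus>\<^bsub>V\<^esub> complex_of_real a \<odot>\<^bsub>V\<^esub> y) =
      complex_of_real c \<odot>\<^bsub>V\<^esub> x \<oplus>\<^bsub>V\<^esub> complex_of_real (c * a) \<odot>\<^bsub>V\<^esub> y"
      using x y by (simp add: smult_add_right)
    have "q (complex_of_real c \<odot>\<^bsub>V\<^esub> x \<oplus>\<^bsub>V\<^esub> complex_of_real (c * a) \<odot>\<^bsub>V\<^esub> y) - (c * a) * q y \<le> c * t"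
      using sublinearD(2)[OF q, of "x \<oplus>\<^bsub>V\<^esub> complex_of_real a \<odot>\<^bsub>V\<^esub> y" c] x y c
      unfolding eq a by (simp add: algebra_simps)
    then show "\<exists>r\<in>?T (complex_of_real c \<odot>\<^bsub>V\<^esub> x). r \<le> c * t"
      using a(1) c by (auto intro!: bexI[of _ "c * a"])
  next
    have "?T \<zero>\<^bsub>V\<^esub> = {0}"
      using y sublinearD(2)[OF q y] by (auto intro!: image_eqI[of _ _ 0])
    then show "Inf (?T \<zero>\<^bsub>V\<^esub>) = 0" by simp
  qed (use bb in auto)
  then show "sublinear (tilt q y)" by (simp add: tilt_def[abs_def])
qed

lemma exists_minimal_sublinear:
  assumes p: "sublinear p"
  shows "\<exists>q. sublinear q \<and> (\<forall>x\<in>hermitian. q x \<le> p x) \<and>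
    (\<forall>q'. sublinear q' \<longrightarrow> (\<forall>x\<in>hermitian. q' x \<le> q x) \<longrightarrow> (\<forall>x\<in>hermitian. q' x = q x))"
proof -
  \<comment> \<open>Fixing the values off the hermitian part makes the pointwise order of functions
    agree with comparison on the hermitian part, as the application of Zorn's lemma
    requires.\<close>
  define Q where "Q = {q. sublinear q \<and> (\<forall>x\<in>hermitian. q x \<le> p x) \<and> (\<forall>x. x \<notin> hermitian \<longrightarrow> q x = 0)}"
  have sub_cong: "sublinear (\<lambda>x. if x \<in> hermitian then q x else 0)" if "sublinear q" for q
    using that by (auto simp: sublinear_def)
  have "\<exists>m\<in>Q. \<forall>a\<in>Q. a \<le> m \<longrightarrow> a = m"
  proof (rule predicate_Zorn)
    show "partial_order_on Q (relation_of (\<lambda>a b. b \<le> a) Q)"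
      by (auto simp: partial_order_on_def preorder_on_def refl_on_def trans_def antisym_def relation_of_def)
  next
    fix C assume C: "C \<in> Chains (relation_of (\<lambda>a b. b \<le> a) Q)"
    then have CQ: "C \<subseteq> Q" and chain: "\<And>a b. a \<in> C \<Longrightarrow> b \<in> C \<Longrightarrow> a \<le> b \<or> b \<le> a"
      by (auto simp: Chains_def relation_of_def)
    show "\<exists>u\<in>Q. \<forall>a\<in>C. u \<le> a"
    proof (cases "C = {}")
      case True
      then show ?thesis
        using sub_cong[OF p] by (intro bexI[of _ "\<lambda>x. if x \<in> hermitian then p x else 0"]) (auto simp: Q_def)
    next
      case False
      define T where "T x = (\<lambda>q. q x) ` C" for x
      \<comment> \<open>Subadditivity gives \<open>- q (- x) \<le> q x\<close>, and
        \<open>q \<le> p\<close> makes this bound uniform along the chain, so the infimum is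
        finite.\<close>
      have low: "- p (complex_of_real (- 1) \<odot>\<^bsub>V\<^esub> x) \<le> q x" if "x \<in> hermitian" "q \<in> C" for x q
      proof -
        have q: "sublinear q" "q (complex_of_real (- 1) \<odot>\<^bsub>V\<^esub> x) \<le> p (complex_of_real (- 1) \<odot>\<^bsub>V\<^esub> x)"
          using that CQ hermitian_closed(2)[OF that(1), of "-1"] by (auto simp: Q_def)
        show ?thesis using sublinearD(4)[OF q(1) that(1)] q(2) by linarith
      qed
      have bdd: "bdd_below (T x)" for x
      proof (cases "x \<in> hermitian")
        case True
        then show ?thesis
          unfolding T_def using low by (intro bdd_belowI[of _ "- p (complex_of_real (- 1) \<odot>\<^bsub>V\<^esub> x)"]) auto
      next
        case False
        then show ?thesis
          unfolding T_def using CQ by (intro bdd_belowI[of _ 0]) (auto simp: Q_def)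
      qed
      have CS: "sublinear q" if "q \<in> C" for q using that CQ by (auto simp: Q_def)
      have "sublinear (\<lambda>x. Inf (T x))"
      proof (rule sublinear_Inf)
        fix x y s t assume xy: "x \<in> hermitian" "y \<in> hermitian" and "s \<in> T x" "t \<in> T y"
        then obtain a b where ab: "a \<in> C" "b \<in> C" "s = a x" "t = b y" by (auto simp: T_def)
        obtain c where c: "c \<in> C" "c \<le> a" "c \<le> b" using chain[OF ab(1,2)] ab by auto
        have "c (x \<oplus>\<^bsub>V\<^esub> y) \<le> c x + c y" using sublinearD(1)[OF CS[OF c(1)] xy] .
        also have "\<dots> \<le> s + t" using c(2,3) by (auto simp: ab le_fun_def intro!: add_mono)
        finally show "\<exists>r\<in>T (x \<oplus>\<^bsub>V\<^esub> y). r \<le> s + t" using c(1) by (auto simp: T_def)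
      next
        fix x t and c :: real assume "x \<in> hermitian" "c > 0" "t \<in> T x"
        then show "\<exists>r\<in>T (complex_of_real c \<odot>\<^bsub>V\<^esub> x). r \<le> c * t"
          using sublinearD(2)[OF CS] by (fastforce simp: T_def)
      next
        have "T \<zero>\<^bsub>V\<^esub> = {0}"
          using False sublinearD(3)[OF CS hermitian_closed(3)] by (force simp: T_def)
        then show "Inf (T \<zero>\<^bsub>V\<^esub>) = 0" by simp
      qed (use False bdd in \<open>auto simp: T_def\<close>)
      moreover have "Inf (T x) \<le> q x" if "q \<in> C" for q x
        using that by (intro cInf_lower bdd) (auto simp: T_def)
      moreover have "Inf (T x) = 0" if "x \<notin> hermitian" for x
      proof -
        have "T x = {0}" using that False CQ by (force simp: T_def Q_def)
        then show ?thesis by simp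
      qed
      moreover obtain q where "q \<in> C" "q \<in> Q" using False CQ by auto
      ultimately have "(\<lambda>x. Inf (T x)) \<in> Q"
        using order_trans unfolding Q_def by blast
      then show ?thesis
        using \<open>\<And>q x. q \<in> C \<Longrightarrow> Inf (T x) \<le> q x\<close> by (intro bexI[of _ "\<lambda>x. Inf (T x)"]) (auto simp: le_fun_def)
    qed
  qed
  then obtain m where m: "m \<in> Q" "\<And>a. a \<in> Q \<Longrightarrow> a \<le> m \<Longrightarrow> a = m" by blast
  have "\<forall>x\<in>hermitian. q' x = m x" if q': "sublinear q'" "\<forall>x\<in>hermitian. q' x \<le> m x" for q'
  proof -
    let ?a = "\<lambda>x. if x \<in> hermitian then q' x else 0"
    have "?a \<in> Q" using sub_cong[OF q'(1)] q'(2) m(1) order_trans by (fastforce simp: Q_def)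
    moreover have "?a \<le> m" using q'(2) m(1) by (auto simp: le_fun_def Q_def)
    ultimately have "?a = m" by (rule m(2))
    then show ?thesis
    proof (intro ballI)
      fix x assume "x \<in> hermitian"
      then show "q' x = m x" using fun_cong[OF \<open>?a = m\<close>, of x] by simp
    qed
  qed
  moreover have "sublinear m" "\<forall>x\<in>hermitian. m x \<le> p x" using m(1) by (simp_all add: Q_def)
  ultimately show ?thesis by (intro exI[of _ m] conjI allI impI)
qed

text \<open>A minimal sublinear functional is linear, since its tilt in any direction lies below it
  and hence equals it. The minimal one is taken below the tilt of \<open>p\<close> along
  \<open>w\<close>, not merely below \<open>p\<close>; this forces the value \<open>p w\<close> at
  \<open>w\<close>.\<close>

theorem Hahn_Banach_hermitian:
  assumes p: "sublinear p" and w: "w \<in> hermitian"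
  shows "\<exists>q. (\<forall>x\<in>hermitian. \<forall>y\<in>hermitian. q (x \<oplus>\<^bsub>V\<^esub> y) = q x + q y) \<and>
    (\<forall>x\<in>hermitian. \<forall>t. q (complex_of_real t \<odot>\<^bsub>V\<^esub> x) = t * q x) \<and>
    (\<forall>x\<in>hermitian. q x \<le> p x) \<and> q w = p w"
proof -
  from exists_minimal_sublinear[OF sublinear_tilt[OF p w]]
  obtain q where q: "sublinear q" "\<forall>x\<in>hermitian. q x \<le> tilt p w x"
    and min: "\<forall>q'. sublinear q' \<longrightarrow> (\<forall>x\<in>hermitian. q' x \<le> q x) \<longrightarrow> (\<forall>x\<in>hermitian. q' x = q x)"
    by (elim exE conjE)
  have add: "q (x \<oplus>\<^bsub>V\<^esub> y) = q x + q y" if xy: "x \<in> hermitian" "y \<in> hermitian" for x y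
  proof -
    have "tilt q y u \<le> q u" if "u \<in> hermitian" for u
      using tilt_le[OF q(1) xy(2) that, of 0] that xy by simp
    then have "tilt q y x = q x"
      using min[rule_format, OF sublinear_tilt[OF q(1) xy(2)] _ xy(1)] by simp
    then have "q x \<le> q (x \<oplus>\<^bsub>V\<^esub> y) - q y"
      using tilt_le[OF q(1) xy(2,1), of 1] xy by simp
    then show ?thesis using sublinearD(1)[OF q(1) xy] by simp
  qed
  have neg: "q (complex_of_real (- 1) \<odot>\<^bsub>V\<^esub> x) = - q x" if x: "x \<in> hermitian" for x
  proof -
    have "x \<oplus>\<^bsub>V\<^esub> complex_of_real (- 1) \<odot>\<^bsub>V\<^esub> x = \<zero>\<^bsub>V\<^esub>"
      using smult_add_left[of x 1 "-1"] x by simp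
    then show ?thesis
      using add[OF x hermitian_closed(2)[OF x, of "-1"]] sublinearD(3)[OF q(1) x] by simp
  qed
  have scale: "q (complex_of_real t \<odot>\<^bsub>V\<^esub> x) = t * q x" if x: "x \<in> hermitian" for t x
  proof (cases "t \<ge> 0")
    case False
    have "complex_of_real t \<odot>\<^bsub>V\<^esub> x = complex_of_real (- t) \<odot>\<^bsub>V\<^esub> (complex_of_real (- 1) \<odot>\<^bsub>V\<^esub> x)"
      using x by simp
    then have "q (complex_of_real t \<odot>\<^bsub>V\<^esub> x) = - t * q (complex_of_real (- 1) \<odot>\<^bsub>V\<^esub> x)"
      using sublinearD(2)[OF q(1) hermitian_closed(2)[OF x, of "-1"], of "- t"] False by (simp only:)
    then show ?thesis by (simp only: neg[OF x])
  qed (use sublinearD(2)[OF q(1) x] in simp)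
  have le: "q x \<le> p x" if "x \<in> hermitian" for x
    using q(2)[rule_format, OF that] tilt_le[OF p w that, of 0] that w by simp
  have "complex_of_real (- 1) \<odot>\<^bsub>V\<^esub> w \<oplus>\<^bsub>V\<^esub> w = \<zero>\<^bsub>V\<^esub>"
    using smult_add_left[of w "-1" 1] w by simp
  \<comment> \<open>The tilt at \<open>- w\<close> is at most its term for \<open>t = 1\<close>,
    which is \<open>p 0 - p w\<close>; this bounds \<open>q w\<close> from below by
    \<open>p w\<close>.\<close>
  then have "q (complex_of_real (- 1) \<odot>\<^bsub>V\<^esub> w) \<le> - p w"
    using q(2)[rule_format, OF hermitian_closed(2)[OF w, of "-1"]] tilt_le[OF p w hermitian_closed(2)[OF w, of "-1"], of 1]
      sublinearD(3)[OF p w] w by simp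
  then have "q w = p w" using neg[OF w] le[OF w] by simp
  with add scale le show ?thesis by blast
qed

lemma singleton_mat_mats: "mat 1 1 (\<lambda>_. x) \<in> mats V 1 \<longleftrightarrow> x \<in> carrier V"
  by (auto simp: mats_def)

end

section \<open>Positive elements and the existence of states\<close>

context operator_system
begin

lemma one_pos_nat: "0 < (1::nat)"
  by simp

definition positive :: "'a \<Rightarrow> bool" where
  "positive x \<longleftrightarrow> mat 1 1 (\<lambda>_. x) \<in> mpos V 1"

lemma mats_1: "A \<in> mats V 1 \<Longrightarrow> A = mat 1 1 (\<lambda>_. A $$ (0, 0))"
  by (rule eq_matI) auto

lemma positive_entry: "A \<in> mpos V 1 \<Longrightarrow> positive (A $$ (0, 0))"
  using mats_1[OF mpos_mats[of 1 A]] by (simp add: positive_def)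

lemma positive_hermitian: "positive x \<Longrightarrow> x \<in> hermitian"
proof -
  assume x: "positive x"
  then have A: "mat 1 1 (\<lambda>_. x) \<in> herm_mats V 1"
    using mpos_herm[of 1] by (auto simp: positive_def)
  show ?thesis
    using herm_mats_index[OF A, of 0 0] herm_matsD(1)[OF A] singleton_mat_mats[of x] by (intro hermitianI) auto
qed

lemma positive_carrier [simp]: "positive x \<Longrightarrow> x \<in> carrier V"
  using positive_hermitian by simp

lemma positive_add: "positive x \<Longrightarrow> positive y \<Longrightarrow> positive (x \<oplus>\<^bsub>V\<^esub> y)"
proof -
  assume xy: "positive x" "positive y"
  have "mat_add V (mat 1 1 (\<lambda>_. x)) (mat 1 1 (\<lambda>_. y)) = mat 1 1 (\<lambda>_. x \<oplus>\<^bsub>V\<^esub> y)"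
    by (rule eq_matI) (auto simp: mat_add_def)
  then show ?thesis
    using mpos_add[OF one_pos_nat xy[unfolded positive_def]] unfolding positive_def by simp
qed

lemma positive_scale: "positive x \<Longrightarrow> r \<ge> 0 \<Longrightarrow> positive (complex_of_real r \<odot>\<^bsub>V\<^esub> x)"
proof -
  assume x: "positive x" "r \<ge> 0"
  have "mat_scale V (complex_of_real r) (mat 1 1 (\<lambda>_. x)) = mat 1 1 (\<lambda>_. complex_of_real r \<odot>\<^bsub>V\<^esub> x)"
    by (rule eq_matI) (auto simp: mat_scale_def)
  then show ?thesis using x mpos_scale[of 1 _ r] by (force simp: positive_def)
qed

lemma positive_proper: "positive x \<Longrightarrow> positive (\<ominus>\<^bsub>V\<^esub> x) \<Longrightarrow> x = \<zero>\<^bsub>V\<^esub>"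
proof -
  assume x: "positive x" "positive (\<ominus>\<^bsub>V\<^esub> x)"
  have "mat_neg V (mat 1 1 (\<lambda>_. x)) = mat 1 1 (\<lambda>_. \<ominus>\<^bsub>V\<^esub> x)"
    by (rule eq_matI) (auto simp: mat_neg_def)
  then have "mat 1 1 (\<lambda>_. x) = mat_zero V 1"
    using x mpos_proper[of 1] by (auto simp: positive_def)
  then have "mat 1 1 (\<lambda>_. x) $$ (0, 0) = mat_zero V 1 $$ (0, 0)" by simp
  then show ?thesis by (simp add: mat_zero_def)
qed

lemma unit_combination_mat:
  "mat_add V (mat_scale V c (mat_diag_const V 1 (ounit V))) (mat 1 1 (\<lambda>_. x)) = mat 1 1 (\<lambda>_. c \<odot>\<^bsub>V\<^esub> ounit V \<oplus>\<^bsub>V\<^esub> x)"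
  by (rule eq_matI) (auto simp: mat_add_def mat_scale_def mat_diag_const_def)

lemma ounit_hermitian [simp]: "ounit V \<in> hermitian"
  using ounit_closed ounit_herm by (rule hermitianI)

lemma positive_order_unit:
  assumes "x \<in> hermitian"
  shows "\<exists>r>0. positive (complex_of_real r \<odot>\<^bsub>V\<^esub> ounit V \<oplus>\<^bsub>V\<^esub> (\<ominus>\<^bsub>V\<^esub> x))"
proof -
  have "mat 1 1 (\<lambda>_. x) \<in> herm_mats V 1"
    using assms hermitian_invol[OF assms]
    by (intro herm_matsI) (simp_all only: singleton_mat_mats hermitian_carrier, simp)
  moreover have "mat_neg V (mat 1 1 (\<lambda>_. x)) = mat 1 1 (\<lambda>_. \<ominus>\<^bsub>V\<^esub> x)"
    by (rule eq_matI) (auto simp: mat_neg_def)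
  ultimately show ?thesis
    using matrix_order_unit[OF one_pos_nat, of "mat 1 1 (\<lambda>_. x)"]
    unfolding positive_def unit_combination_mat[symmetric] by simp
qed

lemma positive_archimedean:
  assumes "x \<in> carrier V" "\<And>r. r > 0 \<Longrightarrow> positive (complex_of_real r \<odot>\<^bsub>V\<^esub> ounit V \<oplus>\<^bsub>V\<^esub> x)"
  shows "positive x"
  unfolding positive_def
proof (rule archimedean[OF one_pos_nat])
  show "mat_add V (scalar_mat V 1 r (ounit V)) (mat 1 1 (\<lambda>_. x)) \<in> mpos V 1"
    if "r > 0" for r
    using assms(2)[OF that] unfolding positive_def unit_combination_mat .
qed (use assms(1) in \<open>simp only: singleton_mat_mats\<close>)

lemma positive_ounit: "positive (ounit V)"
proof -
  obtain r where "r > 0" "positive (complex_of_real r \<odot>\<^bsub>V\<^esub> ounit V \<oplus>\<^bsub>V\<^esub> (\<ominus>\<^bsub>V\<^esub> \<zero>\<^bsub>V\<^esub>))"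
    using positive_order_unit[of "\<zero>\<^bsub>V\<^esub>"] by auto
  then show ?thesis
    using positive_scale[of "complex_of_real r \<odot>\<^bsub>V\<^esub> ounit V" "1/r"] ounit_closed by (simp add: neg_eq_smult)
qed

text \<open>The order unit property of the zero matrix makes some multiple \<open>s e\<close> with
  \<open>s > 0\<close> positive; rescaling gives the others.\<close>

lemma mat_unit_mpos:
  assumes n: "n > 0" and r: "r \<ge> 0"
  shows "scalar_mat V n r (ounit V) \<in> mpos V n"
proof -
  have z: "mat_zero V n \<in> herm_mats V n"
    by (rule herm_matsI) auto
  obtain s where s: "s > 0" "mat_add V (scalar_mat V n s (ounit V)) (mat_neg V (mat_zero V n)) \<in> mpos V n"
    using matrix_order_unit[OF n z] by blast
  note d = mat_diag_const_mats[OF ounit_closed, of n]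
  have "mat_scale V (complex_of_real (r / s)) (mat_add V (scalar_mat V n s (ounit V)) (mat_neg V (mat_zero V n)))
     = scalar_mat V n r (ounit V)"
  proof (rule mats_eqI)
    fix i j assume ij: "i < n" "j < n"
    show "mat_scale V (complex_of_real (r / s)) (mat_add V (scalar_mat V n s (ounit V)) (mat_neg V (mat_zero V n))) $$ (i, j)
      = scalar_mat V n r (ounit V) $$ (i, j)"
      unfolding mat_index(4)[OF ij mat_add_mats[OF mat_scale_mats[OF d] mat_neg_mats[OF mat_zero_mats]]]
        mat_index(2)[OF ij mat_scale_mats[OF d]] mat_index(4)[OF ij d] mat_index(3)[OF ij mat_zero_mats]
      using ij s(1) ounit_closed by (simp add: neg_eq_smult)
  qed (use d in auto)
  then show ?thesis
    using mpos_scale[OF n s(2), of "r / s"] s(1) r by simp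
qed

text \<open>Hahn-Banach is applied to \<open>p x = inf {t. x \<le> t e}\<close>: by the Archimedean property, \<open>0 < p (-x)\<close>
  if \<open>x\<close> is not positive.\<close>

lemma exists_real_state_negative:
  assumes x: "x \<in> hermitian" "\<not> positive x" and e: "ounit V \<noteq> \<zero>\<^bsub>V\<^esub>"
  shows "\<exists>q. (\<forall>x\<in>hermitian. \<forall>y\<in>hermitian. q (x \<oplus>\<^bsub>V\<^esub> y) = q x + q y) \<and>
    (\<forall>x\<in>hermitian. \<forall>t. q (complex_of_real t \<odot>\<^bsub>V\<^esub> x) = t * q x) \<and>
    (\<forall>x. positive x \<longrightarrow> 0 \<le> q x) \<and> q (ounit V) = (1::real) \<and> q x \<noteq> 0"
proof -
  let ?e = "ounit V"
  define T where "T x = {t. positive (complex_of_real t \<odot>\<^bsub>V\<^esub> ?e \<oplus>\<^bsub>V\<^esub> (\<ominus>\<^bsub>V\<^esub> x))}" for x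
  have ec [simp]: "?e \<in> carrier V" by (rule ounit_closed)
  \<comment> \<open>Here \<open>e \<noteq> 0\<close> enters: if a negative multiple of
    \<open>e\<close> were positive, both \<open>e\<close> and \<open>- e\<close> would be, against
    properness. Consequently \<open>p 0 = 0\<close>.\<close>
  have pos_real: "t \<ge> 0" if "positive (complex_of_real t \<odot>\<^bsub>V\<^esub> ?e)" for t
  proof (rule ccontr)
    assume t: "\<not> t \<ge> 0"
    have "positive (complex_of_real (- 1 / t) \<odot>\<^bsub>V\<^esub> (complex_of_real t \<odot>\<^bsub>V\<^esub> ?e))"
      using t that by (intro positive_scale[OF that]) (auto simp: field_simps)
    then have "positive (\<ominus>\<^bsub>V\<^esub> ?e)" using t by (simp add: neg_eq_smult)
    then show False using positive_proper[OF positive_ounit] e by simp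
  qed
  have Tadd: "s + t \<in> T (x \<oplus>\<^bsub>V\<^esub> y)" if "x \<in> hermitian" "y \<in> hermitian" "s \<in> T x" "t \<in> T y" for x y s t
  proof -
    have "(complex_of_real s \<odot>\<^bsub>V\<^esub> ?e \<oplus>\<^bsub>V\<^esub> (\<ominus>\<^bsub>V\<^esub> x)) \<oplus>\<^bsub>V\<^esub> (complex_of_real t \<odot>\<^bsub>V\<^esub> ?e \<oplus>\<^bsub>V\<^esub> (\<ominus>\<^bsub>V\<^esub> y)) =
      complex_of_real (s + t) \<odot>\<^bsub>V\<^esub> ?e \<oplus>\<^bsub>V\<^esub> (\<ominus>\<^bsub>V\<^esub> (x \<oplus>\<^bsub>V\<^esub> y))"
      using that by (simp add: smult_add_left minus_add a_ac)
    then show ?thesis using positive_add that unfolding T_def by force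
  qed
  have Tscale: "c * t \<in> T (complex_of_real c \<odot>\<^bsub>V\<^esub> x)" if "x \<in> hermitian" "c \<ge> 0" "t \<in> T x" for x c t
  proof -
    have "complex_of_real c \<odot>\<^bsub>V\<^esub> (complex_of_real t \<odot>\<^bsub>V\<^esub> ?e \<oplus>\<^bsub>V\<^esub> (\<ominus>\<^bsub>V\<^esub> x)) =
      complex_of_real (c * t) \<odot>\<^bsub>V\<^esub> ?e \<oplus>\<^bsub>V\<^esub> (\<ominus>\<^bsub>V\<^esub> (complex_of_real c \<odot>\<^bsub>V\<^esub> x))"
      using that by (simp add: smult_add_right neg_eq_smult mult_ac)
    then show ?thesis using positive_scale[OF _ that(2)] that(3) unfolding T_def by force
  qed
  have T0: "t \<in> T \<zero>\<^bsub>V\<^esub> \<longleftrightarrow> t \<ge> 0" for t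
    using pos_real[of t] positive_scale[OF positive_ounit, of t] by (auto simp: T_def neg_eq_smult)
  have xm: "\<zero>\<^bsub>V\<^esub> = x \<oplus>\<^bsub>V\<^esub> complex_of_real (- 1) \<odot>\<^bsub>V\<^esub> x" if "x \<in> hermitian" for x
    using smult_add_left[of x 1 "-1"] that by simp
  have ne: "\<exists>t. t \<in> T x" if "x \<in> hermitian" for x
    using positive_order_unit[OF that] by (auto simp: T_def)
  have bdd: "bdd_below (T x)" if x: "x \<in> hermitian" for x
  proof -
    obtain s where s: "s \<in> T (complex_of_real (- 1) \<odot>\<^bsub>V\<^esub> x)"
      using ne[OF hermitian_closed(2)[OF x, of "-1"]] by auto
    have "- s \<le> t" if "t \<in> T x" for t
      using Tadd[OF x hermitian_closed(2)[OF x, of "-1"] that s] xm[OF x] T0 by force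
    then show ?thesis by (rule bdd_belowI)
  qed
  define p where "p x = Inf (T x)" for x
  have p_le: "p x \<le> t" if "x \<in> hermitian" "t \<in> T x" for x t
    unfolding p_def using that bdd by (intro cInf_lower) auto
  have "sublinear p"
    unfolding p_def[abs_def]
  proof (rule sublinear_Inf)
    have "T \<zero>\<^bsub>V\<^esub> = {0..}" using T0 by auto
    then show "Inf (T \<zero>\<^bsub>V\<^esub>) = 0" by simp
  next
    show "\<exists>r\<in>T (x \<oplus>\<^bsub>V\<^esub> y). r \<le> s + t" if "x \<in> hermitian" "y \<in> hermitian" "s \<in> T x" "t \<in> T y" for x y s t
      using Tadd[OF that] by auto
    show "\<exists>r\<in>T (complex_of_real c \<odot>\<^bsub>V\<^esub> x). r \<le> c * t" if "x \<in> hermitian" "c > 0" "t \<in> T x" for x c t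
      using Tscale[OF that(1) _ that(3), of c] that(2) by (intro bexI[of _ "c * t"]) auto
  qed (use ne bdd in auto)
  \<comment> \<open>Prescribing the value at \<open>w = - x\<close> gives
    \<open>q x = - p w\<close>, so it remains to show \<open>p w > 0\<close>.\<close>
  define w where "w = complex_of_real (- 1) \<odot>\<^bsub>V\<^esub> x"
  have w: "w \<in> hermitian" unfolding w_def using x(1) by (rule hermitian_closed)
  obtain q where q: "\<And>x y. x \<in> hermitian \<Longrightarrow> y \<in> hermitian \<Longrightarrow> q (x \<oplus>\<^bsub>V\<^esub> y) = q x + q y"
      "\<And>x t. x \<in> hermitian \<Longrightarrow> q (complex_of_real t \<odot>\<^bsub>V\<^esub> x) = t * q x"
      "\<And>x. x \<in> hermitian \<Longrightarrow> q x \<le> p x" "q w = p w"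
    using Hahn_Banach_hermitian[OF \<open>sublinear p\<close> w] by blast
  have pos: "0 \<le> q y" if y: "positive y" for y
  proof -
    have h: "y \<in> hermitian" using y by (rule positive_hermitian)
    have "0 \<in> T (complex_of_real (- 1) \<odot>\<^bsub>V\<^esub> y)"
      using y h by (simp add: T_def neg_eq_smult)
    then have "q (complex_of_real (- 1) \<odot>\<^bsub>V\<^esub> y) \<le> 0"
      using q(3) p_le h hermitian_closed(2)[OF h, of "-1"] by (meson order_trans)
    then show ?thesis using q(2)[OF h, of "-1"] by simp
  qed
  have qe: "q ?e = 1"
  proof -
    have p0: "positive \<zero>\<^bsub>V\<^esub>" using positive_scale[OF positive_ounit, of 0] by simp
    have z: "?e \<oplus>\<^bsub>V\<^esub> (- 1) \<odot>\<^bsub>V\<^esub> ?e = \<zero>\<^bsub>V\<^esub>" "(- 1) \<odot>\<^bsub>V\<^esub> ?e \<oplus>\<^bsub>V\<^esub> ?e = \<zero>\<^bsub>V\<^esub>"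
      using smult_add_left[of ?e 1 "-1"] smult_add_left[of ?e "-1" 1] by simp_all
    have "1 \<in> T ?e" using p0 by (simp add: T_def neg_eq_smult z)
    then have "q ?e \<le> 1" using q(3)[OF ounit_hermitian] p_le[OF ounit_hermitian] by (meson order_trans)
    have m: "complex_of_real (- 1) \<odot>\<^bsub>V\<^esub> ?e \<in> hermitian" using ounit_hermitian by (rule hermitian_closed)
    have "- 1 \<in> T (complex_of_real (- 1) \<odot>\<^bsub>V\<^esub> ?e)"
      using p0 by (simp add: T_def neg_eq_smult z)
    then have "q (complex_of_real (- 1) \<odot>\<^bsub>V\<^esub> ?e) \<le> - 1" using q(3)[OF m] p_le[OF m] by (meson order_trans)
    then show ?thesis using q(2)[OF ounit_hermitian, of "-1"] \<open>q ?e \<le> 1\<close> by simp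
  qed
  \<comment> \<open>An \<open>r\<close> at which the Archimedean condition fails is a lower bound of
    \<open>T w\<close>: if some \<open>t < r\<close> were in \<open>T w\<close>, then
    \<open>r e + x\<close>, being the sum of \<open>(r - t) e\<close> and \<open>t e + x\<close>,
    would be positive.\<close>
  have "\<exists>r>0. \<not> positive (complex_of_real r \<odot>\<^bsub>V\<^esub> ?e \<oplus>\<^bsub>V\<^esub> x)"
    using positive_archimedean[of x] x by auto
  then obtain r where r: "r > 0" "\<not> positive (complex_of_real r \<odot>\<^bsub>V\<^esub> ?e \<oplus>\<^bsub>V\<^esub> x)" by blast
  have "r \<le> t" if "t \<in> T w" for t
  proof (rule ccontr)
    assume "\<not> r \<le> t"
    have "positive (complex_of_real t \<odot>\<^bsub>V\<^esub> ?e \<oplus>\<^bsub>V\<^esub> x)"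
      using that x(1) by (simp add: T_def w_def neg_eq_smult)
    moreover have "positive (complex_of_real (r - t) \<odot>\<^bsub>V\<^esub> ?e)"
      using \<open>\<not> r \<le> t\<close> by (intro positive_scale positive_ounit) auto
    ultimately have "positive (complex_of_real (r - t) \<odot>\<^bsub>V\<^esub> ?e \<oplus>\<^bsub>V\<^esub> (complex_of_real t \<odot>\<^bsub>V\<^esub> ?e \<oplus>\<^bsub>V\<^esub> x))"
      using positive_add by blast
    then show False
      using r(2) x(1) by (simp add: a_assoc[symmetric] smult_add_left[symmetric])
  qed
  then have "r \<le> p w"
    unfolding p_def using ne[OF w] by (intro cInf_greatest) auto
  then have "q x \<noteq> 0"
    using r(1) q(4) q(2)[OF x(1), of "-1"] by (simp add: w_def)
  with q(1,2) pos qe show ?thesis by blast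
qed

end

text \<open>Positive functionals are completely positive: the quadratic form of the image of
  \<open>A\<close> at \<open>v\<close> is the value of \<open>f\<close> at the compression of
  \<open>A\<close> by the row \<open>v\<close>, which is a positive element.\<close>

lemma ucp_complexI:
  assumes V: "operator_system V" and lin: "linear_map V complex_sys f"
    and pos: "\<And>x. operator_system.positive V x \<Longrightarrow> 0 \<le> f x" and unital: "f (ounit V) = 1"
  shows "ucp V complex_sys f"
proof (rule ucpI[OF lin])
  interpret V: operator_system V by fact
  have lin': "linear_map V complex_star f" using lin by (simp add: linear_map_def)
  interpret f: star_linear_map V complex_star f by unfold_locales (fact lin')
  fix n :: nat and A assume n: "n > 0" and A: "A \<in> mpos V n"
  note Am = V.mpos_mats[OF n A]
  have "0 \<le> qform n v (map_mat f A)" for v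
  proof -
    define \<alpha> where "\<alpha> = mat 1 n (\<lambda>(i, k). v k)"
    have \<alpha>: "\<alpha> \<in> carrier_mat 1 n" by (simp add: \<alpha>_def)
    have pos1: "V.positive (mat_conj V \<alpha> A $$ (0, 0))"
      using V.mpos_conj[OF _ n \<alpha> A] by (intro V.positive_entry) simp
    have "f (mat_conj V \<alpha> A $$ (0, 0)) = map_mat f (mat_conj V \<alpha> A) $$ (0, 0)"
      using f.map_mat_index[OF _ _ V.mat_conj_mats[OF \<alpha> Am], of 0 0] by simp
    also have "\<dots> = qform n v (map_mat f A)"
      unfolding f.map_mat_conj[OF \<alpha> Am] using Am
      by (simp add: complex_star.mat_conj_index'[OF \<alpha>] qform_def) (simp add: \<alpha>_def)
    finally show ?thesis using pos[OF pos1] by simp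
  qed
  then show "map_mat f A \<in> mpos complex_sys n"
    using f.map_mat_mats[OF Am] by (simp add: mpos_complex_sys[OF n] psd_def)
qed (simp add: unital)

lemma ucp_complex_qform_nonneg:
  assumes "ucp V complex_sys f" "n > 0" "A \<in> mpos V n"
  shows "0 \<le> qform n v (map_mat f A)"
  using ucpD(2)[OF assms] by (simp add: mpos_complex_sys[OF assms(2)] psd_def)

lemma ucp_complex_positive:
  assumes V: "operator_system V" and f: "ucp V complex_sys f" and x: "operator_system.positive V x"
  shows "0 \<le> f x"
  using ucp_complex_qform_nonneg[OF f, of 1 "mat 1 1 (\<lambda>_. x)" "\<lambda>_. 1"] x
  by (simp add: operator_system.positive_def[OF V] qform_def)

text \<open>If the real and imaginary parts of \<open>z\<close> and their negatives were all
  positive, both parts would vanish by properness. So one of the four is not positive, and a real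
  functional that does not vanish on it is extended complex linearly.\<close>

theorem states_separate:
  assumes V: "operator_system V" and z: "z \<in> carrier V" "z \<noteq> \<zero>\<^bsub>V\<^esub>"
  shows "\<exists>f. ucp V complex_sys f \<and> f z \<noteq> 0"
proof -
  interpret V: operator_system V by fact
  let ?re = V.re_part and ?im = V.im_part
  have ic [simp]: "invol V x \<in> carrier V" if "x \<in> carrier V" for x using that by (rule V.invol_closed)
  note herm = V.re_im_hermitian and decomp = V.re_im_decomposition
  \<comment> \<open>With \<open>e = 0\<close> the order unit property makes every hermitian element
    positive, which leaves only the zero space.\<close>
  have e: "ounit V \<noteq> \<zero>\<^bsub>V\<^esub>"
  proof
    assume e: "ounit V = \<zero>\<^bsub>V\<^esub>"
    have "x = \<zero>\<^bsub>V\<^esub>" if x: "x \<in> V.hermitian" for x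
    proof (rule V.positive_proper)
      have m: "(- 1) \<odot>\<^bsub>V\<^esub> x \<in> V.hermitian" using V.hermitian_closed(2)[OF x, of "-1"] by simp
      show "V.positive x" using V.positive_order_unit[OF m] x by (auto simp: e V.neg_eq_smult)
      show "V.positive (\<ominus>\<^bsub>V\<^esub> x)" using V.positive_order_unit[OF x] x by (auto simp: e V.neg_eq_smult)
    qed
    then have "?re z = \<zero>\<^bsub>V\<^esub>" "?im z = \<zero>\<^bsub>V\<^esub>" using herm[OF z(1)] by blast+
    then show False using decomp[OF z(1)] z(2) by simp
  qed
  have "\<exists>x. x \<in> V.hermitian \<and> \<not> V.positive x \<and> (x = ?re z \<or> x = ?im z \<or> x = \<ominus>\<^bsub>V\<^esub> ?re z \<or> x = \<ominus>\<^bsub>V\<^esub> ?im z)"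
  proof (rule ccontr)
    have m: "\<ominus>\<^bsub>V\<^esub> x \<in> V.hermitian" if "x \<in> V.hermitian" for x
      using V.hermitian_closed(2)[OF that, of "-1"] that by (simp add: V.neg_eq_smult)
    assume "\<not> ?thesis"
    then have "?re z = \<zero>\<^bsub>V\<^esub>" "?im z = \<zero>\<^bsub>V\<^esub>"
      using herm[OF z(1)] m by (auto intro!: V.positive_proper)
    then show False using decomp[OF z(1)] z(2) by simp
  qed
  then obtain x where x: "x \<in> V.hermitian" "\<not> V.positive x"
    "x = ?re z \<or> x = ?im z \<or> x = \<ominus>\<^bsub>V\<^esub> ?re z \<or> x = \<ominus>\<^bsub>V\<^esub> ?im z" by blast
  obtain q where q: "\<forall>x\<in>V.hermitian. \<forall>y\<in>V.hermitian. q (x \<oplus>\<^bsub>V\<^esub> y) = q x + q y"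
    "\<forall>x\<in>V.hermitian. \<forall>t. q (complex_of_real t \<odot>\<^bsub>V\<^esub> x) = t * q x"
    "\<forall>x. V.positive x \<longrightarrow> 0 \<le> q x" "q (ounit V) = (1::real)" "q x \<noteq> 0"
    using V.exists_real_state_negative[OF x(1,2) e] by (elim exE conjE)
  note qadd = q(1)[rule_format] and qscale = q(2)[rule_format]
  have qneg: "q (\<ominus>\<^bsub>V\<^esub> u) = - q u" if "u \<in> V.hermitian" for u
    using qscale[OF that, of "-1"] that by (simp add: V.neg_eq_smult)
  \<comment> \<open>The complex linear extension of \<open>q\<close>, which is controlled only on
    the hermitian part.\<close>
  define f where "f x = Complex (q (?re x)) (q (?im x))" for x
  have re_add: "?re (x \<oplus>\<^bsub>V\<^esub> y) = ?re x \<oplus>\<^bsub>V\<^esub> ?re y" "?im (x \<oplus>\<^bsub>V\<^esub> y) = ?im x \<oplus>\<^bsub>V\<^esub> ?im y"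
    if "x \<in> carrier V" "y \<in> carrier V" for x y
    using that by (simp_all add: V.re_part_def V.im_part_def V.invol_add V.smult_add_right V.a_ac)
  have re_smult: "?re (complex_of_real t \<odot>\<^bsub>V\<^esub> x) = complex_of_real t \<odot>\<^bsub>V\<^esub> ?re x"
    "?im (complex_of_real t \<odot>\<^bsub>V\<^esub> x) = complex_of_real t \<odot>\<^bsub>V\<^esub> ?im x"
    "?re (\<i> \<odot>\<^bsub>V\<^esub> x) = complex_of_real (- 1) \<odot>\<^bsub>V\<^esub> ?im x" "?im (\<i> \<odot>\<^bsub>V\<^esub> x) = ?re x"
    if "x \<in> carrier V" for x t
    using that by (simp_all add: V.re_part_def V.im_part_def V.invol_smult V.smult_add_right mult_ac)
  have f_add: "f (x \<oplus>\<^bsub>V\<^esub> y) = f x + f y" if "x \<in> carrier V" "y \<in> carrier V" for x y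
    using that herm by (simp add: f_def re_add qadd complex_eq_iff)
  have f_real: "f (complex_of_real t \<odot>\<^bsub>V\<^esub> x) = complex_of_real t * f x" if "x \<in> carrier V" for x t
    using that herm by (simp add: f_def re_smult qscale complex_eq_iff)
  have f_i: "f (\<i> \<odot>\<^bsub>V\<^esub> x) = \<i> * f x" if "x \<in> carrier V" for x
    using that herm qscale[OF herm(2)[OF that], of "-1"] by (simp add: f_def re_smult complex_eq_iff)
  have f_smult: "f (c \<odot>\<^bsub>V\<^esub> x) = c * f x" if x: "x \<in> carrier V" for c x
  proof -
    have "c \<odot>\<^bsub>V\<^esub> x = complex_of_real (Re c) \<odot>\<^bsub>V\<^esub> x \<oplus>\<^bsub>V\<^esub> \<i> \<odot>\<^bsub>V\<^esub> (complex_of_real (Im c) \<odot>\<^bsub>V\<^esub> x)"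
      using x by (simp add: V.smult_add_left[symmetric] complex_eq[symmetric])
    then have "f (c \<odot>\<^bsub>V\<^esub> x) = complex_of_real (Re c) * f x + \<i> * (complex_of_real (Im c) * f x)"
      using x by (simp only: f_add f_real f_i V.smult_closed)
    also have "\<dots> = (complex_of_real (Re c) + \<i> * complex_of_real (Im c)) * f x"
      by (simp add: algebra_simps)
    finally show ?thesis by (simp add: complex_eq[symmetric])
  qed
  have re_herm: "?re x = x" "?im x = \<zero>\<^bsub>V\<^esub>" if x: "x \<in> V.hermitian" for x
    using x V.smult_add_left[of x "1/2" "1/2"] V.smult_add_left[of x "- (\<i>/2)" "\<i>/2"]
    by (simp_all add: V.re_part_def V.im_part_def V.hermitian_invol V.smult_add_right)
  have q0: "q \<zero>\<^bsub>V\<^esub> = 0" using qscale[OF x(1), of 0] x(1) by simp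
  have "ucp V complex_sys f"
  proof (rule ucp_complexI[OF V])
    show "linear_map V complex_sys f"
      by (rule linear_mapI) (simp_all add: f_add f_smult)
    show "0 \<le> f x" if "V.positive x" for x
      using that q(3) q0 re_herm[OF V.positive_hermitian[OF that]] by (simp add: f_def less_eq_complex_def)
    show "f (ounit V) = 1"
      using q(4) q0 re_herm[OF V.ounit_hermitian] by (simp add: f_def complex_eq_iff)
  qed
  moreover have "f z \<noteq> 0"
    using x(3) q(5) herm[OF z(1)] qneg by (auto simp: f_def complex_eq_iff)
  ultimately show ?thesis by blast
qed

text \<open>Embeds the complex numbers into the carrier, so that universality can be applied to
  complex valued functionals.\<close>

lemma (in operator_system) inj_smult_ounit:
  assumes e: "ounit V \<noteq> \<zero>\<^bsub>V\<^esub>"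
  shows "inj (\<lambda>c. c \<odot>\<^bsub>V\<^esub> ounit V)"
proof (rule injI)
  fix c d assume eq: "c \<odot>\<^bsub>V\<^esub> ounit V = d \<odot>\<^bsub>V\<^esub> ounit V"
  have "(c - d) \<odot>\<^bsub>V\<^esub> ounit V = c \<odot>\<^bsub>V\<^esub> ounit V \<oplus>\<^bsub>V\<^esub> (- d) \<odot>\<^bsub>V\<^esub> ounit V"
    using smult_add_left[OF ounit_closed, of c "- d"] by simp
  also have "\<dots> = (d + (- d)) \<odot>\<^bsub>V\<^esub> ounit V"
    unfolding eq by (rule smult_add_left[OF ounit_closed, symmetric])
  finally have z: "(c - d) \<odot>\<^bsub>V\<^esub> ounit V = \<zero>\<^bsub>V\<^esub>" using ounit_closed by simp
  show "c = d"
  proof (rule ccontr)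
    assume "c \<noteq> d"
    then have "ounit V = (1 / (c - d)) \<odot>\<^bsub>V\<^esub> ((c - d) \<odot>\<^bsub>V\<^esub> ounit V)"
      using ounit_closed by simp
    then show False using e by (simp add: z)
  qed
qed

section \<open>Inductive limits\<close>

lemma compatible_mapsD:
  assumes "compatible_maps S \<phi> R \<rho>"
  shows "ucp (S k) R (\<rho> k)" "x \<in> carrier (S k) \<Longrightarrow> \<rho> (Suc k) (\<phi> k x) = \<rho> k x"
  using assms by (auto simp: compatible_maps_def)

lemma compatible_maps_comp:
  assumes "compatible_maps S \<phi> L \<psi>" "ucp L R h"
  shows "compatible_maps S \<phi> R (\<lambda>k. h \<circ> \<psi> k)"
  using assms by (auto simp: compatible_maps_def intro: ucp_comp)

text \<open>Frees the universal property from the fixed type: the target is transported along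
  \<open>j\<close>, and the map obtained there is composed with the inverse of
  \<open>j\<close>.\<close>

lemma inductive_limit_lift:
  fixes S :: "nat \<Rightarrow> 'a op_sys" and R :: "'r op_sys" and j :: "'r \<Rightarrow> nat \<times> 'a"
  assumes "inductive_limit S \<phi> L \<psi>" "operator_system R" "compatible_maps S \<phi> R \<rho>" "inj_on j (carrier R)"
  shows "\<exists>h. ucp L R h \<and> (\<forall>k. \<forall>x\<in>carrier (S k). h (\<psi> k x) = \<rho> k x)"
proof -
  let ?k = "inv_into (carrier R) j"
  have "operator_system (transport j R)" "compatible_maps S \<phi> (transport j R) (\<lambda>k. j \<circ> \<rho> k)"
    using operator_system_transport[OF assms(2,4)] compatible_maps_comp[OF assms(3) ucp_transport[OF assms(2,4)]]
    by auto
  then obtain h where h: "ucp L (transport j R) h" "\<forall>k. \<forall>x\<in>carrier (S k). h (\<psi> k x) = (j \<circ> \<rho> k) x"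
    using assms(1) unfolding inductive_limit_def by blast
  show ?thesis
  proof (intro exI[of _ "?k \<circ> h"] conjI allI ballI)
    show "ucp L R (?k \<circ> h)" using h(1) ucp_transport_inv[OF assms(2,4)] by (rule ucp_comp)
    fix k x assume x: "x \<in> carrier (S k)"
    then have "\<rho> k x \<in> carrier R"
      using compatible_mapsD(1)[OF assms(3), of k] by (auto dest: ucpD(1) linear_mapD(1))
    then show "(?k \<circ> h) (\<psi> k x) = \<rho> k x" using h(2) x inv_into_f_f[OF assms(4)] by simp
  qed
qed

text \<open>The uniqueness half for the same targets; composing with the injective \<open>j\<close>
  loses nothing.\<close>

lemma inductive_limit_unique:
  fixes S :: "nat \<Rightarrow> 'a op_sys" and R :: "'r op_sys" and j :: "'r \<Rightarrow> nat \<times> 'a"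
  assumes "inductive_limit S \<phi> L \<psi>" "operator_system R" "inj_on j (carrier R)"
    and h: "ucp L R h" "ucp L R h'" "\<And>k x. x \<in> carrier (S k) \<Longrightarrow> h (\<psi> k x) = h' (\<psi> k x)"
    and z: "z \<in> carrier L"
  shows "h z = h' z"
proof -
  note T = ucp_transport[OF assms(2,3)]
  have "compatible_maps S \<phi> L \<psi>" using assms(1) by (simp add: inductive_limit_def)
  then have "compatible_maps S \<phi> (transport j R) (\<lambda>k. (j \<circ> h) \<circ> \<psi> k)"
    by (rule compatible_maps_comp[OF _ ucp_comp[OF h(1) T]])
  then have "\<forall>g g'. ucp L (transport j R) g \<and> (\<forall>k. \<forall>x\<in>carrier (S k). g (\<psi> k x) = ((j \<circ> h) \<circ> \<psi> k) x) \<and>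
      ucp L (transport j R) g' \<and> (\<forall>k. \<forall>x\<in>carrier (S k). g' (\<psi> k x) = ((j \<circ> h) \<circ> \<psi> k) x) \<longrightarrow>
      (\<forall>z\<in>carrier L. g z = g' z)"
    using assms(1) operator_system_transport[OF assms(2,3)] unfolding inductive_limit_def by blast
  from this[rule_format, of "j \<circ> h" "j \<circ> h'" z] have "j (h z) = j (h' z)"
    using ucp_comp[OF h(1) T] ucp_comp[OF h(2) T] h(3) z by simp
  moreover have "h z \<in> carrier R" "h' z \<in> carrier R"
    using z ucpD(1)[OF h(1)] ucpD(1)[OF h(2)] by (auto dest: linear_mapD(1))
  ultimately show ?thesis using assms(3) by (auto dest: inj_onD)
qed

section \<open>Norm blocks and adjoints under unital completely positive maps\<close>

lemma (in operator_system) norm_block_mpos: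
  assumes x: "x \<in> carrier V"
  shows "\<exists>r>0. norm_block V (ounit V) r x \<in> mpos V 2"
proof -
  have ec [simp]: "ounit V \<in> carrier V" by (rule ounit_closed)
  have ix: "invol V x \<in> carrier V" using x by (rule invol_closed)
  \<comment> \<open>The minus signs compensate for the negation in
    \<open>matrix_order_unit\<close>.\<close>
  define A where "A = mat 2 2 (\<lambda>(i, j). if i = j then \<zero>\<^bsub>V\<^esub> else if i = 0 then \<ominus>\<^bsub>V\<^esub> x else \<ominus>\<^bsub>V\<^esub> invol V x)"
  have A: "A \<in> herm_mats V 2"
  proof (rule herm_matsI)
    show "A \<in> mats V 2" unfolding A_def by (rule mat_mem_mats) (use x ix in auto)
    show "invol V (A $$ (j, i)) = A $$ (i, j)" if "i < 2" "j < 2" for i j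
      using that x ix by (auto simp: A_def neg_eq_smult invol_smult invol_invol)
  qed
  then obtain r where r: "r > 0"
    "mat_add V (scalar_mat V 2 r (ounit V)) (mat_neg V A) \<in> mpos V 2"
    using matrix_order_unit[of 2 A] by auto
  have "mat_add V (scalar_mat V 2 r (ounit V)) (mat_neg V A) =
    norm_block V (ounit V) r x"
    using x ix by (intro eq_matI)
      (auto simp: A_def norm_block_def mat_add_def mat_neg_def mat_scale_def mat_diag_const_def neg_eq_smult)
  then show ?thesis using r by auto
qed

lemma ucp_norm_block:
  assumes "operator_system V" "star_vector_space W" "linear_map V W f" "f (ounit V) = e" "x \<in> carrier V"
    and "f (invol V x) = invol W (f x)"
  shows "map_mat f (norm_block V (ounit V) r x) = norm_block W e r (f x)"
proof -
  interpret V: operator_system V by fact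
  show ?thesis
    using assms V.ounit_closed by (intro eq_matI) (auto simp: norm_block_def linear_mapD(3)[OF assms(3)])
qed

text \<open>Preservation of adjoints is not part of \<open>linear_map\<close>; it follows from
  positivity at level 2. The image of a positive norm block is hermitian, and its off-diagonal
  entries are the images of \<open>x\<close> and of its adjoint.\<close>

lemma ucp_invol:
  assumes "operator_system V" "operator_system W" and f: "ucp V W f" and x: "x \<in> carrier V"
  shows "f (invol V x) = invol W (f x)"
proof -
  interpret V: operator_system V by fact
  interpret W: operator_system W by fact
  obtain r where r: "norm_block V (ounit V) r x \<in> mpos V 2"
    using V.norm_block_mpos[OF x] by auto
  have "map_mat f (norm_block V (ounit V) r x) \<in> herm_mats W 2"
    using ucpD(2)[OF f _ r] W.mpos_herm[of 2] by auto
  from W.herm_mats_index[OF this, of 1 0] show ?thesis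
    by (simp add: norm_block_def)
qed

lemma ucp_star_linear_map:
  assumes "operator_system V" "operator_system W" "ucp V W f"
  shows "star_linear_map V W f"
proof -
  interpret V: operator_system V by fact
  interpret W: operator_system W by fact
  show ?thesis by unfold_locales (rule ucpD(1)[OF assms(3)])
qed

text \<open>\<open>L\<close> itself may lie outside the universe, so uniqueness is applied to
  \<open>f \<circ> u\<close> and \<open>f\<close> for states \<open>f\<close>; these separate
  points. The injection of the complex numbers is requested only in the presence of a state, since
  for zero systems the type \<open>'a\<close> may be too small.\<close>

lemma inductive_limit_endo_identity:
  fixes S :: "nat \<Rightarrow> 'a op_sys" and L :: "'l op_sys"
  assumes lim: "inductive_limit S \<phi> L \<psi>"
    and u: "ucp L L u" "\<And>k x. x \<in> carrier (S k) \<Longrightarrow> u (\<psi> k x) = \<psi> k x"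
    and inj: "\<And>f. ucp L complex_sys f \<Longrightarrow> \<exists>j :: complex \<Rightarrow> nat \<times> 'a. inj j"
    and z: "z \<in> carrier L"
  shows "u z = z"
proof (rule ccontr)
  have L: "operator_system L" using lim by (simp add: inductive_limit_def)
  interpret L: operator_system L by (rule L)
  assume neq: "u z \<noteq> z"
  have uz: "u z \<in> carrier L" using linear_mapD(1)[OF ucpD(1)[OF u(1)] z] .
  have "u z \<oplus>\<^bsub>L\<^esub> (\<ominus>\<^bsub>L\<^esub> z) \<noteq> \<zero>\<^bsub>L\<^esub>"
    using neq uz z by (metis L.minus_equality L.minus_minus L.a_inv_closed)
  then obtain f where f: "ucp L complex_sys f" "f (u z \<oplus>\<^bsub>L\<^esub> (\<ominus>\<^bsub>L\<^esub> z)) \<noteq> 0"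
    using states_separate[OF L, of "u z \<oplus>\<^bsub>L\<^esub> (\<ominus>\<^bsub>L\<^esub> z)"] uz z by auto
  interpret f: star_linear_map L complex_sys f
    by (rule ucp_star_linear_map[OF L operator_system_complex f(1)])
  obtain j :: "complex \<Rightarrow> nat \<times> 'a" where j: "inj_on j (carrier complex_sys)"
    using inj[OF f(1)] by auto
  have "(f \<circ> u) z = f z"
    using inductive_limit_unique[OF lim operator_system_complex j ucp_comp[OF u(1) f(1)] f(1) _ z] u(2) by simp
  then show False using f(2) uz z by (simp add: f.map_add f.map_neg f.W.neg_eq_smult)
qed

section \<open>The union of the images in a cocone\<close>

locale op_sys_cocone =
  fixes S :: "nat \<Rightarrow> 'a op_sys" and \<phi> :: "nat \<Rightarrow> 'a \<Rightarrow> 'a" and L :: "'l op_sys" and \<psi> :: "nat \<Rightarrow> 'a \<Rightarrow> 'l"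
  assumes system: "inductive_system S \<phi>" and L: "operator_system L" and compatible: "compatible_maps S \<phi> L \<psi>"
begin

sublocale L: operator_system L by (rule L)

lemma S: "operator_system (S k)"
  using system by (simp add: inductive_system_def)

lemma \<psi>: "ucp (S k) L (\<psi> k)"
  using compatible_mapsD(1)[OF compatible] .

lemma \<psi>_carrier [simp]: "x \<in> carrier (S k) \<Longrightarrow> \<psi> k x \<in> carrier L"
  using ucpD(1)[OF \<psi>] by (rule linear_mapD)

lemma \<psi>_map: "star_linear_map (S k) L (\<psi> k)"
  by (rule ucp_star_linear_map[OF S L \<psi>])

lemma image_carrier_mono: "k \<le> m \<Longrightarrow> \<psi> k ` carrier (S k) \<subseteq> \<psi> m ` carrier (S m)"
proof (rule lift_Suc_mono_le[of "\<lambda>k. \<psi> k ` carrier (S k)"])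
  fix k
  have "ucp (S k) (S (Suc k)) (\<phi> k)" using system by (simp add: inductive_system_def)
  then have "\<phi> k x \<in> carrier (S (Suc k))" if "x \<in> carrier (S k)" for x
    using that by (auto dest: ucpD(1) linear_mapD(1))
  then show "\<psi> k ` carrier (S k) \<subseteq> \<psi> (Suc k) ` carrier (S (Suc k))"
    using compatible_mapsD(2)[OF compatible] by (metis image_eqI image_subsetI)
qed

lemma image_mpos_mono:
  assumes n: "n > 0"
  shows "k \<le> m \<Longrightarrow> map_mat (\<psi> k) ` mpos (S k) n \<subseteq> map_mat (\<psi> m) ` mpos (S m) n"
proof (rule lift_Suc_mono_le[of "\<lambda>k. map_mat (\<psi> k) ` mpos (S k) n"])
  fix k
  interpret Sk: operator_system "S k" by (rule S)
  have \<phi>: "ucp (S k) (S (Suc k)) (\<phi> k)" using system by (simp add: inductive_system_def)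
  show "map_mat (\<psi> k) ` mpos (S k) n \<subseteq> map_mat (\<psi> (Suc k)) ` mpos (S (Suc k)) n"
  proof (rule image_subsetI)
    fix A assume A: "A \<in> mpos (S k) n"
    have "map_mat (\<psi> k) A = map_mat (\<psi> (Suc k)) (map_mat (\<phi> k) A)"
      using Sk.mpos_mats[OF n A] compatible_mapsD(2)[OF compatible, of _ k]
      by (intro eq_matI) (auto simp: Sk.mats_closed)
    then show "map_mat (\<psi> k) A \<in> map_mat (\<psi> (Suc k)) ` mpos (S (Suc k)) n"
      using ucpD(2)[OF \<phi> n A] by auto
  qed
qed

definition limit_carrier :: "'l set" where
  "limit_carrier = (\<Union>k. \<psi> k ` carrier (S k))"

definition limit_cone :: "nat \<Rightarrow> 'l mat set" where
  "limit_cone n = (\<Union>k. map_mat (\<psi> k) ` mpos (S k) n)"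

text \<open>The Archimedeanization of \<open>limit_space\<close> with the cones \<open>limit_cone\<close> turns out to be \<open>L\<close> itself if \<open>L\<close>
  is an inductive limit.\<close>

definition limit_space :: "'l star_space" where
  "limit_space = \<lparr>carrier = limit_carrier, monoid.mult = undefined, one = undefined, zero = \<zero>\<^bsub>L\<^esub>,
     add = add L, smult = smult L, invol = invol L\<rparr>"

lemma limit_space_simps [simp]:
  "carrier limit_space = limit_carrier" "\<zero>\<^bsub>limit_space\<^esub> = \<zero>\<^bsub>L\<^esub>" "add limit_space = add L"
  "smult limit_space = smult L" "invol limit_space = invol L"
  "mat_add limit_space = mat_add L" "mat_scale limit_space = mat_scale L"
  "mat_diag_const limit_space = mat_diag_const L"
  by (simp_all add: limit_space_def fun_eq_iff mat_add_def mat_scale_def mat_diag_const_def cong: if_cong)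

lemma limit_carrier_L: "x \<in> limit_carrier \<Longrightarrow> x \<in> carrier L"
  by (auto simp: limit_carrier_def)

lemma limit_carrierI: "x \<in> carrier (S k) \<Longrightarrow> \<psi> k x \<in> limit_carrier"
  by (auto simp: limit_carrier_def)

lemma limit_carrierE:
  assumes "x \<in> limit_carrier"
  obtains k a where "a \<in> carrier (S k)" "x = \<psi> k a"
  using assms by (auto simp: limit_carrier_def)

text \<open>A chosen representative \<open>(k, a)\<close> determines the element as
  \<open>\<psi> k a\<close>. This puts the union of the images into the universe although
  \<open>'l\<close> is arbitrary.\<close>

lemma limit_carrier_inj: "\<exists>j :: 'l \<Rightarrow> nat \<times> 'a. inj_on j limit_carrier"
proof (intro exI inj_onI)
  let ?P = "\<lambda>z p. snd p \<in> carrier (S (fst p)) \<and> \<psi> (fst p) (snd p) = z"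
  fix x y assume x: "x \<in> limit_carrier" and y: "y \<in> limit_carrier" and eq: "(SOME p. ?P x p) = (SOME p. ?P y p)"
  have ex: "\<exists>p. ?P z p" if "z \<in> limit_carrier" for z
    using that by (auto simp: limit_carrier_def)
  show "x = y" using someI_ex[OF ex[OF x]] someI_ex[OF ex[OF y]] eq by metis
qed

lemma limit_carrier_common:
  assumes "x \<in> limit_carrier" "y \<in> limit_carrier"
  obtains k a b where "a \<in> carrier (S k)" "b \<in> carrier (S k)" "x = \<psi> k a" "y = \<psi> k b"
proof -
  obtain k l where "x \<in> \<psi> k ` carrier (S k)" "y \<in> \<psi> l ` carrier (S l)"
    using assms by (auto simp: limit_carrier_def)
  then have "x \<in> \<psi> (max k l) ` carrier (S (max k l))" "y \<in> \<psi> (max k l) ` carrier (S (max k l))"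
    using image_carrier_mono[of k "max k l"] image_carrier_mono[of l "max k l"] by auto
  then show ?thesis using that by auto
qed

lemma limit_coneI: "A \<in> mpos (S k) n \<Longrightarrow> map_mat (\<psi> k) A \<in> limit_cone n"
  by (auto simp: limit_cone_def)

lemma limit_coneE:
  assumes "A \<in> limit_cone n"
  obtains k C where "C \<in> mpos (S k) n" "A = map_mat (\<psi> k) C"
  using assms by (auto simp: limit_cone_def)

lemma limit_cone_common:
  assumes n: "n > 0" and "A \<in> limit_cone n" "B \<in> limit_cone n"
  obtains k C D where "C \<in> mpos (S k) n" "D \<in> mpos (S k) n" "A = map_mat (\<psi> k) C" "B = map_mat (\<psi> k) D"
proof -
  obtain k l where "A \<in> map_mat (\<psi> k) ` mpos (S k) n" "B \<in> map_mat (\<psi> l) ` mpos (S l) n"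
    using assms by (auto simp: limit_cone_def)
  then have "A \<in> map_mat (\<psi> (max k l)) ` mpos (S (max k l)) n" "B \<in> map_mat (\<psi> (max k l)) ` mpos (S (max k l)) n"
    using image_mpos_mono[OF n, of k "max k l"] image_mpos_mono[OF n, of l "max k l"] by auto
  then show ?thesis using that by auto
qed

lemma limit_cone_L: "n > 0 \<Longrightarrow> A \<in> limit_cone n \<Longrightarrow> A \<in> mpos L n"
  by (auto simp: limit_cone_def intro: ucpD(2)[OF \<psi>])

lemma mats_limit_space_L: "A \<in> mats limit_space n \<Longrightarrow> A \<in> mats L n"
  unfolding mats_def using limit_carrier_L by simp

lemma limit_carrier_closed:
  assumes "x \<in> limit_carrier"
  shows "y \<in> limit_carrier \<Longrightarrow> x \<oplus>\<^bsub>L\<^esub> y \<in> limit_carrier"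
    and "c \<odot>\<^bsub>L\<^esub> x \<in> limit_carrier"
    and "invol L x \<in> limit_carrier"
    and "\<zero>\<^bsub>L\<^esub> \<in> limit_carrier"
proof -
  obtain k a where a: "a \<in> carrier (S k)" "x = \<psi> k a" using assms by (rule limit_carrierE)
  interpret Sk: operator_system "S k" by (rule S)
  show c: "c \<odot>\<^bsub>L\<^esub> x \<in> limit_carrier" for c
    using limit_carrierI[OF Sk.smult_closed[OF a(1)], of c] linear_mapD(3)[OF ucpD(1)[OF \<psi>] a(1), of c] a(2) by simp
  show "invol L x \<in> limit_carrier"
    using limit_carrierI[OF Sk.invol_closed[OF a(1)]] ucp_invol[OF S L \<psi> a(1)] a(2) by simp
  show "\<zero>\<^bsub>L\<^esub> \<in> limit_carrier" using c[of 0] limit_carrier_L[OF assms] by simp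
next
  assume "y \<in> limit_carrier"
  then obtain k a b where ab: "a \<in> carrier (S k)" "b \<in> carrier (S k)" "x = \<psi> k a" "y = \<psi> k b"
    using limit_carrier_common[OF assms] by metis
  interpret Sk: operator_system "S k" by (rule S)
  show "x \<oplus>\<^bsub>L\<^esub> y \<in> limit_carrier"
    using limit_carrierI[OF Sk.a_closed[OF ab(1,2)]] linear_mapD(2)[OF ucpD(1)[OF \<psi>] ab(1,2)] ab(3,4) by simp
qed

lemma star_vector_space_limit: "star_vector_space limit_space"
proof (rule star_vector_spaceI)
  have "\<psi> 0 (ounit (S 0)) \<in> limit_carrier"
    using operator_system.ounit_closed[OF S] by (rule limit_carrierI)
  then show "\<zero>\<^bsub>limit_space\<^esub> \<in> carrier limit_space"
    using limit_carrier_closed(4) by simp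
qed (auto simp: limit_carrier_closed limit_carrier_L L.a_ac L.smult_add_left L.smult_add_right
    L.invol_invol L.invol_add L.invol_smult)

text \<open>Norm blocks are inherited from the levels, where they are positive. Properness is
  inherited from \<open>L\<close>: the closure of \<open>limit_cone\<close> lies in the cones of
  \<open>L\<close>, which are closed and proper.\<close>

lemma archimedeanizable_limit: "archimedeanizable limit_space (ounit L) limit_cone"
proof -
  interpret U: star_vector_space limit_space by (rule star_vector_space_limit)
  have lin: "linear_map (S k) limit_space (\<psi> k)" for k
    using ucpD(1)[OF \<psi>[of k]] limit_carrierI by (intro linear_mapI) (simp_all add: linear_mapD)
  have star: "star_linear_map (S k) limit_space (\<psi> k)" for k
  proof -
    interpret Sk: operator_system "S k" by (rule S)
    show ?thesis by unfold_locales (rule lin)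
  qed
  have e: "ounit L \<in> limit_carrier"
    using limit_carrierI[OF operator_system.ounit_closed[OF S], of 0] ucpD(3)[OF \<psi>, of 0] by simp
  have cone_mats: "A \<in> mats limit_space n" if A: "A \<in> limit_cone n" and "n > 0" for A n
  proof -
    obtain k C where C: "C \<in> mpos (S k) n" "A = map_mat (\<psi> k) C" using A by (rule limit_coneE)
    interpret Sk: operator_system "S k" by (rule S)
    show ?thesis using star_linear_map.map_mat_mats[OF star Sk.mpos_mats[OF that(2) C(1)]] C(2) by simp
  qed
  show ?thesis
  proof
    show "ounit L \<in> carrier limit_space" using e by simp
    show "invol limit_space (ounit L) = ounit L" by (simp add: L.ounit_herm)
  next
    fix n :: nat assume n: "n > 0"
    show "limit_cone n \<subseteq> herm_mats limit_space n"
    proof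
      fix A assume A: "A \<in> limit_cone n"
      then have "A \<in> herm_mats L n" using limit_cone_L[OF n] L.mpos_herm[OF n] by auto
      then show "A \<in> herm_mats limit_space n"
        using cone_mats[OF A n] L.herm_mats_index[of A n] by (intro U.herm_matsI) auto
    qed
    show "mat_add limit_space A B \<in> limit_cone n" if AB: "A \<in> limit_cone n" "B \<in> limit_cone n" for A B
    proof -
      obtain k C D where CD: "C \<in> mpos (S k) n" "D \<in> mpos (S k) n" "A = map_mat (\<psi> k) C" "B = map_mat (\<psi> k) D"
        using limit_cone_common[OF n AB] .
      interpret Sk: operator_system "S k" by (rule S)
      show ?thesis
        using limit_coneI[OF Sk.mpos_add[OF n CD(1,2)]] CD
          star_linear_map.map_mat_add[OF star Sk.mpos_mats[OF n CD(1)] Sk.mpos_mats[OF n CD(2)]] by simp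
    qed
    show "mat_scale limit_space (complex_of_real r) A \<in> limit_cone n" if A: "A \<in> limit_cone n" and r: "0 \<le> r" for A r
    proof -
      obtain k C where C: "C \<in> mpos (S k) n" "A = map_mat (\<psi> k) C" using A by (rule limit_coneE)
      interpret Sk: operator_system "S k" by (rule S)
      show ?thesis
        using limit_coneI[OF Sk.mpos_scale[OF n C(1) r]] C
          star_linear_map.map_mat_scale[OF star Sk.mpos_mats[OF n C(1)]] by simp
    qed
    show "mat_conj limit_space \<alpha> A \<in> limit_cone n"
      if m: "m > 0" and \<alpha>: "\<alpha> \<in> carrier_mat n m" and A: "A \<in> limit_cone m" for m \<alpha> A
    proof -
      obtain k C where C: "C \<in> mpos (S k) m" "A = map_mat (\<psi> k) C" using A by (rule limit_coneE)
      interpret Sk: operator_system "S k" by (rule S)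
      show ?thesis
        using limit_coneI[OF Sk.mpos_conj[OF n m \<alpha> C(1)]] C
          star_linear_map.map_mat_conj[OF star \<alpha> Sk.mpos_mats[OF m C(1)]] by simp
    qed
    show "A = mat_zero limit_space n" if A: "A \<in> mats limit_space n"
      and pos: "\<And>r::real. r > 0 \<Longrightarrow>
        mat_add limit_space (scalar_mat limit_space n r (ounit L)) A \<in> limit_cone n"
      and neg: "\<And>r::real. r > 0 \<Longrightarrow>
        mat_add limit_space (scalar_mat limit_space n r (ounit L))
          (mat_neg limit_space A) \<in> limit_cone n" for A
    proof -
      have "mat_neg limit_space A = mat_neg L A"
        unfolding U.mat_neg_eq_scale[OF A] L.mat_neg_eq_scale[OF mats_limit_space_L[OF A]] by simp
      then have neg': "mat_add L (scalar_mat L n r (ounit L)) (mat_neg L A) \<in> mpos L n"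
        if "r > 0" for r using limit_cone_L[OF n neg[OF that]] by simp
      have pos': "mat_add L (scalar_mat L n r (ounit L)) A \<in> mpos L n"
        if "r > 0" for r using limit_cone_L[OF n pos[OF that]] by simp
      note Am = mats_limit_space_L[OF A]
      have "A = mat_zero L n"
        by (rule L.mpos_proper[OF n L.archimedean[OF n Am pos'] L.archimedean[OF n L.mat_neg_mats[OF Am] neg']])
      then show ?thesis by (simp add: mat_zero_def)
    qed
  next
    fix x assume "x \<in> carrier limit_space"
    then obtain k a where a: "a \<in> carrier (S k)" "x = \<psi> k a" by (auto elim: limit_carrierE)
    interpret Sk: operator_system "S k" by (rule S)
    obtain r where r: "r > 0" "norm_block (S k) (ounit (S k)) r a \<in> mpos (S k) 2"
      using Sk.norm_block_mpos[OF a(1)] by auto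
    have "map_mat (\<psi> k) (norm_block (S k) (ounit (S k)) r a) = norm_block limit_space (ounit L) r x"
      unfolding a(2)
      by (rule ucp_norm_block[OF S star_vector_space_limit lin])
        (use a(1) ucpD(3)[OF \<psi>] ucp_invol[OF S L \<psi> a(1)] in auto)
    then show "\<exists>r>0. norm_block limit_space (ounit L) r x \<in> limit_cone 2"
      using r limit_coneI[OF r(2)] by auto
  qed
qed

text \<open>The universal property gives a map from \<open>L\<close> to the union \<open>R\<close>
  of the images. Followed by the inclusion of \<open>R\<close> in \<open>L\<close> it fixes all
  \<open>\<psi> k x\<close>, so it is the identity. That it maps into \<open>R\<close> and preserves
  cones then carries all the information about \<open>L\<close>.\<close>

lemma inductive_limit_identity:
  assumes lim: "inductive_limit S \<phi> L \<psi>"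
  shows "\<exists>h. ucp L (archimedeanization limit_space (ounit L) limit_cone) h \<and> (\<forall>z\<in>carrier L. h z = z)"
proof -
  define R where "R = archimedeanization limit_space (ounit L) limit_cone"
  interpret U: archimedeanizable limit_space "ounit L" limit_cone by (rule archimedeanizable_limit)
  have R: "operator_system R" unfolding R_def by (rule U.operator_system_archimedeanization)
  have "ucp (S k) R (\<psi> k)" for k
  proof (rule ucpI)
    show "linear_map (S k) R (\<psi> k)"
      using ucpD(1)[OF \<psi>[of k]] limit_carrierI by (intro linear_mapI) (simp_all add: linear_mapD R_def)
    show "map_mat (\<psi> k) A \<in> mpos R n" if "n > 0" "A \<in> mpos (S k) n" for n A
      unfolding R_def using that by (intro U.P_subset_closure limit_coneI)
    show "\<psi> k (ounit (S k)) = ounit R" using ucpD(3)[OF \<psi>] by (simp add: R_def)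
  qed
  then have comp: "compatible_maps S \<phi> R \<psi>"
    using compatible by (simp add: compatible_maps_def)
  obtain j :: "'l \<Rightarrow> nat \<times> 'a" where inj: "inj_on j (carrier R)"
    using limit_carrier_inj by (auto simp: R_def)
  obtain h where h: "ucp L R h" "\<And>k x. x \<in> carrier (S k) \<Longrightarrow> h (\<psi> k x) = \<psi> k x"
    using inductive_limit_lift[OF lim R comp inj] by blast
  have "ucp R L id"
  proof (rule ucpI)
    show "linear_map R L id"
      by (rule linear_mapI) (auto simp: R_def limit_carrier_L)
    show "map_mat id A \<in> mpos L n" if n: "n > 0" and A: "A \<in> mpos R n" for n A
    proof -
      have "A \<in> mats limit_space n" using A by (simp add: R_def)
      note Am = mats_limit_space_L[OF this]
      have "map_mat id A = A" by (rule eq_matI) auto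
      moreover have "A \<in> mpos L n"
        using A by (intro L.archimedean[OF n Am] limit_cone_L[OF n]) (simp add: R_def)
      ultimately show ?thesis by simp
    qed
  qed (simp add: R_def)
  from ucp_comp[OF h(1) this] have hL: "ucp L L h" by simp
  have "h z = z" if "z \<in> carrier L" for z
  proof (rule inductive_limit_endo_identity[OF lim hL h(2) _ that])
    fix f assume f: "ucp L complex_sys f"
    interpret f: star_linear_map L complex_sys f
      by (rule ucp_star_linear_map[OF L operator_system_complex f])
    interpret S0: operator_system "S 0" by (rule S)
    \<comment> \<open>A state takes the value 1 at the unit of \<open>L\<close>, which is the image
      of the unit of \<open>S 0\<close>; multiples of the latter give the injection.\<close>
    have "ounit (S 0) \<noteq> \<zero>\<^bsub>S 0\<^esub>"
    proof
      assume "ounit (S 0) = \<zero>\<^bsub>S 0\<^esub>"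
      then have "ounit L = \<zero>\<^bsub>L\<^esub>"
        using ucpD(3)[OF \<psi>, of 0] star_linear_map.map_zero[OF \<psi>_map, of 0] by simp
      then show False using ucpD(3)[OF f] f.map_zero by simp
    qed
    from S0.inj_smult_ounit[OF this]
    have "inj (\<lambda>c. (0::nat, c \<odot>\<^bsub>S 0\<^esub> ounit (S 0)))" by (auto simp: inj_on_def)
    then show "\<exists>j :: complex \<Rightarrow> nat \<times> 'a. inj j" by blast
  qed
  then show ?thesis using h(1) unfolding R_def by blast
qed

lemma inductive_limit_carrier:
  assumes "inductive_limit S \<phi> L \<psi>"
  shows "carrier L = limit_carrier"
proof -
  obtain h where h: "ucp L (archimedeanization limit_space (ounit L) limit_cone) h" "\<forall>z\<in>carrier L. h z = z"
    using inductive_limit_identity[OF assms] by blast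
  then show ?thesis using linear_mapD(1)[OF ucpD(1)[OF h(1)]] limit_carrier_L by auto
qed

lemma inductive_limit_mpos:
  assumes "inductive_limit S \<phi> L \<psi>" and n: "n > 0" and A: "A \<in> mpos L n" and r: "r > 0"
  shows "mat_add L (scalar_mat L n r (ounit L)) A \<in> limit_cone n"
proof -
  obtain h where h: "ucp L (archimedeanization limit_space (ounit L) limit_cone) h" "\<forall>z\<in>carrier L. h z = z"
    using inductive_limit_identity[OF assms(1)] by blast
  have "map_mat h A = A"
    using h(2) L.mpos_mats[OF n A] by (intro eq_matI) (auto simp: L.mats_closed)
  then show ?thesis using ucpD(2)[OF h(1) n A] r by simp
qed

end

section \<open>The algebraic tensor product\<close>

abbreviation pm_scale :: "complex \<Rightarrow> ('k \<Rightarrow>\<^sub>0 complex) \<Rightarrow> ('k \<Rightarrow>\<^sub>0 complex)" where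
  "pm_scale c \<equiv> Poly_Mapping.map ((*) c)"

lemma lookup_pm_scale [simp]: "Poly_Mapping.lookup (pm_scale c f) k = c * Poly_Mapping.lookup f k"
  by (simp add: Poly_Mapping.map.rep_eq when_def)

lemma pm_scale_simps:
  "pm_scale c (f + g) = pm_scale c f + pm_scale c g"
  "pm_scale c (f - g) = pm_scale c f - pm_scale c g"
  "pm_scale (c + d) f = pm_scale c f + pm_scale d f"
  "pm_scale c (pm_scale d f) = pm_scale (c * d) f"
  "pm_scale 1 f = f" "pm_scale 0 f = 0" "pm_scale (- 1) f = - f" "pm_scale c 0 = 0"
  by (rule poly_mapping_eqI; simp add: lookup_add lookup_minus algebra_simps)+

lemma pm_scale_single: "pm_scale c (Poly_Mapping.single p a) = Poly_Mapping.single p (c * a)"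
  by (simp add: map_single)

lemma keys_pm_scale: "Poly_Mapping.keys (pm_scale c f) \<subseteq> Poly_Mapping.keys f"
  by (auto simp: in_keys_iff)

lemma pm_scale_sum: "pm_scale c (\<Sum>p\<in>K. h p) = (\<Sum>p\<in>K. pm_scale c (h p))"
  by (rule poly_mapping_eqI) (simp add: lookup_sum sum_distrib_left)

lemma pm_sum_singles: "(\<Sum>p\<in>Poly_Mapping.keys f. Poly_Mapping.single p (Poly_Mapping.lookup f p)) = f"
  by (rule poly_mapping_eqI) (simp add: lookup_sum lookup_single when_def in_keys_iff)

text \<open>Covers the involution, with conjugated coefficients, and \<open>f \<otimes> g\<close>,
  with unchanged ones, at the level of formal combinations; hence the parameter
  \<open>\<kappa>\<close>.\<close>

definition pm_push :: "('k \<Rightarrow> 'l) \<Rightarrow> (complex \<Rightarrow> complex) \<Rightarrow> ('k \<Rightarrow>\<^sub>0 complex) \<Rightarrow> ('l \<Rightarrow>\<^sub>0 complex)" where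
  "pm_push \<sigma> \<kappa> f = (\<Sum>p\<in>Poly_Mapping.keys f. Poly_Mapping.single (\<sigma> p) (\<kappa> (Poly_Mapping.lookup f p)))"

locale coefficient_hom =
  fixes \<kappa> :: "complex \<Rightarrow> complex"
  assumes add: "\<kappa> (a + b) = \<kappa> a + \<kappa> b" and mult: "\<kappa> (a * b) = \<kappa> a * \<kappa> b" and one: "\<kappa> 1 = 1"
begin

lemma zero: "\<kappa> 0 = 0"
  using add[of 0 0] by simp

lemma push_add: "pm_push \<sigma> \<kappa> (f + g) = pm_push \<sigma> \<kappa> f + pm_push \<sigma> \<kappa> g"
  unfolding pm_push_def by (rule setsum_keys_plus_distrib) (simp_all add: zero add single_add)

lemma push_superset:
  assumes "finite K" "Poly_Mapping.keys f \<subseteq> K"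
  shows "pm_push \<sigma> \<kappa> f = (\<Sum>p\<in>K. Poly_Mapping.single (\<sigma> p) (\<kappa> (Poly_Mapping.lookup f p)))"
  unfolding pm_push_def using assms
  by (intro sum.mono_neutral_left) (auto simp: in_keys_iff zero)

lemma push_scale: "pm_push \<sigma> \<kappa> (pm_scale c f) = pm_scale (\<kappa> c) (pm_push \<sigma> \<kappa> f)"
  unfolding push_superset[OF finite_keys keys_pm_scale]
  by (simp add: pm_push_def pm_scale_single pm_scale_sum mult)

lemma push_single: "pm_push \<sigma> \<kappa> (Poly_Mapping.single p a) = Poly_Mapping.single (\<sigma> p) (\<kappa> a)"
  by (simp add: pm_push_def zero)

lemma push_diff: "pm_push \<sigma> \<kappa> (f - g) = pm_push \<sigma> \<kappa> f - pm_push \<sigma> \<kappa> g"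
  using push_add[of \<sigma> "f - g" g] by simp

lemma push_zero: "pm_push \<sigma> \<kappa> 0 = 0"
  by (simp add: pm_push_def)

end

interpretation id_hom: coefficient_hom "\<lambda>x. x"
  by unfold_locales auto

interpretation cnj_hom: coefficient_hom cnj
  by unfold_locales auto

section \<open>The quotient of formal combinations as a star vector space\<close>

locale tensor_pair = S: star_vector_space S + T: star_vector_space T
  for S :: "('a, 'y) star_space_scheme" and T :: "('b, 'z) star_space_scheme"
begin

abbreviation tc :: "('a \<times> 'b \<Rightarrow>\<^sub>0 complex) \<Rightarrow> ('a, 'b) tensor" where
  "tc \<equiv> tensor_class S T"

abbreviation A :: "('a, 'b) tensor star_space" where
  "A \<equiv> alg_tensor S T"

lemma null_diff: "f \<in> tensor_null S T \<Longrightarrow> g \<in> tensor_null S T \<Longrightarrow> f - g \<in> tensor_null S T"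
  using null_add[of f S T "- g"] null_scale[of g S T "-1"] by (simp add: pm_scale_simps)

lemma free_closed:
  "f \<in> tensor_free S T \<Longrightarrow> g \<in> tensor_free S T \<Longrightarrow> f + g \<in> tensor_free S T"
  "f \<in> tensor_free S T \<Longrightarrow> g \<in> tensor_free S T \<Longrightarrow> f - g \<in> tensor_free S T"
  "f \<in> tensor_free S T \<Longrightarrow> pm_scale c f \<in> tensor_free S T"
  "0 \<in> tensor_free S T"
  "x \<in> carrier S \<Longrightarrow> y \<in> carrier T \<Longrightarrow> Poly_Mapping.single (x, y) c \<in> tensor_free S T"
  unfolding tensor_free_def mem_Collect_eq using keys_add[of f g] keys_diff[of f g] keys_pm_scale[of c f]
  by (blast, blast, blast, simp_all)

lemma null_free: "f \<in> tensor_null S T \<Longrightarrow> f \<in> tensor_free S T"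
  by (induction rule: tensor_null.induct) (auto intro!: free_closed)

lemma tc_eq_iff: "tc f = tc g \<longleftrightarrow> f - g \<in> tensor_null S T"
proof
  assume "tc f = tc g"
  moreover have "f \<in> tc f" by (simp add: tensor_class_def null_zero)
  ultimately show "f - g \<in> tensor_null S T" by (simp add: tensor_class_def)
next
  assume fg: "f - g \<in> tensor_null S T"
  have "h - f \<in> tensor_null S T \<longleftrightarrow> h - g \<in> tensor_null S T" for h
    using null_add[OF _ fg, of "h - f"] null_diff[OF _ fg, of "h - g"] by auto
  then show "tc f = tc g" by (simp add: tensor_class_def)
qed

lemma rep_tc: "tensor_rep (tc f) - f \<in> tensor_null S T"
proof -
  have "f \<in> tc f" by (simp add: tensor_class_def null_zero)
  then have "tensor_rep (tc f) \<in> tc f" unfolding tensor_rep_def by (rule someI)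
  then show ?thesis by (simp add: tensor_class_def)
qed

lemma carrier_A: "carrier A = tc ` tensor_free S T"
  by (simp add: alg_tensor_def)

lemma tc_carrier: "f \<in> tensor_free S T \<Longrightarrow> tc f \<in> carrier A"
  by (simp add: carrier_A)

lemma zero_A: "\<zero>\<^bsub>A\<^esub> = tc 0"
  by (simp add: alg_tensor_def)

lemma add_A: "tc f \<oplus>\<^bsub>A\<^esub> tc g = tc (f + g)"
  using null_add[OF rep_tc[of f] rep_tc[of g]] by (simp add: alg_tensor_def tc_eq_iff algebra_simps)

lemma smult_A: "c \<odot>\<^bsub>A\<^esub> tc f = tc (pm_scale c f)"
  using null_scale[OF rep_tc[of f], of c] by (simp add: alg_tensor_def tc_eq_iff pm_scale_simps)

text \<open>Bilinearity relations go to bilinearity relations, also when coefficients are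
  conjugated. Therefore the involution and \<open>tensor_map\<close> can be computed on any
  representative, not only on the one chosen by \<open>tensor_rep\<close>.\<close>

lemma push_null:
  assumes "coefficient_hom \<kappa>" "tensor_pair S' T'"
    and s: "\<And>x. x \<in> carrier S \<Longrightarrow> s x \<in> carrier S'"
      "\<And>x y. x \<in> carrier S \<Longrightarrow> y \<in> carrier S \<Longrightarrow> s (x \<oplus>\<^bsub>S\<^esub> y) = s x \<oplus>\<^bsub>S'\<^esub> s y"
      "\<And>c x. x \<in> carrier S \<Longrightarrow> s (c \<odot>\<^bsub>S\<^esub> x) = \<kappa> c \<odot>\<^bsub>S'\<^esub> s x"
    and t: "\<And>x. x \<in> carrier T \<Longrightarrow> t x \<in> carrier T'"
      "\<And>x y. x \<in> carrier T \<Longrightarrow> y \<in> carrier T \<Longrightarrow> t (x \<oplus>\<^bsub>T\<^esub> y) = t x \<oplus>\<^bsub>T'\<^esub> t y"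
      "\<And>c x. x \<in> carrier T \<Longrightarrow> t (c \<odot>\<^bsub>T\<^esub> x) = \<kappa> c \<odot>\<^bsub>T'\<^esub> t x"
    and f: "f \<in> tensor_null S T"
  shows "pm_push (\<lambda>p. (s (fst p), t (snd p))) \<kappa> f \<in> tensor_null S' T'"
proof -
  interpret \<kappa>: coefficient_hom \<kappa> by fact
  show ?thesis
    using f
    by (induction rule: tensor_null.induct)
      (simp_all add: \<kappa>.push_zero \<kappa>.push_add \<kappa>.push_scale \<kappa>.push_diff \<kappa>.push_single \<kappa>.one s t
        null_zero null_add null_scale add_left add_right smult_left smult_right)
qed

lemma push_free:
  assumes "\<And>x. x \<in> carrier S \<Longrightarrow> s x \<in> carrier S'" "\<And>x. x \<in> carrier T \<Longrightarrow> t x \<in> carrier T'"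
    and f: "f \<in> tensor_free S T"
  shows "pm_push (\<lambda>p. (s (fst p), t (snd p))) \<kappa> f \<in> tensor_free S' T'"
proof -
  have "Poly_Mapping.keys (pm_push (\<lambda>p. (s (fst p), t (snd p))) \<kappa> f) \<subseteq>
    (\<Union>p\<in>Poly_Mapping.keys f. {(s (fst p), t (snd p))})"
    unfolding pm_push_def by (rule order_trans[OF keys_sum]) (auto split: if_splits)
  also have "\<dots> \<subseteq> carrier S' \<times> carrier T'"
    using assms by (auto simp: tensor_free_def)
  finally show ?thesis by (simp add: tensor_free_def)
qed

lemma invol_A: "invol A (tc f) = tc (pm_push (\<lambda>p. (invol S (fst p), invol T (snd p))) cnj f)"
proof -
  have "pm_push (\<lambda>p. (invol S (fst p), invol T (snd p))) cnj (tensor_rep (tc f) - f) \<in> tensor_null S T"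
    using rep_tc[of f]
    by (intro push_null cnj_hom.coefficient_hom_axioms tensor_pair_axioms)
      (auto simp: S.invol_closed T.invol_closed S.invol_add T.invol_add S.invol_smult T.invol_smult)
  then show ?thesis
    by (simp add: alg_tensor_def tc_eq_iff cnj_hom.push_diff) (simp add: pm_push_def)
qed

lemma star_vector_space_A: "star_vector_space A"
proof (rule star_vector_spaceI)
  let ?\<sigma> = "\<lambda>p. (invol S (fst p), invol T (snd p))"
  have inv: "pm_push ?\<sigma> cnj f \<in> tensor_free S T" if "f \<in> tensor_free S T" for f
    using that by (intro push_free S.invol_closed T.invol_closed)
  have "pm_push ?\<sigma> cnj (pm_push ?\<sigma> cnj f) = f" if f: "f \<in> tensor_free S T" for f
  proof -
    have "pm_push ?\<sigma> cnj (pm_push ?\<sigma> cnj f) =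
      (\<Sum>p\<in>Poly_Mapping.keys f. pm_push ?\<sigma> cnj (Poly_Mapping.single (?\<sigma> p) (cnj (Poly_Mapping.lookup f p))))"
      unfolding pm_push_def[of _ _ f]
      by (induction rule: infinite_finite_induct) (simp_all add: cnj_hom.push_add cnj_hom.push_zero)
    also have "\<dots> = (\<Sum>p\<in>Poly_Mapping.keys f. Poly_Mapping.single p (Poly_Mapping.lookup f p))"
      using f by (intro sum.cong) (auto simp: cnj_hom.push_single tensor_free_def S.invol_invol T.invol_invol)
    also have "\<dots> = f" by (rule pm_sum_singles)
    finally show ?thesis .
  qed
  then show "invol A (invol A X) = X" if "X \<in> carrier A" for X
    using that by (auto simp: carrier_A invol_A)
  show "invol A X \<in> carrier A" if "X \<in> carrier A" for X
    using that inv by (auto simp: carrier_A invol_A)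
qed (auto simp: carrier_A zero_A add_A smult_A invol_A free_closed pm_scale_simps algebra_simps
    cnj_hom.push_add cnj_hom.push_scale intro!: imageI free_closed)

sublocale A: star_vector_space A
  by (rule star_vector_space_A)

section \<open>Pure tensors and the universal property\<close>

abbreviation pure :: "'a \<Rightarrow> 'b \<Rightarrow> ('a, 'b) tensor" where
  "pure \<equiv> pure_tensor S T"

lemma pure_carrier [simp, intro]: "x \<in> carrier S \<Longrightarrow> y \<in> carrier T \<Longrightarrow> pure x y \<in> carrier A"
  by (simp add: pure_tensor_def tc_carrier free_closed)

lemma pure_add_left: "x \<in> carrier S \<Longrightarrow> x' \<in> carrier S \<Longrightarrow> y \<in> carrier T \<Longrightarrow>
    pure (x \<oplus>\<^bsub>S\<^esub> x') y = pure x y \<oplus>\<^bsub>A\<^esub> pure x' y"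
  using add_left[of x S x' y T] by (simp add: pure_tensor_def add_A tc_eq_iff diff_diff_add)

lemma pure_add_right: "x \<in> carrier S \<Longrightarrow> y \<in> carrier T \<Longrightarrow> y' \<in> carrier T \<Longrightarrow>
    pure x (y \<oplus>\<^bsub>T\<^esub> y') = pure x y \<oplus>\<^bsub>A\<^esub> pure x y'"
  using add_right[of x S y T y'] by (simp add: pure_tensor_def add_A tc_eq_iff diff_diff_add)

lemma pure_smult_left: "x \<in> carrier S \<Longrightarrow> y \<in> carrier T \<Longrightarrow> pure (c \<odot>\<^bsub>S\<^esub> x) y = c \<odot>\<^bsub>A\<^esub> pure x y"
  using smult_left[of x S y T c] by (simp add: pure_tensor_def smult_A tc_eq_iff pm_scale_single)

lemma pure_smult_right: "x \<in> carrier S \<Longrightarrow> y \<in> carrier T \<Longrightarrow> pure x (c \<odot>\<^bsub>T\<^esub> y) = c \<odot>\<^bsub>A\<^esub> pure x y"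
  using smult_right[of x S y T c] by (simp add: pure_tensor_def smult_A tc_eq_iff pm_scale_single)

lemma pure_zero [simp]:
  "y \<in> carrier T \<Longrightarrow> pure \<zero>\<^bsub>S\<^esub> y = \<zero>\<^bsub>A\<^esub>" "x \<in> carrier S \<Longrightarrow> pure x \<zero>\<^bsub>T\<^esub> = \<zero>\<^bsub>A\<^esub>"
  using pure_smult_left[of "\<zero>\<^bsub>S\<^esub>" y 0] pure_smult_right[of x "\<zero>\<^bsub>T\<^esub>" 0] by simp_all

lemma invol_pure: "invol A (pure x y) = pure (invol S x) (invol T y)"
  by (simp add: pure_tensor_def invol_A cnj_hom.push_single)

lemma tensor_induct [consumes 1, case_names zero add]:
  assumes "X \<in> carrier A" and zero: "P \<zero>\<^bsub>A\<^esub>"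
    and add: "\<And>X x y. X \<in> carrier A \<Longrightarrow> P X \<Longrightarrow> x \<in> carrier S \<Longrightarrow> y \<in> carrier T \<Longrightarrow> P (X \<oplus>\<^bsub>A\<^esub> pure x y)"
  shows "P X"
proof -
  obtain f where f: "f \<in> tensor_free S T" "X = tc f" using assms(1) by (auto simp: carrier_A)
  have "P (tc (\<Sum>p\<in>K. Poly_Mapping.single p (Poly_Mapping.lookup f p))) \<and>
    tc (\<Sum>p\<in>K. Poly_Mapping.single p (Poly_Mapping.lookup f p)) \<in> carrier A"
    if "finite K" "K \<subseteq> carrier S \<times> carrier T" for K
    using that
  proof (induction K rule: finite_induct)
    case empty
    then show ?case using zero A.zero_closed by (simp add: zero_A)
  next
    case (insert p K)
    obtain x y where p: "p = (x, y)" "x \<in> carrier S" "y \<in> carrier T" using insert.prems by auto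
    let ?c = "Poly_Mapping.lookup f p" and ?F = "\<Sum>p\<in>K. Poly_Mapping.single p (Poly_Mapping.lookup f p)"
    \<comment> \<open>The coefficient is moved into the left factor, so that the new summand is a
      pure tensor.\<close>
    have "tc (Poly_Mapping.single p ?c + ?F) = tc ?F \<oplus>\<^bsub>A\<^esub> pure (?c \<odot>\<^bsub>S\<^esub> x) y"
      using p by (simp add: pure_smult_left) (simp add: pure_tensor_def smult_A add_A pm_scale_single add.commute)
    then show ?case using insert p add by auto
  qed
  from this[of "Poly_Mapping.keys f"] show ?thesis
    using f by (simp add: tensor_free_def pm_sum_singles)
qed

lemma linear_map_ext:
  assumes "linear_map A W F" "linear_map A W G" "star_vector_space W"
    and "\<And>x y. x \<in> carrier S \<Longrightarrow> y \<in> carrier T \<Longrightarrow> F (pure x y) = G (pure x y)" "X \<in> carrier A"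
  shows "F X = G X"
proof -
  interpret F: star_linear_map A W F
    by (intro star_linear_map.intro star_vector_space_A assms star_linear_map_axioms.intro)
  interpret G: star_linear_map A W G
    by (intro star_linear_map.intro star_vector_space_A assms star_linear_map_axioms.intro)
  show ?thesis
    using assms(5) by (induction rule: tensor_induct) (simp_all add: F.map_add G.map_add assms(4))
qed

text \<open>Formal combinations are evaluated linearly. The evaluation vanishes on the bilinearity
  relations, so its value at \<open>tensor_rep\<close> of a class is its value at every
  representative.\<close>

lemma tensor_lift_exists:
  assumes W: "star_vector_space W"
    and b: "\<And>x y. x \<in> carrier S \<Longrightarrow> y \<in> carrier T \<Longrightarrow> b x y \<in> carrier W"
      "\<And>x x' y. x \<in> carrier S \<Longrightarrow> x' \<in> carrier S \<Longrightarrow> y \<in> carrier T \<Longrightarrow> b (x \<oplus>\<^bsub>S\<^esub> x') y = b x y \<oplus>\<^bsub>W\<^esub> b x' y"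
      "\<And>x y y'. x \<in> carrier S \<Longrightarrow> y \<in> carrier T \<Longrightarrow> y' \<in> carrier T \<Longrightarrow> b x (y \<oplus>\<^bsub>T\<^esub> y') = b x y \<oplus>\<^bsub>W\<^esub> b x y'"
      "\<And>c x y. x \<in> carrier S \<Longrightarrow> y \<in> carrier T \<Longrightarrow> b (c \<odot>\<^bsub>S\<^esub> x) y = c \<odot>\<^bsub>W\<^esub> b x y"
      "\<And>c x y. x \<in> carrier S \<Longrightarrow> y \<in> carrier T \<Longrightarrow> b x (c \<odot>\<^bsub>T\<^esub> y) = c \<odot>\<^bsub>W\<^esub> b x y"
  shows "\<exists>F. linear_map A W F \<and> (\<forall>x\<in>carrier S. \<forall>y\<in>carrier T. F (pure x y) = b x y)"
proof -
  interpret W: star_vector_space W by fact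
  define ev where "ev f = (\<Oplus>\<^bsub>W\<^esub>p\<in>Poly_Mapping.keys f. Poly_Mapping.lookup f p \<odot>\<^bsub>W\<^esub> b (fst p) (snd p))" for f
  have bp: "b (fst p) (snd p) \<in> carrier W" if "p \<in> Poly_Mapping.keys f" "f \<in> tensor_free S T" for p f
    using that b(1) by (auto simp: tensor_free_def)
  \<comment> \<open>The support of a sum may shrink by cancellation, so evaluations are compared
    over a common larger index set.\<close>
  have ev_superset: "ev f = (\<Oplus>\<^bsub>W\<^esub>p\<in>K. Poly_Mapping.lookup f p \<odot>\<^bsub>W\<^esub> b (fst p) (snd p))"
    if "finite K" "Poly_Mapping.keys f \<subseteq> K" "K \<subseteq> carrier S \<times> carrier T" for K f
    unfolding ev_def using that b(1)
    by (intro W.add.finprod_mono_neutral_cong_left) (auto simp: in_keys_iff subset_iff)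
  have ev_closed: "ev f \<in> carrier W" if "f \<in> tensor_free S T" for f
    unfolding ev_def using bp[OF _ that] by (auto intro!: W.finsum_closed)
  have ev_add: "ev (f + g) = ev f \<oplus>\<^bsub>W\<^esub> ev g" if f: "f \<in> tensor_free S T" and g: "g \<in> tensor_free S T" for f g
  proof -
    let ?K = "Poly_Mapping.keys f \<union> Poly_Mapping.keys g"
    have K: "finite ?K" "?K \<subseteq> carrier S \<times> carrier T" using f g by (auto simp: tensor_free_def)
    have bK: "b (fst p) (snd p) \<in> carrier W" if "p \<in> ?K" for p using K(2) that b(1) by auto
    have "ev (f + g) = (\<Oplus>\<^bsub>W\<^esub>p\<in>?K. Poly_Mapping.lookup f p \<odot>\<^bsub>W\<^esub> b (fst p) (snd p) \<oplus>\<^bsub>W\<^esub>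
        Poly_Mapping.lookup g p \<odot>\<^bsub>W\<^esub> b (fst p) (snd p))"
      unfolding ev_superset[OF K(1) keys_add K(2)]
      by (rule W.finsum_cong') (simp_all add: lookup_add W.smult_add_left bK)
    also have "\<dots> = ev f \<oplus>\<^bsub>W\<^esub> ev g"
      unfolding ev_superset[OF K(1) Un_upper1 K(2)] ev_superset[OF K(1) Un_upper2 K(2)]
      by (rule W.finsum_addf) (simp_all add: bK)
    finally show ?thesis .
  qed
  have ev_scale: "ev (pm_scale c f) = c \<odot>\<^bsub>W\<^esub> ev f" if f: "f \<in> tensor_free S T" for c f
  proof -
    have K: "Poly_Mapping.keys f \<subseteq> carrier S \<times> carrier T" using f by (simp add: tensor_free_def)
    show ?thesis
      unfolding ev_superset[OF finite_keys keys_pm_scale K] unfolding ev_def using bp[OF _ f]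
      by (subst W.smult_finsum) (auto intro!: W.finsum_cong')
  qed
  have ev_single: "ev (Poly_Mapping.single (x, y) c) = c \<odot>\<^bsub>W\<^esub> b x y" if "x \<in> carrier S" "y \<in> carrier T" for x y c
    using that b(1) by (simp add: ev_def)
  have ev_diff: "ev (f - g) = ev f \<oplus>\<^bsub>W\<^esub> (\<ominus>\<^bsub>W\<^esub> ev g)" if f: "f \<in> tensor_free S T" and g: "g \<in> tensor_free S T" for f g
    using ev_add[OF f free_closed(3)[OF g, of "-1"]] ev_scale[OF g, of "-1"] ev_closed[OF g]
    by (simp add: pm_scale_simps W.neg_eq_smult)
  have ev_null: "ev f = \<zero>\<^bsub>W\<^esub>" if "f \<in> tensor_null S T" for f
    using that
  proof (induction rule: tensor_null.induct)
    case null_zero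
    then show ?case by (simp add: ev_def)
  next
    case (null_add f g)
    then show ?case by (simp add: ev_add null_free)
  next
    case (null_scale f c)
    then show ?case by (simp add: ev_scale null_free)
  next
    case (add_left x x' y)
    then show ?case
      by (simp add: ev_diff ev_single free_closed b W.minus_add W.a_ac W.r_neg W.r_neg1 W.r_neg2)
  next
    case (add_right x y y')
    then show ?case
      by (simp add: ev_diff ev_single free_closed b W.minus_add W.a_ac W.r_neg W.r_neg1 W.r_neg2)
  next
    case (smult_left x y c)
    then show ?case by (simp add: ev_diff ev_single free_closed b W.r_neg)
  next
    case (smult_right x y c)
    then show ?case by (simp add: ev_diff ev_single free_closed b W.r_neg)
  qed
  have rep_free: "tensor_rep (tc f) \<in> tensor_free S T" if "f \<in> tensor_free S T" for f
    using free_closed(1)[OF null_free[OF rep_tc[of f]] that] by simp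
  have F: "ev (tensor_rep (tc f)) = ev f" if f: "f \<in> tensor_free S T" for f
    using ev_add[OF null_free[OF rep_tc[of f]] f] ev_null[OF rep_tc[of f]] ev_closed[OF f] by simp
  show ?thesis
  proof (intro exI[of _ "\<lambda>X. ev (tensor_rep X)"] conjI ballI)
    show "linear_map A W (\<lambda>X. ev (tensor_rep X))"
      by (rule linear_mapI) (auto simp: carrier_A add_A smult_A F free_closed ev_closed ev_add ev_scale)
    show "ev (tensor_rep (pure x y)) = b x y" if "x \<in> carrier S" "y \<in> carrier T" for x y
      using that b(1) by (simp add: pure_tensor_def F free_closed ev_single)
  qed
qed

lemma tensor_map:
  assumes "star_vector_space S'" "star_vector_space T'" "linear_map S S' f" "linear_map T T' g"
  shows linear_map_tensor_map: "linear_map A (alg_tensor S' T') (tensor_map S' T' f g)"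
    and tensor_map_pure: "tensor_map S' T' f g (pure x y) = pure_tensor S' T' (f x) (g y)"
proof -
  interpret P: tensor_pair S' T' using assms by (intro tensor_pair.intro)
  let ?\<sigma> = "\<lambda>p. (f (fst p), g (snd p))"
  have map_tc: "tensor_map S' T' f g (tc h) = tensor_class S' T' (pm_push ?\<sigma> (\<lambda>x. x) h)" for h
  proof -
    have "pm_push ?\<sigma> (\<lambda>x. x) (tensor_rep (tc h) - h) \<in> tensor_null S' T'"
      using rep_tc[of h] linear_mapD[OF assms(3)] linear_mapD[OF assms(4)]
      by (intro push_null id_hom.coefficient_hom_axioms P.tensor_pair_axioms)
    then show ?thesis
      by (simp add: tensor_map_def P.tc_eq_iff id_hom.push_diff) (simp add: pm_push_def)
  qed
  show "linear_map A (alg_tensor S' T') (tensor_map S' T' f g)"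
    using push_free[of f S' g T' _ "\<lambda>x. x"] linear_mapD(1)[OF assms(3)] linear_mapD(1)[OF assms(4)]
    by (intro linear_mapI) (auto simp: carrier_A P.carrier_A map_tc add_A P.add_A smult_A P.smult_A
      id_hom.push_add id_hom.push_scale)
  show "tensor_map S' T' f g (pure x y) = pure_tensor S' T' (f x) (g y)"
    by (simp add: pure_tensor_def map_tc id_hom.push_single)
qed

end

section \<open>Entrywise products of positive semidefinite matrices\<close>

definition psd_form :: "nat \<Rightarrow> (nat \<Rightarrow> nat \<Rightarrow> complex) \<Rightarrow> bool" where
  "psd_form n G \<longleftrightarrow> (\<forall>v. 0 \<le> (\<Sum>a<n. \<Sum>b<n. v a * cnj (v b) * G a b))"

lemma psd_form_qform: "(\<Sum>a<n. \<Sum>b<n. v a * cnj (v b) * G a b) = qform n v (mat n n (\<lambda>(a, b). G a b))"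
  by (simp add: qform_def)

lemma psd_form_herm:
  assumes "psd_form n G" "a < n" "b < n"
  shows "G b a = cnj (G a b)"
proof -
  have "Im (qform n v (mat n n (\<lambda>(a, b). G a b))) = 0" for v
    using assms(1) unfolding psd_form_def psd_form_qform less_eq_complex_def by simp
  from qform_real_imp_herm[OF this assms(2,3)] show ?thesis using assms(2,3) by simp
qed

lemma psd_form_two:
  assumes "psd_form n G" "i < n" "j < n"
  shows "0 \<le> G i i + cnj c * G i j + c * G j i + c * cnj c * G j j"
  using assms(1)[unfolded psd_form_def psd_form_qform, rule_format,
      of "\<lambda>k. (if k = i then 1 else 0) + (if k = j then c else 0)"]
  unfolding qform_two[OF assms(2,3)] using assms(2,3) by simp

lemma psd_form_diag: "psd_form n G \<Longrightarrow> i < n \<Longrightarrow> 0 \<le> G i i"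
  using psd_form_two[of n G i i 0] by simp

lemma psd_form_null_diag:
  assumes G: "psd_form n G" and ij: "i < n" "j < n" and "G j j = 0"
  shows "G j i = 0"
proof (rule ccontr)
  assume nz: "G j i \<noteq> 0"
  \<comment> \<open>The test vector is \<open>e_i + c e_j\<close> with
    \<open>c = - s * cnj (G j i)\<close>. As \<open>G j j = 0\<close>, the form has real part
    \<open>Re (G i i) - 2 s |G j i|^2\<close>, and this \<open>s\<close> makes it
    \<open>- 1\<close>.\<close>
  define s where "s = (Re (G i i) + 1) / (2 * (cmod (G j i))\<^sup>2)"
  have pos: "(cmod (G j i))\<^sup>2 > 0" using nz by simp
  have "0 \<le> Re (G i i + cnj (- complex_of_real s * cnj (G j i)) * G i j + (- complex_of_real s * cnj (G j i)) * G j i)"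
    using psd_form_two[OF G ij, of "- complex_of_real s * cnj (G j i)"] assms(4) by (simp add: less_eq_complex_def)
  moreover have "G i j = cnj (G j i)" by (rule psd_form_herm[OF G ij(2,1)])
  moreover have "(cmod (G j i))\<^sup>2 = Re (G j i) * Re (G j i) + Im (G j i) * Im (G j i)"
    by (simp add: cmod_power2 flip: power2_eq_square)
  ultimately have "0 \<le> Re (G i i) - 2 * s * (cmod (G j i))\<^sup>2"
    by (simp add: algebra_simps)
  also have "2 * s * (cmod (G j i))\<^sup>2 = Re (G i i) + 1"
    using pos by (simp add: s_def)
  finally show False by simp
qed

lemma psd_form_restrict: "psd_form (Suc n) G \<Longrightarrow> psd_form n G"
proof -
  assume G: "psd_form (Suc n) G"
  have "0 \<le> (\<Sum>a<n. \<Sum>b<n. v a * cnj (v b) * G a b)" for v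
    using G[unfolded psd_form_def, rule_format, of "\<lambda>a. if a = n then 0 else v a"] by simp
  then show ?thesis by (simp add: psd_form_def)
qed

text \<open>Induction on the size: subtracting the rank one matrix built from the last column of \<open>G\<close>
  (Schur complement) reduces to a smaller matrix.\<close>

lemma psd_form_sum_product:
  "psd_form n G \<Longrightarrow> psd_form n H \<Longrightarrow> 0 \<le> (\<Sum>a<n. \<Sum>b<n. G a b * H a b)"
proof (induction n arbitrary: G)
  case (Suc n)
  define d where "d = G n n"
  \<comment> \<open>The Schur complement of the last diagonal entry. If \<open>d = 0\<close>,
    division by zero yields \<open>G' = G\<close>; the last row and column then vanish by
    \<open>psd_form_null_diag\<close>.\<close>
  define G' where "G' a b = G a b - G a n * cnj (G b n) / d" for a b
  have herm: "G b a = cnj (G a b)" if "a \<le> n" "b \<le> n" for a b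
    using psd_form_herm[OF Suc.prems(1), of a b] that by simp
  have d: "0 \<le> d" "cnj d = d"
    using psd_form_diag[OF Suc.prems(1), of n] by (auto simp: d_def less_eq_complex_def complex_eq_iff)
  have d0: "G n a = 0" "G a n = 0" if "d = 0" "a \<le> n" for a
    using psd_form_null_diag[OF Suc.prems(1), of a n] herm[of n a] that by (auto simp: d_def)
  have G'0: "G' n a = 0" "G' a n = 0" if "a \<le> n" for a
    using that d0[OF _ that] herm[of a n] herm[of n n] d by (auto simp: G'_def d_def[symmetric])
  have "psd_form n G'"
    unfolding psd_form_def
  proof
    fix v :: "nat \<Rightarrow> complex"
    define s where "s = (\<Sum>a<n. v a * G a n)"
    \<comment> \<open>Completing the square: with the last coordinate \<open>- s / d\<close> the
      form of \<open>G\<close> takes the value of the form of \<open>G'\<close> at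
      \<open>v\<close>.\<close>
    define w where "w a = (if a = n then - s / d else v a)" for a
    have cs: "(\<Sum>b<n. cnj (v b) * G n b) = cnj s"
      unfolding s_def cnj_sum by (intro sum.cong refl) (simp add: herm[of _ n])
    have "(\<Sum>a<Suc n. \<Sum>b<Suc n. w a * cnj (w b) * G a b) =
      (\<Sum>a<n. \<Sum>b<n. v a * cnj (v b) * G a b) + cnj (- s / d) * (\<Sum>a<n. v a * G a n) +
      (- s / d) * (\<Sum>b<n. cnj (v b) * G n b) + (- s / d) * cnj (- s / d) * d"
    proof -
      have split: "(\<Sum>a<Suc n. \<Sum>b<Suc n. F a b) =
        (\<Sum>a<n. \<Sum>b<n. F a b) + (\<Sum>a<n. F a n) + (\<Sum>b<n. F n b) + F n n" for F :: "nat \<Rightarrow> nat \<Rightarrow> complex"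
        by (simp add: sum.distrib add_ac)
      have "(\<Sum>a<n. w a * cnj (w n) * G a n) = cnj (- s / d) * (\<Sum>a<n. v a * G a n)"
        unfolding sum_distrib_left by (intro sum.cong) (auto simp: w_def)
      moreover have "(\<Sum>b<n. w n * cnj (w b) * G n b) = (- s / d) * (\<Sum>b<n. cnj (v b) * G n b)"
        unfolding sum_distrib_left by (intro sum.cong) (auto simp: w_def)
      moreover have "(\<Sum>a<n. \<Sum>b<n. w a * cnj (w b) * G a b) = (\<Sum>a<n. \<Sum>b<n. v a * cnj (v b) * G a b)"
        by (intro sum.cong) (auto simp: w_def)
      moreover have "w n * cnj (w n) * G n n = (- s / d) * cnj (- s / d) * d"
        by (simp add: w_def d_def)
      ultimately show ?thesis unfolding split by simp
    qed
    also have "\<dots> = (\<Sum>a<n. \<Sum>b<n. v a * cnj (v b) * G a b) - s * cnj s / d"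
      unfolding cs s_def[symmetric] using d(2) by (cases "d = 0") (auto simp: field_simps)
    also have "s * cnj s / d = (\<Sum>a<n. \<Sum>b<n. v a * cnj (v b) * (G a n * cnj (G b n) / d))"
      by (simp add: s_def cnj_sum sum_product sum_divide_distrib mult_ac)
    also have "(\<Sum>a<n. \<Sum>b<n. v a * cnj (v b) * G a b) - \<dots> = (\<Sum>a<n. \<Sum>b<n. v a * cnj (v b) * G' a b)"
      by (simp add: G'_def sum_subtractf[symmetric] algebra_simps)
    finally have "(\<Sum>a<Suc n. \<Sum>b<Suc n. w a * cnj (w b) * G a b) = (\<Sum>a<n. \<Sum>b<n. v a * cnj (v b) * G' a b)" .
    then show "0 \<le> (\<Sum>a<n. \<Sum>b<n. v a * cnj (v b) * G' a b)"
      using Suc.prems(1)[unfolded psd_form_def, rule_format, of w] by (simp only:)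
  qed
  then have 1: "0 \<le> (\<Sum>a<n. \<Sum>b<n. G' a b * H a b)"
    using Suc.IH psd_form_restrict[OF Suc.prems(2)] by blast
  \<comment> \<open>The difference of \<open>G\<close> and \<open>G'\<close> has rank at most one;
    its product with \<open>H\<close> sums to \<open>1 / d\<close> times the form of
    \<open>H\<close> at the last column of \<open>G\<close>.\<close>
  have "(\<Sum>a<Suc n. \<Sum>b<Suc n. G a b * H a b) =
    (\<Sum>a<Suc n. \<Sum>b<Suc n. G' a b * H a b + (1 / d) * (G a n * cnj (G b n) * H a b))"
    by (intro sum.cong refl) (simp add: G'_def algebra_simps)
  also have "\<dots> = (\<Sum>a<Suc n. \<Sum>b<Suc n. G' a b * H a b) +
    (1 / d) * (\<Sum>a<Suc n. \<Sum>b<Suc n. G a n * cnj (G b n) * H a b)"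
    by (simp only: sum.distrib sum_distrib_left)
  also have "(\<Sum>a<Suc n. \<Sum>b<Suc n. G' a b * H a b) = (\<Sum>a<n. \<Sum>b<n. G' a b * H a b)"
    using G'0 by simp
  finally have eq: "(\<Sum>a<Suc n. \<Sum>b<Suc n. G a b * H a b) = (\<Sum>a<n. \<Sum>b<n. G' a b * H a b) +
    (1 / d) * (\<Sum>a<Suc n. \<Sum>b<Suc n. G a n * cnj (G b n) * H a b)" .
  have "0 \<le> (\<Sum>a<Suc n. \<Sum>b<Suc n. G a n * cnj (G b n) * H a b)"
    using Suc.prems(2)[unfolded psd_form_def, rule_format, of "\<lambda>a. G a n"] .
  moreover have "0 \<le> 1 / d" using d by (auto simp: less_eq_complex_def complex_eq_iff Re_divide Im_divide)
  ultimately show ?case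
    unfolding eq using 1 by (intro add_nonneg_nonneg mult_nonneg_nonneg)
qed simp

section \<open>Selections and block sums\<close>

context star_vector_space
begin

text \<open>Rows of \<open>\<alpha>\<close> are unit vectors or zero. The lemma serves both to
  extract a submatrix and to place a block in a larger zero matrix.\<close>

lemma mat_conj_select:
  assumes \<alpha>: "\<alpha> = mat n m (\<lambda>(i, k). if p i \<and> k = h i then 1 else 0)"
    and h: "\<And>i. i < n \<Longrightarrow> p i \<Longrightarrow> h i < m" and A: "A \<in> mats V m" and ij: "i < n" "j < n"
  shows "mat_conj V \<alpha> A $$ (i, j) = (if p i \<and> p j then A $$ (h i, h j) else \<zero>\<^bsub>V\<^esub>)"
proof -
  have \<alpha>': "\<alpha> \<in> carrier_mat n m" by (simp add: \<alpha>)
  have entry: "\<alpha> $$ (i, k) = (if p i \<and> k = h i then 1 else 0)" if "i < n" "k < m" for i k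
    using that by (simp add: \<alpha>)
  show ?thesis
  proof (cases "p i \<and> p j")
    case True
    have "mat_conj V \<alpha> A $$ (i, j) = (\<Oplus>\<^bsub>V\<^esub>q\<in>{..<m} \<times> {..<m}. if (h i, h j) = q then A $$ q else \<zero>\<^bsub>V\<^esub>)"
      unfolding mat_conj_index[OF \<alpha>' A ij]
      using ij A True by (intro finsum_cong') (auto simp: entry split: if_splits)
    also have "\<dots> = A $$ (h i, h j)"
      using ij A True h by (intro add.finprod_singleton) auto
    finally show ?thesis using True by simp
  next
    case False
    have "mat_conj V \<alpha> A $$ (i, j) = (\<Oplus>\<^bsub>V\<^esub>q\<in>{..<m} \<times> {..<m}. \<zero>\<^bsub>V\<^esub>)"
      unfolding mat_conj_index[OF \<alpha>' A ij]
      using ij A False by (intro finsum_cong') (auto simp: entry)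
    then show ?thesis using False by auto
  qed
qed

text \<open>\<open>X1\<close> and \<open>X2\<close> are blocks of \<open>X\<close> at the disjoint
  positions given by \<open>g1\<close> and \<open>g2\<close>, with zeros between them.
  \<open>\<gamma>\<close> carries the columns of \<open>\<alpha>\<close> and \<open>\<beta>\<close>
  at these positions and vanishes at all others, so further rows and columns of \<open>X\<close> may
  be arbitrary.\<close>

lemma mat_conj_embed:
  assumes X: "X \<in> mats V N" and \<alpha>: "\<alpha> \<in> carrier_mat n r" and \<beta>: "\<beta> \<in> carrier_mat n s"
    and X1: "X1 \<in> mats V r" and X2: "X2 \<in> mats V s"
    and g1: "inj_on g1 {..<r}" "g1 ` {..<r} \<subseteq> {..<N}" and g2: "inj_on g2 {..<s}" "g2 ` {..<s} \<subseteq> {..<N}"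
    and disj: "g1 ` {..<r} \<inter> g2 ` {..<s} = {}"
    and X1_eq: "\<And>u v. u < r \<Longrightarrow> v < r \<Longrightarrow> X $$ (g1 u, g1 v) = X1 $$ (u, v)"
    and X2_eq: "\<And>u v. u < s \<Longrightarrow> v < s \<Longrightarrow> X $$ (g2 u, g2 v) = X2 $$ (u, v)"
    and off: "\<And>u v. u < r \<Longrightarrow> v < s \<Longrightarrow> X $$ (g1 u, g2 v) = \<zero>\<^bsub>V\<^esub>"
      "\<And>u v. u < r \<Longrightarrow> v < s \<Longrightarrow> X $$ (g2 v, g1 u) = \<zero>\<^bsub>V\<^esub>"
  shows "\<exists>\<gamma>\<in>carrier_mat n N. mat_conj V \<gamma> X = mat_add V (mat_conj V \<alpha> X1) (mat_conj V \<beta> X2)"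
proof -
  define \<gamma> where "\<gamma> = mat n N (\<lambda>(i, w). if w \<in> g1 ` {..<r} then \<alpha> $$ (i, inv_into {..<r} g1 w)
    else if w \<in> g2 ` {..<s} then \<beta> $$ (i, inv_into {..<s} g2 w) else 0)"
  have \<gamma>: "\<gamma> \<in> carrier_mat n N" by (simp add: \<gamma>_def)
  have \<gamma>1: "\<gamma> $$ (i, g1 u) = \<alpha> $$ (i, u)" if "i < n" "u < r" for i u
    using that g1 by (auto simp: \<gamma>_def)
  have \<gamma>2: "\<gamma> $$ (i, g2 u) = \<beta> $$ (i, u)" if "i < n" "u < s" for i u
  proof -
    have "g2 u \<notin> g1 ` {..<r}" "g2 u \<in> g2 ` {..<s}" using disj that by auto
    then show ?thesis using that g2 by (auto simp: \<gamma>_def)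
  qed
  have \<gamma>0: "\<gamma> $$ (i, w) = 0" if "i < n" "w < N" "w \<notin> g1 ` {..<r}" "w \<notin> g2 ` {..<s}" for i w
    using that by (simp add: \<gamma>_def)
  have "mat_conj V \<gamma> X = mat_add V (mat_conj V \<alpha> X1) (mat_conj V \<beta> X2)"
  proof (rule mats_eqI)
    note C1 = mat_conj_mats[OF \<alpha> X1] and C2 = mat_conj_mats[OF \<beta> X2]
    show "mat_add V (mat_conj V \<alpha> X1) (mat_conj V \<beta> X2) \<in> mats V n" using C1 C2 by (rule mat_add_mats)
    fix i j assume ij: "i < n" "j < n"
    let ?F = "\<lambda>w. (\<gamma> $$ (i, fst w) * cnj (\<gamma> $$ (j, snd w))) \<odot>\<^bsub>V\<^esub> X $$ w"
    let ?U = "g1 ` {..<r} \<times> g1 ` {..<r}" and ?W = "g2 ` {..<s} \<times> g2 ` {..<s}"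
    have F: "?F w \<in> carrier V" if "w \<in> {..<N} \<times> {..<N}" for w
      using that X by auto
    have sub: "?U \<union> ?W \<subseteq> {..<N} \<times> {..<N}" using g1 g2 by auto
    have "mat_conj V \<gamma> X $$ (i, j) = (\<Oplus>\<^bsub>V\<^esub>w\<in>{..<N} \<times> {..<N}. ?F w)"
      by (rule mat_conj_index[OF \<gamma> X ij])
    also have "\<dots> = (\<Oplus>\<^bsub>V\<^esub>w\<in>?U \<union> ?W. ?F w)"
    proof (rule add.finprod_mono_neutral_cong_right)
      fix w assume w: "w \<in> {..<N} \<times> {..<N} - (?U \<union> ?W)"
      obtain a b where ab: "w = (a, b)" "a < N" "b < N" using w by auto
      have XX: "X $$ (a, b) \<in> carrier V" using X ab by auto
      \<comment> \<open>Outside the two diagonal blocks either \<open>\<gamma>\<close> vanishes at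
        one of the indices, or the entry of \<open>X\<close> lies between the two blocks.\<close>
      consider "a \<notin> g1 ` {..<r}" "a \<notin> g2 ` {..<s}" | "b \<notin> g1 ` {..<r}" "b \<notin> g2 ` {..<s}"
        | "a \<in> g1 ` {..<r}" "b \<in> g2 ` {..<s}" | "a \<in> g2 ` {..<s}" "b \<in> g1 ` {..<r}"
        using w ab by auto
      then show "?F w = \<zero>\<^bsub>V\<^esub>"
        using \<gamma>0[OF ij(1) ab(2)] \<gamma>0[OF ij(2) ab(3)] XX off ab(1) by cases auto
    qed (use sub F in auto)
    also have "\<dots> = (\<Oplus>\<^bsub>V\<^esub>w\<in>?U. ?F w) \<oplus>\<^bsub>V\<^esub> (\<Oplus>\<^bsub>V\<^esub>w\<in>?W. ?F w)"
    proof (rule finsum_Un_disjoint)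
      show "?F \<in> ?U \<rightarrow> carrier V" "?F \<in> ?W \<rightarrow> carrier V" using F sub by blast+
    qed (use disj in auto)
    also have "(\<Oplus>\<^bsub>V\<^esub>w\<in>?U. ?F w) = mat_conj V \<alpha> X1 $$ (i, j)"
    proof -
      have img: "?U = map_prod g1 g1 ` ({..<r} \<times> {..<r})" by auto
      have "(\<Oplus>\<^bsub>V\<^esub>w\<in>?U. ?F w) = (\<Oplus>\<^bsub>V\<^esub>w\<in>{..<r} \<times> {..<r}. ?F (map_prod g1 g1 w))"
        unfolding img
      proof (rule finsum_reindex)
        show "inj_on (map_prod g1 g1) ({..<r} \<times> {..<r})" using g1(1) by (auto simp: inj_on_def)
        show "?F \<in> map_prod g1 g1 ` ({..<r} \<times> {..<r}) \<rightarrow> carrier V"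
          using F sub unfolding img[symmetric] by blast
      qed
      also have "\<dots> = mat_conj V \<alpha> X1 $$ (i, j)"
        unfolding mat_conj_index[OF \<alpha> X1 ij]
        using ij X1 by (intro finsum_cong') (auto simp: \<gamma>1 X1_eq)
      finally show ?thesis .
    qed
    also have "(\<Oplus>\<^bsub>V\<^esub>w\<in>?W. ?F w) = mat_conj V \<beta> X2 $$ (i, j)"
    proof -
      have img: "?W = map_prod g2 g2 ` ({..<s} \<times> {..<s})" by auto
      have "(\<Oplus>\<^bsub>V\<^esub>w\<in>?W. ?F w) = (\<Oplus>\<^bsub>V\<^esub>w\<in>{..<s} \<times> {..<s}. ?F (map_prod g2 g2 w))"
        unfolding img
      proof (rule finsum_reindex)
        show "inj_on (map_prod g2 g2) ({..<s} \<times> {..<s})" using g2(1) by (auto simp: inj_on_def)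
        show "?F \<in> map_prod g2 g2 ` ({..<s} \<times> {..<s}) \<rightarrow> carrier V"
          using F sub unfolding img[symmetric] by blast
      qed
      also have "\<dots> = mat_conj V \<beta> X2 $$ (i, j)"
        unfolding mat_conj_index[OF \<beta> X2 ij]
        using ij X2 by (intro finsum_cong') (auto simp: \<gamma>2 X2_eq)
      finally show ?thesis .
    qed
    finally show "mat_conj V \<gamma> X $$ (i, j) = mat_add V (mat_conj V \<alpha> X1) (mat_conj V \<beta> X2) $$ (i, j)"
      by (simp only: mat_index(2)[OF ij C1])
  qed (rule mat_conj_mats[OF \<gamma> X])
  with \<gamma> show ?thesis by blast
qed

definition block_sum :: "nat \<Rightarrow> 'a mat \<Rightarrow> nat \<Rightarrow> 'a mat \<Rightarrow> 'a mat" where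
  "block_sum k C l D = mat (k + l) (k + l) (\<lambda>(i, j). if i < k \<and> j < k then C $$ (i, j)
     else if \<not> i < k \<and> \<not> j < k then D $$ (i - k, j - k) else \<zero>\<^bsub>V\<^esub>)"

end

text \<open>Each block, padded with zeros, is a compression by a coordinate inclusion, and the block
  sum is the sum of the two.\<close>

lemma (in matrix_ordered_space) block_sum_mpos:
  assumes C: "C \<in> mpos V k" "k > 0" and D: "D \<in> mpos V l" "l > 0"
  shows "block_sum k C l D \<in> mpos V (k + l)"
proof -
  define \<alpha> :: "complex mat" where "\<alpha> = mat (k + l) k (\<lambda>(i, j). if i < k \<and> j = i then 1 else 0)"
  define \<beta> :: "complex mat" where "\<beta> = mat (k + l) l (\<lambda>(i, j). if \<not> i < k \<and> j = i - k then 1 else 0)"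
  have \<alpha>c: "\<alpha> \<in> carrier_mat (k + l) k" and \<beta>c: "\<beta> \<in> carrier_mat (k + l) l" by (simp_all add: \<alpha>_def \<beta>_def)
  note Cm = mpos_mats[OF C(2,1)] and Dm = mpos_mats[OF D(2,1)]
  note aC = mat_conj_mats[OF \<alpha>c Cm] and bD = mat_conj_mats[OF \<beta>c Dm]
  have "block_sum k C l D = mat_add V (mat_conj V \<alpha> C) (mat_conj V \<beta> D)"
  proof (rule mats_eqI[of _ "k + l"])
    show "block_sum k C l D \<in> mats V (k + l)"
      unfolding block_sum_def
    proof (rule mat_mem_mats)
      fix i j assume "i < k + l" "j < k + l"
      then show "(case (i, j) of (i, j) \<Rightarrow> if i < k \<and> j < k then C $$ (i, j)
        else if \<not> i < k \<and> \<not> j < k then D $$ (i - k, j - k) else \<zero>\<^bsub>V\<^esub>) \<in> carrier V"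
        using mats_closed[OF _ _ Cm, of i j] mats_closed[OF _ _ Dm, of "i - k" "j - k"] by auto
    qed
    show "mat_add V (mat_conj V \<alpha> C) (mat_conj V \<beta> D) \<in> mats V (k + l)" using aC bD by auto
    fix i j assume ij: "i < k + l" "j < k + l"
    have a: "mat_conj V \<alpha> C $$ (i, j) = (if i < k \<and> j < k then C $$ (i, j) else \<zero>\<^bsub>V\<^esub>)"
      by (rule mat_conj_select[OF \<alpha>_def _ Cm ij])
    have b: "mat_conj V \<beta> D $$ (i, j) = (if \<not> i < k \<and> \<not> j < k then D $$ (i - k, j - k) else \<zero>\<^bsub>V\<^esub>)"
      by (rule mat_conj_select[OF \<beta>_def _ Dm ij]) auto
    have "i < k \<Longrightarrow> j < k \<Longrightarrow> C $$ (i, j) \<in> carrier V" "\<not> i < k \<Longrightarrow> \<not> j < k \<Longrightarrow> D $$ (i - k, j - k) \<in> carrier V"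
      using mats_closed[OF _ _ Cm, of i j] mats_closed[OF _ _ Dm, of "i - k" "j - k"] ij by simp_all
    then show "block_sum k C l D $$ (i, j) = mat_add V (mat_conj V \<alpha> C) (mat_conj V \<beta> D) $$ (i, j)"
      unfolding mat_index(2)[OF ij aC] a b using ij by (auto simp: block_sum_def)
  qed
  then show ?thesis
    using C D mpos_conj[OF _ C(2) \<alpha>c C(1)] mpos_conj[OF _ D(2) \<beta>c D(1)] mpos_add by simp
qed

section \<open>The maximal tensor product\<close>

lemma max_tensor_eq_archimedeanization:
  "max_tensor S T = archimedeanization (alg_tensor S T) (pure_tensor S T (ounit S) (ounit T)) (P_max S T)"
  by (simp add: max_tensor_def archimedeanization_def)

context tensor_pair
begin

lemma mat_tensor_index:
  assumes "C \<in> mats S k" "D \<in> mats T m" "i < k * m" "j < k * m"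
  shows "mat_tensor S T C D $$ (i, j) = pure (C $$ (i div m, j div m)) (D $$ (i mod m, j mod m))"
  using assms S.mats_dim[OF assms(1)] T.mats_dim[OF assms(2)] by (simp add: mat_tensor_def Let_def)

lemma mat_tensor_entries:
  assumes "C \<in> mats S k" "D \<in> mats T m" "i < k * m" "j < k * m"
  shows "C $$ (i div m, j div m) \<in> carrier S" "D $$ (i mod m, j mod m) \<in> carrier T"
proof -
  have "m > 0" using assms(3) by (cases m) auto
  then show "C $$ (i div m, j div m) \<in> carrier S" "D $$ (i mod m, j mod m) \<in> carrier T"
    using assms by (auto intro!: S.mats_closed[OF _ _ assms(1)] T.mats_closed[OF _ _ assms(2)] less_mult_imp_div_less)
qed

lemma mat_tensor_mats:
  assumes "C \<in> mats S k" "D \<in> mats T m"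
  shows "mat_tensor S T C D \<in> mats A (k * m)"
  using S.mats_dim[OF assms(1)] T.mats_dim[OF assms(2)] mat_tensor_entries[OF assms]
  by (intro A.mats_memI) (auto simp: mat_tensor_index[OF assms], auto simp: mat_tensor_def Let_def)

end

section \<open>The cones of the maximal tensor product before closure\<close>

locale op_sys_pair = S: operator_system S + T: operator_system T
  for S :: "'a op_sys" and T :: "'b op_sys"
begin

sublocale tensor_pair S T
  by unfold_locales

abbreviation unit :: "('a, 'b) tensor" where
  "unit \<equiv> pure (ounit S) (ounit T)"

lemma unit_carrier [simp]: "unit \<in> carrier A"
  by (intro pure_carrier S.ounit_closed T.ounit_closed)

lemma P_maxI:
  "n > 0 \<Longrightarrow> k > 0 \<Longrightarrow> m > 0 \<Longrightarrow> C \<in> mpos S k \<Longrightarrow> D \<in> mpos T m \<Longrightarrow> \<alpha> \<in> carrier_mat n (k * m) \<Longrightarrow>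
    mat_conj A \<alpha> (mat_tensor S T C D) \<in> P_max S T n"
  unfolding P_max_def by blast

lemma P_maxE:
  assumes "X \<in> P_max S T n"
  obtains \<alpha> C D k m where "k > 0" "m > 0" "C \<in> mpos S k" "D \<in> mpos T m" "\<alpha> \<in> carrier_mat n (k * m)"
    "C \<in> mats S k" "D \<in> mats T m" "X = mat_conj A \<alpha> (mat_tensor S T C D)"
proof -
  obtain \<alpha> C D k m where *: "k > 0" "m > 0" "C \<in> mpos S k" "D \<in> mpos T m" "\<alpha> \<in> carrier_mat n (k * m)"
    "X = mat_conj A \<alpha> (mat_tensor S T C D)"
    using assms unfolding P_max_def by blast
  show ?thesis
    using that[OF *(1-5) S.mpos_mats[OF *(1,3)] T.mpos_mats[OF *(2,4)] *(6)] .
qed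

lemma mat_tensor_mpos_P_max:
  assumes "k > 0" "m > 0" "C \<in> mpos S k" "D \<in> mpos T m"
  shows "mat_tensor S T C D \<in> P_max S T (k * m)"
proof -
  note M = mat_tensor_mats[OF S.mpos_mats[OF assms(1,3)] T.mpos_mats[OF assms(2,4)]]
  show ?thesis
    using P_maxI[OF _ assms, of "k * m" "1\<^sub>m (k * m)"] assms(1,2) A.mat_conj_one[OF M] by simp
qed

lemma S_unit_mpos: "mat 1 1 (\<lambda>_. ounit S) \<in> mpos S 1"
  using S.positive_ounit by (simp add: S.positive_def)

lemma unit_tensor_P_max:
  assumes n: "n > 0" and D: "D \<in> mpos T n"
  shows "mat n n (\<lambda>p. pure (ounit S) (D $$ p)) \<in> P_max S T n"
proof -
  have "mat_tensor S T (mat 1 1 (\<lambda>_. ounit S)) D = mat n n (\<lambda>p. pure (ounit S) (D $$ p))"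
    using T.mats_dim[OF T.mpos_mats[OF n D]] by (intro eq_matI) (auto simp: mat_tensor_def Let_def)
  then show ?thesis
    using mat_tensor_mpos_P_max[OF S.one_pos_nat n S_unit_mpos D] by simp
qed

lemma unit_P_max:
  assumes n: "n > 0" and r: "r \<ge> 0"
  shows "scalar_mat A n r unit \<in> P_max S T n"
proof -
  note d = T.mat_diag_const_mats[OF T.ounit_closed, of n]
  have "scalar_mat A n r unit =
    mat n n (\<lambda>p. pure (ounit S) (scalar_mat T n r (ounit T) $$ p))"
  proof (rule eq_matI)
    fix i j assume "i < dim_row (mat n n (\<lambda>p. pure (ounit S) (scalar_mat T n r (ounit T) $$ p)))"
      "j < dim_col (mat n n (\<lambda>p. pure (ounit S) (scalar_mat T n r (ounit T) $$ p)))"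
    then have ij: "i < n" "j < n" by auto
    show "scalar_mat A n r unit $$ (i, j) =
      mat n n (\<lambda>p. pure (ounit S) (scalar_mat T n r (ounit T) $$ p)) $$ (i, j)"
      unfolding A.mat_index(4)[OF ij A.mat_diag_const_mats[OF unit_carrier]] index_mat(1)[OF ij] T.mat_index(4)[OF ij d]
      using ij S.ounit_closed T.ounit_closed by (simp add: pure_smult_right)
  qed (simp_all add: mat_scale_def mat_diag_const_def)
  then show ?thesis using unit_tensor_P_max[OF n T.mat_unit_mpos[OF n r]] by simp
qed

lemma P_max_herm: "P_max S T n \<subseteq> herm_mats A n"
proof
  fix X assume "X \<in> P_max S T n"
  then obtain \<alpha> C D k m where X: "k > 0" "m > 0" "C \<in> mpos S k" "D \<in> mpos T m" "\<alpha> \<in> carrier_mat n (k * m)"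
    "C \<in> mats S k" "D \<in> mats T m" "X = mat_conj A \<alpha> (mat_tensor S T C D)" by (rule P_maxE)
  have "mat_tensor S T C D \<in> herm_mats A (k * m)"
  proof (rule A.herm_matsI[OF mat_tensor_mats[OF X(6,7)]])
    fix i j assume ij: "i < k * m" "j < k * m"
    have "C \<in> herm_mats S k" "D \<in> herm_mats T m" using S.mpos_herm T.mpos_herm X by auto
    then show "invol A (mat_tensor S T C D $$ (j, i)) = mat_tensor S T C D $$ (i, j)"
      unfolding mat_tensor_index[OF X(6,7) ij] mat_tensor_index[OF X(6,7) ij(2,1)] invol_pure
      using ij X(2) by (simp add: S.herm_mats_index T.herm_mats_index less_mult_imp_div_less)
  qed
  then show "X \<in> herm_mats A n" using A.mat_conj_herm[OF X(5)] X(8) by simp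
qed

lemma P_max_scale:
  assumes n: "n > 0" and X: "X \<in> P_max S T n" and r: "(r::real) \<ge> 0"
  shows "mat_scale A (complex_of_real r) X \<in> P_max S T n"
proof -
  obtain \<alpha> C D k m where X: "k > 0" "m > 0" "C \<in> mpos S k" "D \<in> mpos T m" "\<alpha> \<in> carrier_mat n (k * m)"
    "C \<in> mats S k" "D \<in> mats T m" "X = mat_conj A \<alpha> (mat_tensor S T C D)" using X by (rule P_maxE)
  note M = mat_tensor_mats[OF X(6,7)] and rC = S.mat_scale_mats[OF X(6), of "complex_of_real r"]
  have "mat_scale A (complex_of_real r) (mat_tensor S T C D) = mat_tensor S T (mat_scale S (complex_of_real r) C) D"
  proof (rule A.mats_eqI[OF A.mat_scale_mats[OF M] mat_tensor_mats[OF rC X(7)]])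
    fix i j assume ij: "i < k * m" "j < k * m"
    have "i div m < k" "j div m < k" using ij by (auto intro: less_mult_imp_div_less)
    then show "mat_scale A (complex_of_real r) (mat_tensor S T C D) $$ (i, j) =
      mat_tensor S T (mat_scale S (complex_of_real r) C) D $$ (i, j)"
      unfolding A.mat_index(4)[OF ij M] mat_tensor_index[OF X(6,7) ij] mat_tensor_index[OF rC X(7) ij]
      using mat_tensor_entries[OF X(6,7) ij] X(6) by (simp add: pure_smult_left)
  qed
  then have "mat_scale A (complex_of_real r) X = mat_conj A \<alpha> (mat_tensor S T (mat_scale S (complex_of_real r) C) D)"
    by (simp only: X(8) A.mat_conj_scale[OF X(5) M, symmetric])
  then show ?thesis
    using P_maxI[OF n X(1,2) S.mpos_scale[OF X(1,3) r] X(4,5)] by simp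
qed

lemma P_max_conj:
  assumes n: "n > 0" and \<beta>: "\<beta> \<in> carrier_mat n l" and X: "X \<in> P_max S T l"
  shows "mat_conj A \<beta> X \<in> P_max S T n"
proof -
  obtain \<alpha> C D k m where X: "k > 0" "m > 0" "C \<in> mpos S k" "D \<in> mpos T m" "\<alpha> \<in> carrier_mat l (k * m)"
    "C \<in> mats S k" "D \<in> mats T m" "X = mat_conj A \<alpha> (mat_tensor S T C D)" using X by (rule P_maxE)
  show ?thesis
    unfolding X(8) A.mat_conj_conj[OF \<beta> X(5) mat_tensor_mats[OF X(6,7)]]
    using P_maxI[OF n X(1-4) mult_carrier_mat[OF \<beta> X(5)]] .
qed

text \<open>A sum of two elements is compressed from the tensor product of the block sums; the off-diagonal
  blocks that occur have a zero entry in one of the two factors.\<close>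

lemma P_max_add:
  assumes n: "n > 0" and X: "X \<in> P_max S T n" and Y: "Y \<in> P_max S T n"
  shows "mat_add A X Y \<in> P_max S T n"
proof -
  obtain \<alpha> C D k m where X: "k > 0" "m > 0" "C \<in> mpos S k" "D \<in> mpos T m" "\<alpha> \<in> carrier_mat n (k * m)"
    "C \<in> mats S k" "D \<in> mats T m" "X = mat_conj A \<alpha> (mat_tensor S T C D)" using X by (rule P_maxE)
  obtain \<beta> C' D' k' m' where Y: "k' > 0" "m' > 0" "C' \<in> mpos S k'" "D' \<in> mpos T m'" "\<beta> \<in> carrier_mat n (k' * m')"
    "C' \<in> mats S k'" "D' \<in> mats T m'" "Y = mat_conj A \<beta> (mat_tensor S T C' D')" using Y by (rule P_maxE)
  let ?K = "k + k'" and ?M = "m + m'"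
  define C2 where "C2 = S.block_sum k C k' C'"
  define D2 where "D2 = T.block_sum m D m' D'"
  have C2: "C2 \<in> mpos S ?K" and D2: "D2 \<in> mpos T ?M"
    unfolding C2_def D2_def using X Y by (auto intro!: S.block_sum_mpos T.block_sum_mpos)
  have C2m: "C2 \<in> mats S ?K" and D2m: "D2 \<in> mats T ?M"
    using S.mpos_mats[OF _ C2] T.mpos_mats[OF _ D2] X(1,2) by auto
  \<comment> \<open>The pair \<open>(u div m, u mod m)\<close> encoded anew for a second factor of
    size \<open>m + m'\<close>. In \<open>g2\<close> both components are first shifted past the
    blocks \<open>C\<close> and \<open>D\<close>.\<close>
  define g1 where "g1 u = (u div m) * ?M + u mod m" for u
  define g2 where "g2 u = (k + u div m') * ?M + (m + u mod m')" for u
  have g1: "g1 u div ?M = u div m" "g1 u mod ?M = u mod m" for u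
    using X(2) mod_less_divisor[OF X(2), of u] unfolding g1_def by (simp_all add: trans_less_add1)
  have g2: "g2 u div ?M = k + u div m'" "g2 u mod ?M = m + u mod m'" for u
    using Y(2) mod_less_divisor[OF Y(2), of u] unfolding g2_def by simp_all
  have dk: "u div m < k" if "u < k * m" for u using that by (rule less_mult_imp_div_less)
  have dk': "u div m' < k'" if "u < k' * m'" for u using that by (rule less_mult_imp_div_less)
  have mm: "u mod m < m" "u mod m' < m'" for u using X(2) Y(2) by auto
  have lt: "g < ?K * ?M" if "g div ?M < ?K" for g
    using that X(2) by (metis add_gr_0 div_less_iff_less_mult)
  have g1N: "g1 u < ?K * ?M" if "u < k * m" for u
    using dk[OF that] by (intro lt) (simp add: g1)
  have g2N: "g2 u < ?K * ?M" if "u < k' * m'" for u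
    using dk'[OF that] by (intro lt) (simp add: g2)
  have inj1: "inj_on g1 U" for U
    by (rule inj_onI) (metis g1 div_mult_mod_eq)
  have inj2: "inj_on g2 U" for U
    by (rule inj_onI) (metis g2 div_mult_mod_eq add_left_cancel)
  have "\<exists>\<gamma>\<in>carrier_mat n (?K * ?M). mat_conj A \<gamma> (mat_tensor S T C2 D2) =
    mat_add A (mat_conj A \<alpha> (mat_tensor S T C D)) (mat_conj A \<beta> (mat_tensor S T C' D'))"
  proof (rule A.mat_conj_embed[OF mat_tensor_mats[OF C2m D2m] X(5) Y(5) mat_tensor_mats[OF X(6,7)]
        mat_tensor_mats[OF Y(6,7)] inj1 _ inj2])
    show "g1 ` {..<k * m} \<subseteq> {..<?K * ?M}" "g2 ` {..<k' * m'} \<subseteq> {..<?K * ?M}"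
      using g1N g2N by auto
    have "g1 u \<noteq> g2 v" for u v
    proof
      assume "g1 u = g2 v"
      then have "g1 u mod ?M = g2 v mod ?M" by simp
      then show False unfolding g1 g2 using mm(1)[of u] by simp
    qed
    then show "g1 ` {..<k * m} \<inter> g2 ` {..<k' * m'} = {}" by auto
    show "mat_tensor S T C2 D2 $$ (g1 u, g1 v) = mat_tensor S T C D $$ (u, v)" if "u < k * m" "v < k * m" for u v
      unfolding mat_tensor_index[OF C2m D2m g1N[OF that(1)] g1N[OF that(2)]] mat_tensor_index[OF X(6,7) that] g1
      using dk that mm by (simp add: C2_def D2_def S.block_sum_def T.block_sum_def trans_less_add1)
    show "mat_tensor S T C2 D2 $$ (g2 u, g2 v) = mat_tensor S T C' D' $$ (u, v)" if "u < k' * m'" "v < k' * m'" for u v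
      unfolding mat_tensor_index[OF C2m D2m g2N[OF that(1)] g2N[OF that(2)]] mat_tensor_index[OF Y(6,7) that] g2
      using dk' that mm by (simp add: C2_def D2_def S.block_sum_def T.block_sum_def)
    show "mat_tensor S T C2 D2 $$ (g1 u, g2 v) = \<zero>\<^bsub>A\<^esub>" if "u < k * m" "v < k' * m'" for u v
    proof -
      note t = mat_tensor_entries(2)[OF C2m D2m g1N[OF that(1)] g2N[OF that(2)]]
      have "C2 $$ (u div m, k + v div m') = \<zero>\<^bsub>S\<^esub>"
        using dk[OF that(1)] dk'[OF that(2)] by (simp add: C2_def S.block_sum_def trans_less_add1)
      then show ?thesis
        using t unfolding mat_tensor_index[OF C2m D2m g1N[OF that(1)] g2N[OF that(2)]] g1 g2 by simp
    qed
    show "mat_tensor S T C2 D2 $$ (g2 v, g1 u) = \<zero>\<^bsub>A\<^esub>" if "u < k * m" "v < k' * m'" for u v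
    proof -
      note t = mat_tensor_entries(2)[OF C2m D2m g2N[OF that(2)] g1N[OF that(1)]]
      have "C2 $$ (k + v div m', u div m) = \<zero>\<^bsub>S\<^esub>"
        using dk[OF that(1)] dk'[OF that(2)] by (simp add: C2_def S.block_sum_def trans_less_add1)
      then show ?thesis
        using t unfolding mat_tensor_index[OF C2m D2m g2N[OF that(2)] g1N[OF that(1)]] g1 g2 by simp
    qed
  qed
  then obtain \<gamma> where \<gamma>: "\<gamma> \<in> carrier_mat n (?K * ?M)" "mat_conj A \<gamma> (mat_tensor S T C2 D2) = mat_add A X Y"
    unfolding X(8) Y(8) by blast
  then show ?thesis
    using P_maxI[OF n _ _ C2 D2 \<gamma>(1)] X(1,2) by simp
qed

text \<open>The entrywise tensor product of norm blocks of \<open>x\<close> and \<open>y\<close> is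
  a norm block of the pure tensor with constant \<open>s * t\<close>, and it is a corner of the full
  tensor product of the two blocks.\<close>

lemma pure_norm_block_P_max:
  assumes x: "x \<in> carrier S" and y: "y \<in> carrier T"
  shows "\<exists>r>0. norm_block A unit r (pure x y) \<in> P_max S T 2"
proof -
  obtain s where s: "s > 0" "norm_block S (ounit S) s x \<in> mpos S 2" using S.norm_block_mpos[OF x] by auto
  obtain t where t: "t > 0" "norm_block T (ounit T) t y \<in> mpos T 2" using T.norm_block_mpos[OF y] by auto
  let ?C = "norm_block S (ounit S) s x" and ?D = "norm_block T (ounit T) t y"
  have two: "(0::nat) < 2" by simp
  note C = S.mpos_mats[OF two s(2)] and D = T.mpos_mats[OF two t(2)]
  note M = mat_tensor_mats[OF C D]
  \<comment> \<open>Selects the index pairs \<open>(0, 0)\<close> and \<open>(1, 1)\<close>, which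
    are encoded as 0 and 3.\<close>
  define h :: "nat \<Rightarrow> nat" where "h i = 3 * i" for i
  define \<delta> :: "complex mat" where "\<delta> = mat 2 (2 * 2) (\<lambda>(i, k). if True \<and> k = h i then 1 else 0)"
  have \<delta>: "\<delta> \<in> carrier_mat 2 (2 * 2)" by (simp add: \<delta>_def)
  have e: "ounit S \<in> carrier S" "ounit T \<in> carrier T" by (rule S.ounit_closed T.ounit_closed)+
  have hh: "h i < 2 * 2" "h i div 2 = i" "h i mod 2 = i" if "i < 2" for i
    using that by (auto simp: h_def less_2_cases_iff)
  have "mat_conj A \<delta> (mat_tensor S T ?C ?D) = norm_block A unit (s * t) (pure x y)"
  proof (rule A.mats_eqI[of _ 2])
    show "mat_conj A \<delta> (mat_tensor S T ?C ?D) \<in> mats A 2" by (rule A.mat_conj_mats[OF \<delta> M])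
    show "norm_block A unit (s * t) (pure x y) \<in> mats A 2"
      unfolding norm_block_def by (rule A.mat_mem_mats) (use x y in \<open>auto simp: A.invol_closed\<close>)
    fix i j :: nat assume ij: "i < 2" "j < 2"
    have "mat_conj A \<delta> (mat_tensor S T ?C ?D) $$ (i, j) = mat_tensor S T ?C ?D $$ (h i, h j)"
      using A.mat_conj_select[OF \<delta>_def _ M ij] hh(1) by simp
    also have "\<dots> = pure (?C $$ (i, j)) (?D $$ (i, j))"
      unfolding mat_tensor_index[OF C D hh(1)[OF ij(1)] hh(1)[OF ij(2)]] hh(2,3)[OF ij(1)] hh(2,3)[OF ij(2)] ..
    also have "\<dots> = norm_block A unit (s * t) (pure x y) $$ (i, j)"
      using ij e x y by (auto simp: norm_block_def pure_smult_left pure_smult_right invol_pure mult.commute)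
    finally show "mat_conj A \<delta> (mat_tensor S T ?C ?D) $$ (i, j) = norm_block A unit (s * t) (pure x y) $$ (i, j)" .
  qed
  then have "norm_block A unit (s * t) (pure x y) \<in> P_max S T 2"
    using P_maxI[OF two two two s(2) t(2) \<delta>] by simp
  then show ?thesis using s(1) t(1) by (intro exI[of _ "s * t"]) auto
qed

text \<open>Norm blocks add up together with their constants, a triangle inequality for the order
  norm; hence pure tensors suffice.\<close>

lemma norm_block_P_max:
  assumes "X \<in> carrier A"
  shows "\<exists>r>0. norm_block A unit r X \<in> P_max S T 2"
  using assms
proof (induction rule: tensor_induct)
  case zero
  have "norm_block A unit 1 \<zero>\<^bsub>A\<^esub> = scalar_mat A 2 1 unit"
    by (intro eq_matI) (auto simp: norm_block_def mat_scale_def mat_diag_const_def)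
  then show ?case using unit_P_max[of 2 1] by (intro exI[of _ 1]) simp
next
  case (add X x y)
  obtain r where r: "r > 0" "norm_block A unit r X \<in> P_max S T 2" using add.IH by auto
  obtain s where s: "s > 0" "norm_block A unit s (pure x y) \<in> P_max S T 2"
    using pure_norm_block_P_max[OF add.hyps(2,3)] by auto
  have xy: "pure x y \<in> carrier A" using add.hyps by auto
  have "mat_add A (norm_block A unit r X) (norm_block A unit s (pure x y)) = norm_block A unit (r + s) (X \<oplus>\<^bsub>A\<^esub> pure x y)"
    using add.hyps(1) xy by (intro eq_matI)
      (auto simp: mat_add_def norm_block_def A.smult_add_left A.invol_add)
  then show ?case
    using P_max_add[OF _ r(2) s(2)] r(1) s(1) by (intro exI[of _ "r + s"]) auto
qed

end

lemma sum_div_mod: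
  fixes k m :: nat
  shows "(\<Sum>u<k * m. f u) = (\<Sum>a<k. \<Sum>p<m. f (a * m + p))"
proof -
  have "(\<Sum>a<k. sum f {a * m..<a * m + m}) = sum f {..<k * m}"
    by (rule sum.nat_group)
  moreover have "sum f {a * m..<a * m + m} = (\<Sum>p<m. f (a * m + p))" for a
    using sum.shift_bounds_nat_ivl[of f 0 "a * m" m] by (simp add: atLeast0LessThan add.commute)
  ultimately show ?thesis by simp
qed

section \<open>Products of states on the algebraic tensor product\<close>

context op_sys_pair
begin

text \<open>The quadratic form of the image of \<open>C \<otimes> D\<close> at \<open>w\<close> is
  the sum of the entries of an entrywise product: one factor is the image of \<open>C\<close> under
  \<open>f\<close>, the other collects the values of the form of the image of \<open>D\<close> on
  the blocks of \<open>w\<close>. Both are positive semidefinite.\<close>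

lemma state_map_P_max:
  assumes f: "ucp S complex_sys f" and g: "ucp T complex_sys g"
    and F: "linear_map A complex_star F" "\<And>x y. x \<in> carrier S \<Longrightarrow> y \<in> carrier T \<Longrightarrow> F (pure x y) = f x * g y"
    and X: "X \<in> P_max S T n"
  shows "map_mat F X \<in> psd n"
proof -
  interpret F: star_linear_map A complex_star F by unfold_locales (fact F(1))
  obtain \<alpha> C D k m where X: "k > 0" "m > 0" "C \<in> mpos S k" "D \<in> mpos T m" "\<alpha> \<in> carrier_mat n (k * m)"
    "C \<in> mats S k" "D \<in> mats T m" "X = mat_conj A \<alpha> (mat_tensor S T C D)" using X by (rule P_maxE)
  note M = mat_tensor_mats[OF X(6,7)]
  have G: "psd_form k (\<lambda>a b. f (C $$ (a, b)))"
    using ucp_complex_qform_nonneg[OF f X(1,3)] S.mats_dim[OF X(6)]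
    by (simp add: psd_form_def qform_def)
  have "0 \<le> qform (k * m) w (map_mat F (mat_tensor S T C D))" for w
  proof -
    \<comment> \<open>The sesquilinear form of the image of \<open>D\<close> between the blocks
      \<open>a\<close> and \<open>b\<close> of \<open>w\<close>. Its own form at \<open>z\<close> is
      that of the image of \<open>D\<close> at the combination of the blocks with coefficients
      \<open>z\<close>.\<close>
    define H where "H a b = (\<Sum>p<m. \<Sum>q<m. w (a * m + p) * cnj (w (b * m + q)) * g (D $$ (p, q)))" for a b
    have "psd_form k H"
      unfolding psd_form_def
    proof
      fix z :: "nat \<Rightarrow> complex"
      have "(\<Sum>a<k. \<Sum>b<k. z a * cnj (z b) * H a b) =
        (\<Sum>a<k. \<Sum>b<k. \<Sum>p<m. \<Sum>q<m. (z a * w (a * m + p)) * cnj (z b * w (b * m + q)) * g (D $$ (p, q)))"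
        by (simp add: H_def sum_distrib_left mult_ac)
      also have "\<dots> = (\<Sum>a<k. \<Sum>p<m. \<Sum>b<k. \<Sum>q<m. (z a * w (a * m + p)) * cnj (z b * w (b * m + q)) * g (D $$ (p, q)))"
        by (intro sum.cong refl sum.swap)
      also have "\<dots> = (\<Sum>p<m. \<Sum>a<k. \<Sum>b<k. \<Sum>q<m. (z a * w (a * m + p)) * cnj (z b * w (b * m + q)) * g (D $$ (p, q)))"
        by (rule sum.swap)
      also have "\<dots> = (\<Sum>p<m. \<Sum>a<k. \<Sum>q<m. \<Sum>b<k. (z a * w (a * m + p)) * cnj (z b * w (b * m + q)) * g (D $$ (p, q)))"
        by (intro sum.cong refl sum.swap)
      also have "\<dots> = (\<Sum>p<m. \<Sum>q<m. \<Sum>a<k. \<Sum>b<k. (z a * w (a * m + p)) * cnj (z b * w (b * m + q)) * g (D $$ (p, q)))"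
        by (intro sum.cong refl sum.swap)
      also have "\<dots> = qform m (\<lambda>p. \<Sum>a<k. z a * w (a * m + p)) (map_mat g D)"
        using T.mats_dim[OF X(7)]
        by (simp add: qform_def cnj_sum sum_distrib_left sum_distrib_right mult_ac) (intro sum.cong refl sum.swap)
      finally show "0 \<le> (\<Sum>a<k. \<Sum>b<k. z a * cnj (z b) * H a b)"
        using ucp_complex_qform_nonneg[OF g X(2,4)] by simp
    qed
    from psd_form_sum_product[OF G this]
    have "0 \<le> (\<Sum>a<k. \<Sum>b<k. f (C $$ (a, b)) * H a b)" .
    also have "(\<Sum>a<k. \<Sum>b<k. f (C $$ (a, b)) * H a b) =
      (\<Sum>a<k. \<Sum>b<k. \<Sum>p<m. \<Sum>q<m. w (a * m + p) * cnj (w (b * m + q)) * (f (C $$ (a, b)) * g (D $$ (p, q))))"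
      by (simp add: H_def sum_distrib_left mult_ac)
    also have "\<dots> = (\<Sum>a<k. \<Sum>p<m. \<Sum>b<k. \<Sum>q<m. w (a * m + p) * cnj (w (b * m + q)) * (f (C $$ (a, b)) * g (D $$ (p, q))))"
      by (intro sum.cong refl sum.swap)
    also have "\<dots> = (\<Sum>a<k. \<Sum>p<m. \<Sum>b<k. \<Sum>q<m. w (a * m + p) * cnj (w (b * m + q)) *
        map_mat F (mat_tensor S T C D) $$ (a * m + p, b * m + q))"
    proof (intro sum.cong refl)
      fix a p b q assume "a \<in> {..<k}" "p \<in> {..<m}" "b \<in> {..<k}" "q \<in> {..<m}"
      then have ab: "a < k" "p < m" "b < k" "q < m" by auto
      have idx: "c * m + r < k * m" if "c < k" "r < m" for c r
      proof -
        have "c * m + r < c * m + m" using that by simp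
        also have "\<dots> = Suc c * m" by simp
        also have "\<dots> \<le> k * m" using that by (intro mult_right_mono) auto
        finally show ?thesis .
      qed
      have "map_mat F (mat_tensor S T C D) $$ (a * m + p, b * m + q) = f (C $$ (a, b)) * g (D $$ (p, q))"
        unfolding F.map_mat_index[OF idx[OF ab(1,2)] idx[OF ab(3,4)] M]
          mat_tensor_index[OF X(6,7) idx[OF ab(1,2)] idx[OF ab(3,4)]]
        using ab F(2) S.mats_closed[OF ab(1,3) X(6)] T.mats_closed[OF ab(2,4) X(7)] by simp
      then show "w (a * m + p) * cnj (w (b * m + q)) * (f (C $$ (a, b)) * g (D $$ (p, q))) =
        w (a * m + p) * cnj (w (b * m + q)) * map_mat F (mat_tensor S T C D) $$ (a * m + p, b * m + q)" by simp
    qed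
    also have "\<dots> = qform (k * m) w (map_mat F (mat_tensor S T C D))"
      by (simp only: qform_def sum_div_mod)
    finally show ?thesis .
  qed
  then have "0 \<le> qform n v (map_mat F X)" for v
    unfolding X(8) F.map_mat_conj[OF X(5) M] qform_conj[OF X(5)] .
  moreover have "map_mat F X \<in> carrier_mat n n"
    using F.map_mat_mats[OF A.mat_conj_mats[OF X(5) M]] X(8) by simp
  ultimately show ?thesis by (simp add: psd_def)
qed

lemma product_functional_exists:
  assumes f: "linear_map S complex_sys f" and g: "linear_map T complex_sys g"
  shows "\<exists>F. linear_map A complex_star F \<and> (\<forall>x\<in>carrier S. \<forall>y\<in>carrier T. F (pure x y) = f x * g y)"
  using linear_mapD(2,3)[OF f] linear_mapD(2,3)[OF g]
  by (intro tensor_lift_exists complex_star.star_vector_space_axioms) (simp_all add: algebra_simps)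

text \<open>Lists instead of tensors, since separation is proved by induction on the number of
  summands.\<close>

definition tensor_list :: "('a \<times> 'b) list \<Rightarrow> ('a, 'b) tensor" where
  "tensor_list xs = foldr (\<lambda>p X. pure (fst p) (snd p) \<oplus>\<^bsub>A\<^esub> X) xs \<zero>\<^bsub>A\<^esub>"

text \<open>The slice map \<open>f \<otimes> id\<close>, evaluated on a given list of
  summands.\<close>

definition slice :: "('a \<Rightarrow> complex) \<Rightarrow> ('a \<times> 'b) list \<Rightarrow> 'b" where
  "slice f xs = foldr (\<lambda>p Y. f (fst p) \<odot>\<^bsub>T\<^esub> snd p \<oplus>\<^bsub>T\<^esub> Y) xs \<zero>\<^bsub>T\<^esub>"

lemma tensor_list_simps [simp]:
  "tensor_list [] = \<zero>\<^bsub>A\<^esub>" "tensor_list (p # xs) = pure (fst p) (snd p) \<oplus>\<^bsub>A\<^esub> tensor_list xs"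
  "slice f [] = \<zero>\<^bsub>T\<^esub>" "slice f (p # xs) = f (fst p) \<odot>\<^bsub>T\<^esub> snd p \<oplus>\<^bsub>T\<^esub> slice f xs"
  by (simp_all add: tensor_list_def slice_def)

lemma tensor_list_carrier: "set xs \<subseteq> carrier S \<times> carrier T \<Longrightarrow> tensor_list xs \<in> carrier A"
  by (induction xs) auto

lemma slice_carrier: "set xs \<subseteq> carrier S \<times> carrier T \<Longrightarrow> slice f xs \<in> carrier T"
  by (induction xs) auto

lemma tensor_list_exists:
  assumes "X \<in> carrier A"
  shows "\<exists>xs. set xs \<subseteq> carrier S \<times> carrier T \<and> X = tensor_list xs"
  using assms
proof (induction rule: tensor_induct)
  case zero
  show ?case by (intro exI[of _ "[]"]) simp
next
  case (add X x y)
  then obtain xs where "set xs \<subseteq> carrier S \<times> carrier T" "X = tensor_list xs" by auto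
  with add show ?case by (intro exI[of _ "(x, y) # xs"]) (auto simp: A.a_comm)
qed

lemma functional_tensor_list:
  assumes F: "linear_map A complex_star F" "\<And>x y. x \<in> carrier S \<Longrightarrow> y \<in> carrier T \<Longrightarrow> F (pure x y) = f x * g y"
    and g: "ucp T complex_sys g" and us: "set us \<subseteq> carrier S \<times> carrier T"
  shows "F (tensor_list us) = g (slice f us)"
proof -
  interpret F: star_linear_map A complex_star F by unfold_locales (fact F(1))
  interpret g: star_linear_map T complex_sys g
    by (rule ucp_star_linear_map[OF T.operator_system_axioms operator_system_complex g])
  show ?thesis
    using us
  proof (induction us)
    case Nil
    show ?case using F.map_zero g.map_zero by simp
  next
    case (Cons u us)
    then show ?case
      using F(2) slice_carrier[of us f] tensor_list_carrier[of us]
      by (auto simp: F.map_add g.map_add g.map_smult)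
  qed
qed

text \<open>Induction on the length of \<open>\<Sum> x\<^sub>i \<otimes> y\<^sub>i\<close>: if \<open>f x\<^sub>0 \<noteq> 0\<close> for some state \<open>f\<close>, then
  the slice along \<open>f\<close> vanishes, which expresses \<open>y\<^sub>0\<close> by the other \<open>y\<^sub>i\<close>.\<close>

lemma tensor_list_eq_zero:
  assumes "set xs \<subseteq> carrier S \<times> carrier T"
    and "\<And>f g. ucp S complex_sys f \<Longrightarrow> ucp T complex_sys g \<Longrightarrow> g (slice f xs) = 0"
  shows "tensor_list xs = \<zero>\<^bsub>A\<^esub>"
  using assms
proof (induction "length xs" arbitrary: xs rule: less_induct)
  case less
  show ?case
  proof (cases xs)
    case Nil
    then show ?thesis by simp
  next
    case (Cons p ys)
    obtain x y where p: "p = (x, y)" by (cases p)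
    have xy: "x \<in> carrier S" "y \<in> carrier T" and ys: "set ys \<subseteq> carrier S \<times> carrier T"
      using less.prems(1) Cons p by auto
    note sl = slice_carrier[OF ys]
    show ?thesis
    proof (cases "x = \<zero>\<^bsub>S\<^esub>")
      case True
      have "slice f ys = slice f xs" if "ucp S complex_sys f" for f
      proof -
        interpret f: star_linear_map S complex_sys f
          by (rule ucp_star_linear_map[OF S.operator_system_axioms operator_system_complex that])
        show ?thesis using True Cons p xy sl f.map_zero by simp
      qed
      then have "tensor_list ys = \<zero>\<^bsub>A\<^esub>"
        using less.prems(2) Cons ys by (intro less.hyps) auto
      then show ?thesis using True Cons p xy by simp
    next
      case False
      obtain f0 where f0: "ucp S complex_sys f0" "f0 x \<noteq> 0"
        using states_separate[OF S.operator_system_axioms xy(1) False] by auto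
      have "slice f0 xs = \<zero>\<^bsub>T\<^esub>"
      proof (rule ccontr)
        assume "slice f0 xs \<noteq> \<zero>\<^bsub>T\<^esub>"
        then obtain g where "ucp T complex_sys g" "g (slice f0 xs) \<noteq> 0"
          using states_separate[OF T.operator_system_axioms slice_carrier[OF less.prems(1)]] by auto
        then show False using less.prems(2)[OF f0(1)] by simp
      qed
      then have "f0 x \<odot>\<^bsub>T\<^esub> y \<oplus>\<^bsub>T\<^esub> slice f0 ys = \<zero>\<^bsub>T\<^esub>" using Cons p by simp
      then have "f0 x \<odot>\<^bsub>T\<^esub> y = (- 1) \<odot>\<^bsub>T\<^esub> slice f0 ys"
        using xy sl by (metis T.minus_equality T.neg_eq_smult T.smult_closed)
      then have "(1 / f0 x) \<odot>\<^bsub>T\<^esub> (f0 x \<odot>\<^bsub>T\<^esub> y) = (1 / f0 x) \<odot>\<^bsub>T\<^esub> ((- 1) \<odot>\<^bsub>T\<^esub> slice f0 ys)" by simp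
      then have y: "y = (- 1 / f0 x) \<odot>\<^bsub>T\<^esub> slice f0 ys" using xy sl f0(2) by simp
      define c where "c = - 1 / f0 x"
      \<comment> \<open>Substituting \<open>y = c * \<Sum> f0(x_i) y_i\<close> into the first
        summand and distributing it over the others adds \<open>c * f0(x_i) * x\<close> to each
        \<open>x_i\<close>; this saves one summand.\<close>
      define zs where "zs = map (\<lambda>p. (fst p \<oplus>\<^bsub>S\<^esub> (c * f0 (fst p)) \<odot>\<^bsub>S\<^esub> x, snd p)) ys"
      have zs: "set zs \<subseteq> carrier S \<times> carrier T" using ys xy by (auto simp: zs_def)
      have "tensor_list (map (\<lambda>p. (fst p \<oplus>\<^bsub>S\<^esub> (c * f0 (fst p)) \<odot>\<^bsub>S\<^esub> x, snd p)) ys) =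
        pure x (c \<odot>\<^bsub>T\<^esub> slice f0 ys) \<oplus>\<^bsub>A\<^esub> tensor_list ys"
        using ys
      proof (induction ys)
        case (Cons q ys)
        then have q: "fst q \<in> carrier S" "snd q \<in> carrier T" and ys: "set ys \<subseteq> carrier S \<times> carrier T" by auto
        note sl = slice_carrier[OF ys] and tl = tensor_list_carrier[OF ys]
        show ?case
          using Cons.IH[OF ys] q xy sl tl
          by (simp add: pure_add_left pure_smult_left pure_add_right pure_smult_right A.a_ac
            T.smult_add_right A.smult_add_right)
      qed (use xy in simp)
      then have tl: "tensor_list zs = tensor_list xs"
        using y Cons p by (simp add: zs_def c_def)
      \<comment> \<open>The hypothesis concerns lists, but the number \<open>g (slice f us)\<close>
        depends only on the tensor, being its image under the product functional.\<close>
      have "g (slice f zs) = 0" if fg: "ucp S complex_sys f" "ucp T complex_sys g" for f g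
      proof -
        obtain F where F: "linear_map A complex_star F" "\<forall>x\<in>carrier S. \<forall>y\<in>carrier T. F (pure x y) = f x * g y"
          using product_functional_exists[OF ucpD(1)[OF fg(1)] ucpD(1)[OF fg(2)]] by blast
        have Fg: "F (tensor_list us) = g (slice f us)" if "set us \<subseteq> carrier S \<times> carrier T" for us
          using functional_tensor_list[OF F(1) _ fg(2) that] F(2) by blast
        show ?thesis
          using Fg[OF zs] Fg[OF less.prems(1)] less.prems(2)[OF fg] by (simp add: tl)
      qed
      then have "tensor_list zs = \<zero>\<^bsub>A\<^esub>"
        using zs Cons by (intro less.hyps) (auto simp: zs_def)
      then show ?thesis by (simp add: tl)
    qed
  qed
qed

lemma product_states_separate:
  assumes X: "X \<in> carrier A"
    and zero: "\<And>f g F. ucp S complex_sys f \<Longrightarrow> ucp T complex_sys g \<Longrightarrow> linear_map A complex_star F \<Longrightarrow>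
      (\<And>x y. x \<in> carrier S \<Longrightarrow> y \<in> carrier T \<Longrightarrow> F (pure x y) = f x * g y) \<Longrightarrow> F X = 0"
  shows "X = \<zero>\<^bsub>A\<^esub>"
proof -
  obtain xs where xs: "set xs \<subseteq> carrier S \<times> carrier T" "X = tensor_list xs"
    using tensor_list_exists[OF X] by auto
  have "g (slice f xs) = 0" if fg: "ucp S complex_sys f" "ucp T complex_sys g" for f g
  proof -
    obtain F where F: "linear_map A complex_star F" "\<forall>x\<in>carrier S. \<forall>y\<in>carrier T. F (pure x y) = f x * g y"
      using product_functional_exists[OF ucpD(1)[OF fg(1)] ucpD(1)[OF fg(2)]] by blast
    show ?thesis
      using functional_tensor_list[OF F(1) _ fg(2) xs(1), of f] zero[OF fg F(1)] F(2) xs(2) by simp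
  qed
  then show ?thesis using tensor_list_eq_zero[OF xs(1)] xs(2) by simp
qed

lemma archimedeanizable_max: "archimedeanizable A unit (P_max S T)"
proof
  show "unit \<in> carrier A" by simp
  show "invol A unit = unit" by (simp add: invol_pure S.ounit_herm T.ounit_herm)
  show "\<exists>r>0. norm_block A unit r X \<in> P_max S T 2" if "X \<in> carrier A" for X
    using that by (rule norm_block_P_max)
next
  fix n :: nat and X assume n: "n > 0" and X: "X \<in> mats A n"
    and pos: "\<And>r::real. r > 0 \<Longrightarrow> mat_add A (scalar_mat A n r unit) X \<in> P_max S T n"
    and neg: "\<And>r::real. r > 0 \<Longrightarrow> mat_add A (scalar_mat A n r unit) (mat_neg A X) \<in> P_max S T n"
  show "X = mat_zero A n"
  proof (rule A.mats_eqI[OF X A.mat_zero_mats])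
    fix i j assume ij: "i < n" "j < n"
    \<comment> \<open>A product of states maps \<open>X\<close> and its negative to matrices with
      nonnegative forms, so it kills every entry of \<open>X\<close>.\<close>
    have "X $$ (i, j) = \<zero>\<^bsub>A\<^esub>"
    proof (rule product_states_separate[OF A.mats_closed[OF ij X]])
      fix f g F assume fg: "ucp S complex_sys f" "ucp T complex_sys g" and F: "linear_map A complex_star F"
        "\<And>x y. x \<in> carrier S \<Longrightarrow> y \<in> carrier T \<Longrightarrow> F (pure x y) = f x * g y"
      interpret F: star_linear_map A complex_star F by unfold_locales (fact F(1))
      have Fu: "F unit = 1" using F(2)[OF S.ounit_closed T.ounit_closed] ucpD(3)[OF fg(1)] ucpD(3)[OF fg(2)] by simp
      note d = A.mat_diag_const_mats[OF unit_carrier, of n]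
      have im: "map_mat F (mat_add A (scalar_mat A n r unit) Y) =
        mat_add complex_star (scalar_mat complex_star n r 1) (map_mat F Y)"
        if "Y \<in> mats A n" for r Y
        unfolding F.map_mat_add[OF A.mat_scale_mats[OF d] that] F.map_mat_scale[OF d] F.map_mat_diag_const[OF unit_carrier] Fu ..
      note FX = F.map_mat_mats[OF X] and FN = F.map_mat_mats[OF A.mat_neg_mats[OF X]]
      have "0 \<le> qform n v (map_mat F X)" for v
        using state_map_P_max[OF fg F pos] FX by (intro qform_nonneg_of_closure) (simp_all add: im[OF X])
      moreover have "0 \<le> qform n v (map_mat F (mat_neg A X))" for v
        using state_map_P_max[OF fg F neg] FN by (intro qform_nonneg_of_closure) (simp_all add: im[OF A.mat_neg_mats[OF X]])
      ultimately have "qform n v (map_mat F X) = 0" for v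
        using FX unfolding F.map_mat_neg[OF X] by (auto simp: qform_neg intro: antisym)
      then have "map_mat F X $$ (i, j) = 0" by (rule qform_zero_imp_zero[OF _ ij])
      then show "F (X $$ (i, j)) = 0" using F.map_mat_index[OF ij X] by simp
    qed
    then show "X $$ (i, j) = mat_zero A n $$ (i, j)" using ij by simp
  qed
qed (simp_all add: P_max_herm P_max_add P_max_scale P_max_conj)

sublocale max: archimedeanizable A unit "P_max S T"
  by (rule archimedeanizable_max)

theorem operator_system_max_tensor: "operator_system (max_tensor S T)"
  unfolding max_tensor_eq_archimedeanization by (rule max.operator_system_archimedeanization)

lemma P_max_subset_max_tensor: "n > 0 \<Longrightarrow> X \<in> P_max S T n \<Longrightarrow> X \<in> mpos (max_tensor S T) n"
  unfolding max_tensor_eq_archimedeanization by (rule max.P_subset_closure)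

end

lemma max_tensor_simps [simp]:
  "carrier (max_tensor S T) = carrier (alg_tensor S T)" "add (max_tensor S T) = add (alg_tensor S T)"
  "zero (max_tensor S T) = zero (alg_tensor S T)" "smult (max_tensor S T) = smult (alg_tensor S T)"
  "invol (max_tensor S T) = invol (alg_tensor S T)" "ounit (max_tensor S T) = pure_tensor S T (ounit S) (ounit T)"
  by (simp_all add: max_tensor_eq_archimedeanization)

text \<open>Compressions of \<open>C \<otimes> D\<close> go to compressions of
  \<open>map_mat f C \<otimes> D\<close> by the same scalar matrix, and unitality carries the
  perturbations along to the closure.\<close>

lemma ucp_tensor_map:
  assumes S: "operator_system S" and S': "operator_system S'" and T: "operator_system T" and f: "ucp S S' f"
  shows "ucp (max_tensor S T) (max_tensor S' T) (tensor_map S' T f id)"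
proof -
  interpret P: op_sys_pair S T using S T by (intro op_sys_pair.intro)
  interpret Q: op_sys_pair S' T using S' T by (intro op_sys_pair.intro)
  have id: "linear_map T T id" by (rule linear_mapI) auto
  note tm = P.tensor_map[OF Q.S.star_vector_space_axioms P.T.star_vector_space_axioms ucpD(1)[OF f] id]
  let ?F = "tensor_map S' T f id"
  interpret F: star_linear_map P.A Q.A ?F by unfold_locales (rule tm(1))
  interpret f: star_linear_map S S' f by (rule ucp_star_linear_map[OF S S' f])
  have Fu: "?F P.unit = Q.unit" by (simp add: tm(2) ucpD(3)[OF f])
  have PQ: "map_mat ?F X \<in> P_max S' T n" if n: "n > 0" and X: "X \<in> P_max S T n" for n X
  proof -
    obtain \<alpha> C D k m where X: "k > 0" "m > 0" "C \<in> mpos S k" "D \<in> mpos T m" "\<alpha> \<in> carrier_mat n (k * m)"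
      "C \<in> mats S k" "D \<in> mats T m" "X = mat_conj P.A \<alpha> (mat_tensor S T C D)" using X by (rule P.P_maxE)
    note M = P.mat_tensor_mats[OF X(6,7)] and fC = f.map_mat_mats[OF X(6)]
    have "map_mat ?F (mat_tensor S T C D) = mat_tensor S' T (map_mat f C) D"
    proof (rule Q.A.mats_eqI[OF F.map_mat_mats[OF M] Q.mat_tensor_mats[OF fC X(7)]])
      fix i j assume ij: "i < k * m" "j < k * m"
      have "i div m < k" "j div m < k" using ij by (auto intro: less_mult_imp_div_less)
      then show "map_mat ?F (mat_tensor S T C D) $$ (i, j) = mat_tensor S' T (map_mat f C) D $$ (i, j)"
        unfolding F.map_mat_index[OF ij M] P.mat_tensor_index[OF X(6,7) ij] Q.mat_tensor_index[OF fC X(7) ij]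
        using X(6) by (simp add: tm(2) f.map_mat_index)
    qed
    then show ?thesis
      using Q.P_maxI[OF n X(1,2) ucpD(2)[OF f X(1,3)] X(4,5)] F.map_mat_conj[OF X(5) M] X(8) by simp
  qed
  show ?thesis
  proof (rule ucpI)
    show "linear_map (max_tensor S T) (max_tensor S' T) ?F"
      using tm(1) by (simp add: linear_map_def)
    show "map_mat ?F X \<in> mpos (max_tensor S' T) n" if n: "n > 0" and X: "X \<in> mpos (max_tensor S T) n" for n X
    proof -
      have Xm: "X \<in> mats P.A n" using X by (simp add: max_tensor_eq_archimedeanization)
      note d = P.A.mat_diag_const_mats[OF P.unit_carrier, of n]
      have "mat_add Q.A (scalar_mat Q.A n r Q.unit) (map_mat ?F X) \<in> P_max S' T n"
        if "r > 0" for r :: real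
      proof -
        have "mat_add P.A (scalar_mat P.A n r P.unit) X \<in> P_max S T n"
          using X that by (simp add: max_tensor_eq_archimedeanization)
        from PQ[OF n this] show ?thesis
          unfolding F.map_mat_add[OF P.A.mat_scale_mats[OF d] Xm] F.map_mat_scale[OF d]
            F.map_mat_diag_const[OF P.unit_carrier] Fu .
      qed
      then show ?thesis
        using F.map_mat_mats[OF Xm] by (simp add: max_tensor_eq_archimedeanization)
    qed
  qed (simp add: Fu)
qed

context op_sys_pair
begin

lemma pure_positive:
  assumes a: "S.positive a" and p: "T.positive p"
  shows "mat 1 1 (\<lambda>_. pure a p) \<in> mpos (max_tensor S T) 1"
proof -
  have "mat_tensor S T (mat 1 1 (\<lambda>_. a)) (mat 1 1 (\<lambda>_. p)) = mat 1 1 (\<lambda>_. pure a p)"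
    by (intro eq_matI) (auto simp: mat_tensor_def Let_def)
  then show ?thesis
    using mat_tensor_mpos_P_max[OF S.one_pos_nat S.one_pos_nat a[unfolded S.positive_def] p[unfolded T.positive_def]]
    by (intro P_max_subset_max_tensor) simp_all
qed

end

section \<open>Comparison of the two inductive limits\<close>

locale tensor_limit =
  fixes S :: "nat \<Rightarrow> 'a op_sys" and \<phi> :: "nat \<Rightarrow> 'a \<Rightarrow> 'a" and T :: "'b op_sys"
    and L :: "'l op_sys" and \<psi> :: "nat \<Rightarrow> 'a \<Rightarrow> 'l"
    and M :: "'m op_sys" and \<chi> :: "nat \<Rightarrow> ('a, 'b) tensor \<Rightarrow> 'm"
  assumes system: "inductive_system S \<phi>"
    and T: "operator_system T"
    and limL: "inductive_limit S \<phi> L \<psi>"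
    and limM: "inductive_limit (\<lambda>k. max_tensor (S k) T)
           (\<lambda>k. tensor_map (S (Suc k)) T (\<phi> k) id) M \<chi>"
begin

sublocale C: op_sys_cocone S \<phi> L \<psi>
  using limL system by (intro op_sys_cocone.intro) (simp_all only: inductive_limit_def)

sublocale LT: op_sys_pair L T
  by (intro op_sys_pair.intro C.L T)

lemma SkT: "op_sys_pair (S k) T"
  by (intro op_sys_pair.intro C.S T)

lemma M: "operator_system M"
  using limM by (simp add: inductive_limit_def)

sublocale M: operator_system M
  by (rule M)

lemma compatM: "compatible_maps (\<lambda>k. max_tensor (S k) T) (\<lambda>k. tensor_map (S (Suc k)) T (\<phi> k) id) M \<chi>"
  using limM by (simp add: inductive_limit_def)

lemma \<chi>: "ucp (max_tensor (S k) T) M (\<chi> k)"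
  using compatible_mapsD(1)[OF compatM] .

lemma \<phi>: "ucp (S k) (S (Suc k)) (\<phi> k)"
  using system by (simp add: inductive_system_def)

lemma \<chi>_linear: "linear_map (alg_tensor (S k) T) M (\<chi> k)"
  using ucpD(1)[OF \<chi>[of k]] by (simp add: linear_map_def)

lemma id_linear: "linear_map T T id"
  by (rule linear_mapI) auto

lemma tensor_map_pure:
  assumes "linear_map (S k) W f" "star_vector_space W"
  shows "tensor_map W T f id (pure_tensor (S k) T x y) = pure_tensor W T (f x) y"
proof -
  interpret Sk: op_sys_pair "S k" T by (rule SkT)
  show ?thesis using Sk.tensor_map_pure[OF assms(2) LT.T.star_vector_space_axioms assms(1) id_linear] by simp
qed

lemma \<chi>_step:
  assumes "x \<in> carrier (S k)" "y \<in> carrier T"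
  shows "\<chi> (Suc k) (pure_tensor (S (Suc k)) T (\<phi> k x) y) = \<chi> k (pure_tensor (S k) T x y)"
proof -
  interpret Sk: op_sys_pair "S k" T by (rule SkT)
  interpret Sk': op_sys_pair "S (Suc k)" T by (rule SkT)
  show ?thesis
    using compatible_mapsD(2)[OF compatM, of "pure_tensor (S k) T x y" k] assms
      tensor_map_pure[OF ucpD(1)[OF \<phi>] Sk'.S.star_vector_space_axioms] by auto
qed

abbreviation \<rho> :: "nat \<Rightarrow> ('a, 'b) tensor \<Rightarrow> ('l, 'b) tensor" where
  "\<rho> k \<equiv> tensor_map L T (\<psi> k) id"

lemma \<rho>_pure: "\<rho> k (pure_tensor (S k) T x y) = LT.pure (\<psi> k x) y"
  by (rule tensor_map_pure[OF ucpD(1)[OF C.\<psi>] C.L.star_vector_space_axioms])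

lemma \<rho>: "ucp (max_tensor (S k) T) (max_tensor L T) (\<rho> k)"
  by (rule ucp_tensor_map[OF C.S C.L T C.\<psi>])

lemma \<rho>_linear: "linear_map (alg_tensor (S k) T) LT.A (\<rho> k)"
  using ucpD(1)[OF \<rho>[of k]] by (simp add: linear_map_def)

lemma compat_\<rho>:
  "compatible_maps (\<lambda>k. max_tensor (S k) T) (\<lambda>k. tensor_map (S (Suc k)) T (\<phi> k) id) (max_tensor L T) \<rho>"
  unfolding compatible_maps_def
proof (intro conjI allI ballI)
  fix k X assume X: "X \<in> carrier (max_tensor (S k) T)"
  interpret Sk: op_sys_pair "S k" T by (rule SkT)
  interpret Sk': op_sys_pair "S (Suc k)" T by (rule SkT)
  let ?t = "tensor_map (S (Suc k)) T (\<phi> k) id"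
  have t: "linear_map Sk.A Sk'.A ?t"
    using ucpD(1)[OF ucp_tensor_map[OF C.S C.S T \<phi>, of k]] by (simp add: linear_map_def)
  have "(\<rho> (Suc k) \<circ> ?t) X = \<rho> k X"
  proof (rule Sk.linear_map_ext[OF linear_map_comp[OF t \<rho>_linear] \<rho>_linear LT.star_vector_space_A])
    show "(\<rho> (Suc k) \<circ> ?t) (Sk.pure x y) = \<rho> k (Sk.pure x y)" if "x \<in> carrier (S k)" "y \<in> carrier T" for x y
      using that tensor_map_pure[OF ucpD(1)[OF \<phi>] Sk'.S.star_vector_space_axioms]
        compatible_mapsD(2)[OF C.compatible] by (simp add: \<rho>_pure)
  qed (use X in simp)
  then show "\<rho> (Suc k) (?t X) = \<rho> k X" by simp
qed (rule \<rho>)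

lemma tensor_system:
  "inductive_system (\<lambda>k. max_tensor (S k) T) (\<lambda>k. tensor_map (S (Suc k)) T (\<phi> k) id)"
  unfolding inductive_system_def
  using op_sys_pair.operator_system_max_tensor[OF SkT] ucp_tensor_map[OF C.S C.S T \<phi>] by blast

sublocale CT: op_sys_cocone "\<lambda>k. max_tensor (S k) T" "\<lambda>k. tensor_map (S (Suc k)) T (\<phi> k) id" "max_tensor L T" \<rho>
  by (intro op_sys_cocone.intro tensor_system LT.operator_system_max_tensor compat_\<rho>)

text \<open>Puts \<open>max_tensor L T\<close> into the universe in which \<open>M\<close> is
  universal: each summand of a tensor comes from some level, and the images of the levels
  increase.\<close>

lemma tensor_carrier_limit: "carrier LT.A \<subseteq> CT.limit_carrier"
proof
  fix X assume "X \<in> carrier LT.A"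
  then show "X \<in> CT.limit_carrier"
  proof (induction rule: LT.tensor_induct)
    case zero
    have "\<rho> 0 (ounit (max_tensor (S 0) T)) \<in> CT.limit_carrier"
      using operator_system.ounit_closed[OF CT.S] by (rule CT.limit_carrierI)
    from CT.limit_carrier_closed(4)[OF this] show ?case by (simp only: max_tensor_simps)
  next
    case (add X x y)
    obtain k a where a: "a \<in> carrier (S k)" "x = \<psi> k a"
      using add.hyps(2) C.inductive_limit_carrier[OF limL] by (auto elim: C.limit_carrierE)
    interpret Sk: op_sys_pair "S k" T by (rule SkT)
    have "LT.pure x y \<in> CT.limit_carrier"
      using CT.limit_carrierI[of "Sk.pure a y" k] a add.hyps(3)
      by (simp only: \<rho>_pure max_tensor_simps Sk.pure_carrier)
    then show ?case using CT.limit_carrier_closed(1)[OF add.IH] by (simp only: max_tensor_simps)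
  qed
qed

lemma to_tensor_exists:
  "\<exists>h. ucp M (max_tensor L T) h \<and> (\<forall>k. \<forall>X\<in>carrier (alg_tensor (S k) T). h (\<chi> k X) = \<rho> k X)"
proof -
  obtain j :: "('l, 'b) tensor \<Rightarrow> nat \<times> ('a, 'b) tensor" where "inj_on j CT.limit_carrier"
    using CT.limit_carrier_inj by auto
  then have "inj_on j (carrier (max_tensor L T))"
    using tensor_carrier_limit by (auto intro: inj_on_subset)
  from inductive_limit_lift[OF limM LT.operator_system_max_tensor compat_\<rho> this] show ?thesis by simp
qed

text \<open>\<open>\<chi>\<^sub>k (a \<otimes> y)\<close> depends only on \<open>\<psi>\<^sub>k a\<close>: for a state \<open>f\<close> of \<open>M\<close> and suitable
  \<open>y \<ge> e\<close>, the functionals \<open>a \<mapsto> f (\<chi>\<^sub>k (a \<otimes> y))\<close> are a positive multiple of a compatible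
  family of states, so they factor through \<open>L\<close>.\<close>

lemma \<chi>_pure_cong_above_unit:
  assumes p: "LT.T.positive p" and a: "a \<in> carrier (S k)" "a' \<in> carrier (S l)" and eq: "\<psi> k a = \<psi> l a'"
  shows "\<chi> k (pure_tensor (S k) T a (ounit T \<oplus>\<^bsub>T\<^esub> p)) = \<chi> l (pure_tensor (S l) T a' (ounit T \<oplus>\<^bsub>T\<^esub> p))"
proof (rule ccontr)
  let ?y = "ounit T \<oplus>\<^bsub>T\<^esub> p"
  have eT: "LT.T.positive (ounit T)" by (rule LT.T.positive_ounit)
  have y: "LT.T.positive ?y" using LT.T.positive_add[OF eT p] .
  have yc: "?y \<in> carrier T" using y by simp
  have \<chi>c: "\<chi> k (pure_tensor (S k) T a q) \<in> carrier M" if "a \<in> carrier (S k)" "q \<in> carrier T" for k a q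
  proof -
    interpret Sk: op_sys_pair "S k" T by (rule SkT)
    show ?thesis using that by (intro linear_mapD(1)[OF \<chi>_linear]) auto
  qed
  assume "\<not> ?thesis"
  then have neq: "\<chi> k (pure_tensor (S k) T a ?y) \<oplus>\<^bsub>M\<^esub> (\<ominus>\<^bsub>M\<^esub> \<chi> l (pure_tensor (S l) T a' ?y)) \<noteq> \<zero>\<^bsub>M\<^esub>"
    using \<chi>c[OF a(1) yc] \<chi>c[OF a(2) yc] by (metis M.minus_equality M.minus_minus M.a_inv_closed)
  obtain f where f: "ucp M complex_sys f"
    "f (\<chi> k (pure_tensor (S k) T a ?y) \<oplus>\<^bsub>M\<^esub> (\<ominus>\<^bsub>M\<^esub> \<chi> l (pure_tensor (S l) T a' ?y))) \<noteq> 0"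
    using states_separate[OF M _ neq] \<chi>c[OF a(1) yc] \<chi>c[OF a(2) yc] by auto
  interpret f: star_linear_map M complex_sys f
    by (rule ucp_star_linear_map[OF M operator_system_complex f(1)])
  define w where "w k a = f (\<chi> k (pure_tensor (S k) T a ?y))" for k a
  have fpos: "0 \<le> f (\<chi> k (pure_tensor (S k) T b q))" if "operator_system.positive (S k) b" "LT.T.positive q" for k b q
  proof -
    interpret Sk: op_sys_pair "S k" T by (rule SkT)
    have "map_mat (\<chi> k) (mat 1 1 (\<lambda>_. Sk.pure b q)) \<in> mpos M 1"
      using ucpD(2)[OF \<chi> M.one_pos_nat Sk.pure_positive[OF that]] .
    moreover have "map_mat (\<chi> k) (mat 1 1 (\<lambda>_. Sk.pure b q)) = mat 1 1 (\<lambda>_. \<chi> k (Sk.pure b q))"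
      by (rule eq_matI) auto
    ultimately have "M.positive (\<chi> k (Sk.pure b q))" by (simp add: M.positive_def)
    then show ?thesis by (rule ucp_complex_positive[OF M f(1)])
  qed
  have w_linear: "linear_map (S k) complex_sys (w k)" for k
  proof -
    interpret Sk: op_sys_pair "S k" T by (rule SkT)
    show ?thesis
      using yc by (intro linear_mapI) (simp_all add: w_def Sk.pure_add_left Sk.pure_smult_left
        linear_mapD(2,3)[OF \<chi>_linear] f.map_add f.map_smult \<chi>c)
  qed
  define c where "c = w 0 (ounit (S 0))"
  have w_step: "w (Suc k) (\<phi> k b) = w k b" if "b \<in> carrier (S k)" for k b
    using \<chi>_step[OF that yc] by (simp add: w_def)
  have w_unit: "w k (ounit (S k)) = c" for k
  proof (induction k)
    case (Suc k)
    then show ?case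
      using w_step[OF operator_system.ounit_closed[OF C.S], of k] ucpD(3)[OF \<phi>, of k] by simp
  qed (simp add: c_def)
  \<comment> \<open>This is the reason for the form \<open>e + p\<close>: the unit contributes 1 and
    \<open>p\<close> something nonnegative, so division by \<open>c\<close> is possible and
    preserves positivity.\<close>
  have c: "c = 1 + f (\<chi> 0 (pure_tensor (S 0) T (ounit (S 0)) p))"
  proof -
    interpret S0: op_sys_pair "S 0" T by (rule SkT)
    have "f (\<chi> 0 S0.unit) = 1" using ucpD(3)[OF \<chi>, of 0] ucpD(3)[OF f(1)] by simp
    then show ?thesis
      using S0.S.ounit_closed LT.T.ounit_closed p
      by (simp add: c_def w_def S0.pure_add_right linear_mapD(2)[OF \<chi>_linear] f.map_add \<chi>c)
  qed
  have cpos: "0 \<le> 1 / c" "c \<noteq> 0"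
    using fpos[OF operator_system.positive_ounit[OF C.S] p, of 0] unfolding c
    by (auto simp: less_eq_complex_def complex_eq_iff Re_divide Im_divide)
  have "compatible_maps S \<phi> complex_sys (\<lambda>k a. (1 / c) * w k a)"
    unfolding compatible_maps_def
  proof (intro conjI allI ballI)
    fix k
    show "ucp (S k) complex_sys (\<lambda>a. (1 / c) * w k a)"
    proof (rule ucp_complexI[OF C.S])
      show "linear_map (S k) complex_sys (\<lambda>a. (1 / c) * w k a)"
        using linear_mapD(2,3)[OF w_linear[of k]] by (intro linear_mapI) (simp_all add: add_divide_distrib)
      show "0 \<le> (1 / c) * w k b" if "operator_system.positive (S k) b" for b
        using fpos[OF that y] cpos(1) unfolding w_def by (rule mult_nonneg_nonneg[rotated])
      show "(1 / c) * w k (ounit (S k)) = 1" using w_unit cpos(2) by simp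
    qed
    show "(1 / c) * w (Suc k) (\<phi> k b) = (1 / c) * w k b" if "b \<in> carrier (S k)" for b
      using w_step[OF that] by simp
  qed
  \<comment> \<open>\<open>c \<noteq> 0\<close> also shows that the unit of \<open>S 0\<close> is
    nonzero, so its multiples embed the complex numbers into the universe of
    \<open>L\<close>.\<close>
  moreover have "inj_on (\<lambda>c. (0::nat, c \<odot>\<^bsub>S 0\<^esub> ounit (S 0))) (carrier complex_sys)"
  proof -
    interpret S0: operator_system "S 0" by (rule C.S)
    have "w 0 \<zero>\<^bsub>S 0\<^esub> = 0"
      using linear_mapD(3)[OF w_linear[of 0] S0.zero_closed, of 0] by simp
    then have "ounit (S 0) \<noteq> \<zero>\<^bsub>S 0\<^esub>" using cpos(2) by (auto simp: c_def)
    from S0.inj_smult_ounit[OF this] show ?thesis by (auto simp: inj_on_def)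
  qed
  ultimately obtain F where F: "\<And>k b. b \<in> carrier (S k) \<Longrightarrow> F (\<psi> k b) = (1 / c) * w k b"
    using inductive_limit_lift[OF limL operator_system_complex] by blast
  have "w k a = w l a'"
    using F[OF a(1)] F[OF a(2)] eq cpos(2) by simp
  then show False
    using f(2) \<chi>c[OF a(1) yc] \<chi>c[OF a(2) yc] by (simp add: w_def f.map_add f.map_neg f.W.neg_eq_smult)
qed

text \<open>The admissible \<open>y\<close> form a complex subspace that contains
  \<open>e + p\<close> for all positive \<open>p\<close>. Taking \<open>p = 0\<close> gives
  \<open>e\<close>, differences give the hermitian elements, and these span
  \<open>T\<close>.\<close>

lemma \<chi>_pure_cong:
  assumes a: "a \<in> carrier (S k)" "a' \<in> carrier (S l)" and eq: "\<psi> k a = \<psi> l a'" and y: "y \<in> carrier T"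
  shows "\<chi> k (pure_tensor (S k) T a y) = \<chi> l (pure_tensor (S l) T a' y)"
proof -
  interpret Sk: op_sys_pair "S k" T by (rule SkT)
  interpret Sl: op_sys_pair "S l" T by (rule SkT)
  define good where "good y \<longleftrightarrow> y \<in> carrier T \<and> \<chi> k (Sk.pure a y) = \<chi> l (Sl.pure a' y)" for y
  have add: "good (y \<oplus>\<^bsub>T\<^esub> y')" if "good y" "good y'" for y y'
    using that a by (simp add: good_def Sk.pure_add_right Sl.pure_add_right linear_mapD(2)[OF \<chi>_linear])
  have smult: "good (c \<odot>\<^bsub>T\<^esub> y)" if "good y" for y c
    using that a by (simp add: good_def Sk.pure_smult_right Sl.pure_smult_right linear_mapD(3)[OF \<chi>_linear])
  have above: "good (ounit T \<oplus>\<^bsub>T\<^esub> p)" if "LT.T.positive p" for p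
    using \<chi>_pure_cong_above_unit[OF that a eq] LT.T.positive_add[OF LT.T.positive_ounit that] by (simp add: good_def)
  have e: "good (ounit T)"
    using above[of "\<zero>\<^bsub>T\<^esub>"] LT.T.positive_scale[OF LT.T.positive_ounit, of 0] LT.T.ounit_closed by simp
  have herm: "good b" if b: "b \<in> LT.T.hermitian" for b
  proof -
    have m: "\<ominus>\<^bsub>T\<^esub> b \<in> LT.T.hermitian"
      using LT.T.hermitian_closed(2)[OF b, of "-1"] b by (simp add: LT.T.neg_eq_smult)
    obtain r where r: "LT.T.positive (complex_of_real r \<odot>\<^bsub>T\<^esub> ounit T \<oplus>\<^bsub>T\<^esub> b)"
      using LT.T.positive_order_unit[OF m] b by auto
    \<comment> \<open>With \<open>p = r e + b\<close>, the element \<open>e + p\<close> exceeds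
      \<open>b\<close> by \<open>(r + 1) e\<close>, which is subtracted here.\<close>
    have "good ((ounit T \<oplus>\<^bsub>T\<^esub> (complex_of_real r \<odot>\<^bsub>T\<^esub> ounit T \<oplus>\<^bsub>T\<^esub> b)) \<oplus>\<^bsub>T\<^esub> (- complex_of_real (r + 1)) \<odot>\<^bsub>T\<^esub> ounit T)"
      by (intro add above smult e r)
    also have "(ounit T \<oplus>\<^bsub>T\<^esub> (complex_of_real r \<odot>\<^bsub>T\<^esub> ounit T \<oplus>\<^bsub>T\<^esub> b)) \<oplus>\<^bsub>T\<^esub> (- complex_of_real (r + 1)) \<odot>\<^bsub>T\<^esub> ounit T =
      b \<oplus>\<^bsub>T\<^esub> (1 \<odot>\<^bsub>T\<^esub> ounit T \<oplus>\<^bsub>T\<^esub> (complex_of_real r \<odot>\<^bsub>T\<^esub> ounit T \<oplus>\<^bsub>T\<^esub> (- complex_of_real (r + 1)) \<odot>\<^bsub>T\<^esub> ounit T))"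
      using b LT.T.ounit_closed by (simp add: LT.T.a_ac)
    also have "\<dots> = b"
      using b LT.T.ounit_closed by (simp add: LT.T.smult_add_left[symmetric] del: LT.T.smult_one)
    finally show ?thesis .
  qed
  obtain b c where "b \<in> LT.T.hermitian" "c \<in> LT.T.hermitian" "y = b \<oplus>\<^bsub>T\<^esub> \<i> \<odot>\<^bsub>T\<^esub> c"
    using LT.T.re_im_hermitian[OF y] LT.T.re_im_decomposition[OF y] by blast
  then have "good y" using add smult herm by simp
  then show ?thesis by (simp add: good_def)
qed

text \<open>The bilinear map is defined by chosen representatives and does not depend on them by
  \<open>\<chi>_pure_cong\<close>. Additivity in the first variable is checked on a level that
  contains representatives of both summands.\<close>

lemma from_tensor_exists:
  "\<exists>g. linear_map LT.A M g \<and>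
    (\<forall>k. \<forall>a\<in>carrier (S k). \<forall>y\<in>carrier T. g (LT.pure (\<psi> k a) y) = \<chi> k (pure_tensor (S k) T a y))"
proof -
  define rep where "rep z = (SOME p. snd p \<in> carrier (S (fst p)) \<and> \<psi> (fst p) (snd p) = z)" for z
  have rep: "snd (rep z) \<in> carrier (S (fst (rep z)))" "\<psi> (fst (rep z)) (snd (rep z)) = z"
    if z: "z \<in> C.limit_carrier" for z
  proof -
    have "\<exists>p. snd p \<in> carrier (S (fst p)) \<and> \<psi> (fst p) (snd p) = z"
      using z by (auto simp: C.limit_carrier_def)
    from someI_ex[OF this] show "snd (rep z) \<in> carrier (S (fst (rep z)))" "\<psi> (fst (rep z)) (snd (rep z)) = z"
      unfolding rep_def by auto
  qed
  define b where "b z y = \<chi> (fst (rep z)) (pure_tensor (S (fst (rep z))) T (snd (rep z)) y)" for z y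
  have b: "b (\<psi> k a) y = \<chi> k (pure_tensor (S k) T a y)" if "a \<in> carrier (S k)" "y \<in> carrier T" for k a y
    unfolding b_def using rep[OF C.limit_carrierI[OF that(1)]] that by (intro \<chi>_pure_cong) auto
  note carrier = C.inductive_limit_carrier[OF limL]
  have "\<exists>g. linear_map LT.A M g \<and> (\<forall>x\<in>carrier L. \<forall>y\<in>carrier T. g (LT.pure x y) = b x y)"
  proof (rule LT.tensor_lift_exists[OF M.star_vector_space_axioms])
    fix x y assume x: "x \<in> carrier L" and y: "y \<in> carrier T"
    obtain k a where a: "a \<in> carrier (S k)" "x = \<psi> k a" using x carrier by (auto elim: C.limit_carrierE)
    interpret Sk: op_sys_pair "S k" T by (rule SkT)
    have smult_\<psi>: "c \<odot>\<^bsub>L\<^esub> x = \<psi> k (c \<odot>\<^bsub>S k\<^esub> a)" for c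
      using linear_mapD(3)[OF ucpD(1)[OF C.\<psi>] a(1)] a(2) by simp
    show "b x y \<in> carrier M" using a y by (simp add: b linear_mapD(1)[OF \<chi>_linear])
    show "b (c \<odot>\<^bsub>L\<^esub> x) y = c \<odot>\<^bsub>M\<^esub> b x y" for c
      unfolding smult_\<psi> using a y by (simp add: b Sk.pure_smult_left linear_mapD(3)[OF \<chi>_linear])
    show "b x (c \<odot>\<^bsub>T\<^esub> y) = c \<odot>\<^bsub>M\<^esub> b x y" for c
      using a y by (simp add: b Sk.pure_smult_right linear_mapD(3)[OF \<chi>_linear])
    show "b x (y \<oplus>\<^bsub>T\<^esub> y') = b x y \<oplus>\<^bsub>M\<^esub> b x y'" if "y' \<in> carrier T" for y'
      using a y that by (simp add: b Sk.pure_add_right linear_mapD(2)[OF \<chi>_linear])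
  next
    fix x x' y assume x: "x \<in> carrier L" "x' \<in> carrier L" and y: "y \<in> carrier T"
    obtain k a a' where a: "a \<in> carrier (S k)" "a' \<in> carrier (S k)" "x = \<psi> k a" "x' = \<psi> k a'"
      using x C.limit_carrier_common unfolding carrier by metis
    interpret Sk: op_sys_pair "S k" T by (rule SkT)
    have "x \<oplus>\<^bsub>L\<^esub> x' = \<psi> k (a \<oplus>\<^bsub>S k\<^esub> a')"
      using linear_mapD(2)[OF ucpD(1)[OF C.\<psi>] a(1,2)] a(3,4) by simp
    then show "b (x \<oplus>\<^bsub>L\<^esub> x') y = b x y \<oplus>\<^bsub>M\<^esub> b x' y"
      using a y by (simp add: b Sk.pure_add_left linear_mapD(2)[OF \<chi>_linear])
  qed
  then show ?thesis using b by (metis C.\<psi>_carrier)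
qed

section \<open>Complete positivity of the map from the tensor product to the limit\<close>

context
  fixes g
  assumes g: "linear_map LT.A M g"
    and g_pure: "\<And>k a y. a \<in> carrier (S k) \<Longrightarrow> y \<in> carrier T \<Longrightarrow> g (LT.pure (\<psi> k a) y) = \<chi> k (pure_tensor (S k) T a y)"
begin

interpretation g: star_linear_map LT.A M g
  by unfold_locales (rule g)

lemma g_unit: "g LT.unit = ounit M"
  using g_pure[OF operator_system.ounit_closed[OF C.S] LT.T.ounit_closed, of 0]
    ucpD(3)[OF C.\<psi>, of 0] ucpD(3)[OF \<chi>, of 0] by simp

text \<open>If \<open>C\<close> is the image of a positive matrix over \<open>S l\<close>, then
  applying \<open>g\<close> to \<open>C \<otimes> D\<close> amounts to applying
  \<open>\<chi> l\<close> to a tensor product over \<open>S l\<close>, and \<open>\<chi> l\<close>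
  is completely positive.\<close>

lemma g_limit_cone:
  assumes k: "k > 0" "m > 0" and C: "C \<in> C.limit_cone k" and D: "D \<in> mpos T m"
  shows "map_mat g (mat_tensor L T C D) \<in> mpos M (k * m)"
proof -
  obtain l C' where C': "C' \<in> mpos (S l) k" "C = map_mat (\<psi> l) C'" using C by (rule C.limit_coneE)
  interpret Sl: op_sys_pair "S l" T by (rule SkT)
  interpret \<psi>l: star_linear_map "S l" L "\<psi> l" by (rule C.\<psi>_map)
  note Cm = Sl.S.mpos_mats[OF k(1) C'(1)] and Dm = LT.T.mpos_mats[OF k(2) D]
  note \<psi>C = \<psi>l.map_mat_mats[OF Cm]
  have "map_mat g (mat_tensor L T (map_mat (\<psi> l) C') D) = map_mat (\<chi> l) (mat_tensor (S l) T C' D)"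
  proof (rule eq_matI)
    fix i j assume "i < dim_row (map_mat (\<chi> l) (mat_tensor (S l) T C' D))" "j < dim_col (map_mat (\<chi> l) (mat_tensor (S l) T C' D))"
    then have ij: "i < k * m" "j < k * m" using Sl.A.mats_dim[OF Sl.mat_tensor_mats[OF Cm Dm]] by simp_all
    note e = Sl.mat_tensor_entries[OF Cm Dm ij]
    have d: "i div m < k" "j div m < k" using ij by (auto intro: less_mult_imp_div_less)
    have "map_mat g (mat_tensor L T (map_mat (\<psi> l) C') D) $$ (i, j) = g (LT.pure (\<psi> l (C' $$ (i div m, j div m))) (D $$ (i mod m, j mod m)))"
      unfolding g.map_mat_index[OF ij LT.mat_tensor_mats[OF \<psi>C Dm]] LT.mat_tensor_index[OF \<psi>C Dm ij]
        \<psi>l.map_mat_index[OF d Cm] ..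
    also have "\<dots> = map_mat (\<chi> l) (mat_tensor (S l) T C' D) $$ (i, j)"
      using ij Sl.A.mats_dim[OF Sl.mat_tensor_mats[OF Cm Dm]]
      by (simp add: g_pure[OF e] Sl.mat_tensor_index[OF Cm Dm ij])
    finally show "map_mat g (mat_tensor L T (map_mat (\<psi> l) C') D) $$ (i, j) = map_mat (\<chi> l) (mat_tensor (S l) T C' D) $$ (i, j)" .
  qed (use Sl.A.mats_dim[OF Sl.mat_tensor_mats[OF Cm Dm]] LT.A.mats_dim[OF LT.mat_tensor_mats[OF \<psi>C Dm]] in simp_all)
  moreover have "mat_tensor (S l) T C' D \<in> mpos (max_tensor (S l) T) (k * m)"
    using k by (intro Sl.P_max_subset_max_tensor Sl.mat_tensor_mpos_P_max C'(1) D) auto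
  ultimately show ?thesis
    using ucpD(2)[OF \<chi>, of "k * m"] k C'(2) by simp
qed

text \<open>For arbitrary positive \<open>C\<close> only the perturbations \<open>t E + C\<close>
  come from a level. They yield positivity of the image of \<open>C \<otimes> D\<close> up to
  \<open>t B\<close>, where \<open>B\<close> is the image of \<open>E \<otimes> D\<close>; since
  \<open>B\<close> does not depend on \<open>t\<close>, the Archimedean property removes it.\<close>

lemma g_mat_tensor:
  assumes k: "k > 0" "m > 0" and C: "C \<in> mpos L k" and D: "D \<in> mpos T m"
  shows "map_mat g (mat_tensor L T C D) \<in> mpos M (k * m)"
proof -
  have km: "k * m > 0" using k by simp
  note Cm = C.L.mpos_mats[OF k(1) C] and Dm = LT.T.mpos_mats[OF k(2) D]
  define E where "E = mat_diag_const L k (ounit L)"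
  have Em: "E \<in> mats L k" unfolding E_def by (rule C.L.mat_diag_const_mats[OF C.L.ounit_closed])
  have E_cone: "E \<in> C.limit_cone k"
  proof -
    interpret S0: operator_system "S 0" by (rule C.S)
    have "mat_diag_const (S 0) k (ounit (S 0)) \<in> mpos (S 0) k"
    proof -
      note d = S0.mat_diag_const_mats[OF S0.ounit_closed, of k]
      have "mat_scale (S 0) (complex_of_real 1) (mat_diag_const (S 0) k (ounit (S 0))) = mat_diag_const (S 0) k (ounit (S 0))"
        by (rule S0.mats_eqI[OF S0.mat_scale_mats[OF d] d])
          (use S0.ounit_closed in \<open>simp add: S0.mat_index(4)[OF _ _ d]\<close>)
      then show ?thesis using S0.mat_unit_mpos[OF k(1), of 1] by simp
    qed
    from C.limit_coneI[OF this] show ?thesis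
      using star_linear_map.map_mat_diag_const[OF C.\<psi>_map S0.ounit_closed, of k] ucpD(3)[OF C.\<psi>, of 0]
      by (simp add: E_def)
  qed
  define B where "B = map_mat g (mat_tensor L T E D)"
  have B: "B \<in> mpos M (k * m)" unfolding B_def by (rule g_limit_cone[OF k E_cone D])
  note Bm = M.mpos_mats[OF km B]
  \<comment> \<open>\<open>B\<close> is not a multiple of the unit because \<open>D\<close> is
    arbitrary, but it is bounded by \<open>R e\<close>; \<open>t = r / R\<close> then turns the
    perturbation \<open>t B\<close> into \<open>r e\<close>.\<close>
  obtain R where R: "R > 0"
    "mat_add M (scalar_mat M (k * m) R (ounit M)) (mat_neg M B) \<in> mpos M (k * m)"
    using M.matrix_order_unit[OF km, of B] M.mpos_herm[OF km] B by auto
  note gm = g.map_mat_mats[OF LT.mat_tensor_mats[OF Cm Dm]]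
  show ?thesis
  proof (rule M.archimedean[OF km gm])
    fix r :: real assume r: "r > 0"
    define t where "t = r / R"
    have t: "t > 0" "t * R = r" using r R(1) by (auto simp: t_def)
    have tEC: "mat_add L (mat_scale L (complex_of_real t) E) C \<in> C.limit_cone k"
      unfolding E_def by (rule C.inductive_limit_mpos[OF limL k(1) C t(1)])
    note tE = C.L.mat_scale_mats[OF Em, of "complex_of_real t"]
    note X = C.L.mat_add_mats[OF tE Cm]
    have "map_mat g (mat_tensor L T (mat_add L (mat_scale L (complex_of_real t) E) C) D) =
      mat_add M (mat_scale M (complex_of_real t) B) (map_mat g (mat_tensor L T C D))"
    proof (rule M.mats_eqI)
      fix i j assume ij: "i < k * m" "j < k * m"
      have d: "i div m < k" "j div m < k" using ij by (auto intro: less_mult_imp_div_less)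
      note e = LT.mat_tensor_entries[OF Cm Dm ij] LT.mat_tensor_entries(1)[OF Em Dm ij]
      show "map_mat g (mat_tensor L T (mat_add L (mat_scale L (complex_of_real t) E) C) D) $$ (i, j) =
        mat_add M (mat_scale M (complex_of_real t) B) (map_mat g (mat_tensor L T C D)) $$ (i, j)"
        unfolding g.map_mat_index[OF ij LT.mat_tensor_mats[OF X Dm]] LT.mat_tensor_index[OF X Dm ij]
          M.mat_index(2)[OF ij M.mat_scale_mats[OF Bm]] M.mat_index(4)[OF ij Bm]
          C.L.mat_index(2)[OF d tE] C.L.mat_index(4)[OF d Em]
          g.map_mat_index[OF ij LT.mat_tensor_mats[OF Cm Dm]] LT.mat_tensor_index[OF Cm Dm ij]
        unfolding B_def g.map_mat_index[OF ij LT.mat_tensor_mats[OF Em Dm]] LT.mat_tensor_index[OF Em Dm ij]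
        using e by (simp add: LT.pure_add_left LT.pure_smult_left g.map_add g.map_smult)
    qed (use X Dm Bm gm in \<open>auto intro: g.map_mat_mats LT.mat_tensor_mats\<close>)
    with g_limit_cone[OF k tEC D]
    have tB: "mat_add M (mat_scale M (complex_of_real t) B) (map_mat g (mat_tensor L T C D)) \<in> mpos M (k * m)" by simp
    show "mat_add M (scalar_mat M (k * m) r (ounit M))
      (map_mat g (mat_tensor L T C D)) \<in> mpos M (k * m)"
      unfolding M.mat_dominated[OF M.mat_diag_const_mats[OF M.ounit_closed] Bm gm t(2)]
      by (rule M.mpos_add[OF km M.mpos_scale[OF km R(2)] tB]) (use t(1) in simp)
  qed
qed

lemma g_ucp: "ucp (max_tensor L T) M g"
proof (rule ucpI)
  show "linear_map (max_tensor L T) M g" using g by (simp add: linear_map_def)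
  show "g (ounit (max_tensor L T)) = ounit M" using g_unit by simp
  fix n :: nat and X assume n: "n > 0" and X: "X \<in> mpos (max_tensor L T) n"
  have P: "map_mat g Y \<in> mpos M n" if Y: "Y \<in> P_max L T n" for Y
  proof -
    obtain \<alpha> C D k m where Y: "k > 0" "m > 0" "C \<in> mpos L k" "D \<in> mpos T m" "\<alpha> \<in> carrier_mat n (k * m)"
      "C \<in> mats L k" "D \<in> mats T m" "Y = mat_conj LT.A \<alpha> (mat_tensor L T C D)" using Y by (rule LT.P_maxE)
    show ?thesis
      unfolding Y(8) g.map_mat_conj[OF Y(5) LT.mat_tensor_mats[OF Y(6,7)]]
      using Y(1,2) by (intro M.mpos_conj[OF n _ Y(5)] g_mat_tensor Y(3,4)) auto
  qed
  have Xm: "X \<in> mats LT.A n" using X by (simp add: max_tensor_eq_archimedeanization)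
  note d = LT.A.mat_diag_const_mats[OF LT.unit_carrier, of n]
  show "map_mat g X \<in> mpos M n"
  proof (rule M.archimedean[OF n g.map_mat_mats[OF Xm]])
    fix r :: real assume "r > 0"
    then have "mat_add LT.A (scalar_mat LT.A n r LT.unit) X \<in> P_max L T n"
      using X by (simp add: max_tensor_eq_archimedeanization)
    from P[OF this] show "mat_add M (scalar_mat M n r (ounit M)) (map_mat g X) \<in> mpos M n"
      unfolding g.map_mat_add[OF LT.A.mat_scale_mats[OF d] Xm] g.map_mat_scale[OF d]
        g.map_mat_diag_const[OF LT.unit_carrier] g_unit .
  qed
qed

end

lemma tensor_limit_isomorphic: "uco_isomorphic M (max_tensor L T)"
proof -
  obtain h where h: "ucp M (max_tensor L T) h"
    "\<And>k X. X \<in> carrier (alg_tensor (S k) T) \<Longrightarrow> h (\<chi> k X) = \<rho> k X"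
    using to_tensor_exists by blast
  obtain g where g: "linear_map LT.A M g"
    "\<And>k a y. a \<in> carrier (S k) \<Longrightarrow> y \<in> carrier T \<Longrightarrow> g (LT.pure (\<psi> k a) y) = \<chi> k (pure_tensor (S k) T a y)"
    using from_tensor_exists by blast
  note gu = g_ucp[OF g]
  have hl: "linear_map M LT.A h" using ucpD(1)[OF h(1)] by (simp add: linear_map_def)
  have hg: "h (g X) = X" if X: "X \<in> carrier LT.A" for X
  proof -
    have "linear_map LT.A LT.A id" by (rule linear_mapI) auto
    moreover have "(h \<circ> g) (LT.pure x y) = id (LT.pure x y)" if xy: "x \<in> carrier L" "y \<in> carrier T" for x y
    proof -
      obtain k a where a: "a \<in> carrier (S k)" "x = \<psi> k a"
        using xy(1) C.inductive_limit_carrier[OF limL] by (auto elim: C.limit_carrierE)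
      interpret Sk: op_sys_pair "S k" T by (rule SkT)
      show ?thesis using g(2)[OF a(1) xy(2)] h(2)[of "Sk.pure a y" k] a xy by (simp add: \<rho>_pure)
    qed
    ultimately have "(h \<circ> g) X = id X"
      using LT.linear_map_ext[OF linear_map_comp[OF g(1) hl] _ LT.star_vector_space_A _ X] by blast
    then show ?thesis by simp
  qed
  have "(g \<circ> h) z = z" if z: "z \<in> carrier M" for z
  proof (rule inductive_limit_endo_identity[OF limM ucp_comp[OF h(1) gu] _ _ z])
    fix k X assume X: "X \<in> carrier (max_tensor (S k) T)"
    interpret Sk: op_sys_pair "S k" T by (rule SkT)
    have "(g \<circ> \<rho> k) X = \<chi> k X"
    proof (rule Sk.linear_map_ext[OF linear_map_comp[OF \<rho>_linear g(1)] \<chi>_linear M.star_vector_space_axioms])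
      show "(g \<circ> \<rho> k) (Sk.pure x y) = \<chi> k (Sk.pure x y)" if "x \<in> carrier (S k)" "y \<in> carrier T" for x y
        using g(2)[OF that] by (simp add: \<rho>_pure)
    qed (use X in simp)
    then show "(g \<circ> h) (\<chi> k X) = \<chi> k X" using h(2) X by simp
  next
    \<comment> \<open>The type of tensors always has room for the complex numbers: singletons of
      formal multiples of one symbol. They need not be tensors, as only the type matters
      here.\<close>
    have "inj (\<lambda>c :: complex. (0 :: nat, {Poly_Mapping.single (undefined :: 'a \<times> 'b) c}))"
      by (rule injI) (auto dest: injD[OF inj_single])
    then show "\<exists>j :: complex \<Rightarrow> nat \<times> ('a, 'b) tensor. inj j" by blast
  qed
  then have gh: "g (h z) = z" if "z \<in> carrier M" for z using that by simp
  have "bij_betw h (carrier M) (carrier (max_tensor L T))"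
    using gh hg linear_mapD(1)[OF hl] linear_mapD(1)[OF g(1)]
    by (intro bij_betw_byWitness[of _ g]) auto
  moreover have "completely_positive (max_tensor L T) M (inv_into (carrier M) h)"
  proof -
    have inv: "inv_into (carrier M) h X = g X" if "X \<in> carrier LT.A" for X
      using that hg gh linear_mapD(1)[OF g(1) that] calculation
      by (metis bij_betw_def inv_into_f_f)
    have "map_mat (inv_into (carrier M) h) X = map_mat g X" if "n > 0" "X \<in> mpos (max_tensor L T) n" for n X
      using that inv LT.A.mats_closed by (intro eq_matI) (auto simp: max_tensor_eq_archimedeanization)
    then show ?thesis
      using gu inv by (simp add: ucp_def completely_positive_def linear_map_def Pi_iff)
  qed
  ultimately have "unital_complete_order_iso M (max_tensor L T) h"
    using h(1) by (simp add: unital_complete_order_iso_def)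
  then show ?thesis by (auto simp: uco_isomorphic_def)
qed

end

theorem theorem4p35:
  fixes S :: "nat \<Rightarrow> 'a op_sys" and \<phi> :: "nat \<Rightarrow> 'a \<Rightarrow> 'a"
    and T :: "'b op_sys"
    and L :: "'l op_sys" and \<psi> :: "nat \<Rightarrow> 'a \<Rightarrow> 'l"
    and M :: "'m op_sys" and \<chi> :: "nat \<Rightarrow> ('a, 'b) tensor \<Rightarrow> 'm"
  assumes "inductive_system S \<phi>"
    and "operator_system T"
    and "inductive_limit S \<phi> L \<psi>"
    and "inductive_limit (\<lambda>k. max_tensor (S k) T)
           (\<lambda>k. tensor_map (S (Suc k)) T (\<phi> k) id) M \<chi>"
  shows "uco_isomorphic M (max_tensor L T)"
  using assms by (rule tensor_limit.tensor_limit_isomorphic[OF tensor_limit.intro])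

end
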